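(* Let $k$ be a commutative ring, $A$ a non-degenerate idempotent $k$-projective algebra and $B$ any algebra. Then there is a bijective correspondence between the following sets of data: (i) non-degenerate idempotent ($k$-projective) $B$-extension structures on $A$; (ii) algebra maps $f:B\to\mathbb{M}(A)$ such that $A$ is a non-degenerate idempotent ($k$-projective) $B$-bimodule with $B$-actions induced by $f$, i.e. $b\cdot a=f(b)\rhd a$ and $a\cdot b=a\lhd f(b)$; (iii) triples of functors $F:A\text{-}\mathsf{Ext}\to B\text{-}\mathsf{Ext}$, $F_r:\mathcal{M}_A\to\mathcal{M}_B$, $F_\ell:{}_A\mathcal{M}\to{}_B\mathcal{M}$ which render commutative the diagram formed with the forgetful functors, i.e. $F$ followed by the forgetful functor $B\text{-}\mathsf{Ext}\to\mathcal{M}_B$ (resp. $B\text{-}\mathsf{Ext}\to{}_B\mathcal{M}$) equals the forgetful functor $A\text{-}\mathsf{Ext}\to\mathcal{M}_A$ followed by $F_r$ (resp. $A\text{-}\mathsf{Ext}\to{}_A\mathcal{M}$ followed by $F_\ell$), and $F_r$, $F_\ell$ commute with the forgetful functors to $\mathcal{M}_k$; (iv) functors $F:A\text{-}\mathsf{Ext}\to B\text{-}\mathsf{Ext}$ which commute with the forgetful functors $A\text{-}\mathsf{Ext}\to\mathcal{M}_k$ and $B\text{-}\mathsf{Ext}\to\mathcal{M}_k$. In any of these equivalent situations, the map $f:B\to\mathbb{M}(A)$ from (ii) can be extended uniquely to a unital algebra morphism $\bar f:\mathbb{M}(B)\to\mathbb{M}(A)$ such that $\bar f\circ\iota_B=f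$.
   Context: Conventions. All modules are $k$-modules, linear means $k$-linear, $\otimes=\otimes_k$. An algebra is a $k$-module $A$ with an associative linear multiplication (no unit assumed); an algebra map is a linear multiplicative map. $A$ is idempotent if $A=A^2$ (finite sums of products); non-degenerate if for every $a\in A$: $a=0$ whenever $ab=0$ for all $b\in A$, and $a=0$ whenever $ba=0$ for all $b\in A$; $k$-projective if projective as a $k$-module. A right $A$-module $M$ (a $k$-module with associative linear action) is idempotent if $M=MA$ (finite sums), non-degenerate if $m=0$ whenever $ma=0$ for all $a\in A$; similarly for left modules; a bimodule has such a property if it has it on both sides. $\mathcal{M}_A$ (resp. ${}_A\mathcal{M}$) is the category of non-degenerate idempotent $k$-projective right (resp. left) $A$-modules with $A$-linear maps; $\mathcal{M}_k$ is the category of $k$-modules. An algebra $R$ is an extension of an algebra $B$ if $R$ is a $B$-bimodule whose multiplication is $B$-bilinear and $B$-balanced, i.e. $(r\cdot b)r'=r(b\cdot r')$. It is a non-degenerate (idempotent, $k$-projective) extension if $R$ is so as a $B$-bimodule. $B\text{-}\mathsf{Ext}$ is the category of non-degenerate idempotent $k$-projective extensions of $B$, with $B$-bilinear algebra maps as morphisms. $\mathbb{M}(A)$ (multiplier algebra) is the set of pairs $x=(\lambda,\rho)$ with $\lambda:A\to A$ right $A$-linear, $\rho:A\to A$ left $A$-linear and $a\lambda(b)=\rho(a)b$ for all $a,b\in A$; it is a unital algebra with product $(\lambda_x\circ\lambda_y,\rho_y\circ\rho_x)$ and unit $(\mathrm{id}_A,\mathrm{id}_A)$. Write $x\rhd a=\lambda(a)$,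 $a\lhd x=\rho(a)$, and $\iota_A:A\to\mathbb{M}(A)$, $\iota_A(a)=(b\mapsto ab,\ b\mapsto ba)$.
   Formalization: In (iii) and (iv) the functors F are also required to keep the multiplication of each extension (only actions change); without this, zeroing multiplications is an extra functor for k=A=B a field. Objects of the categories lie in a fixed, arbitrary infinite universe containing A. *)

theory Defs
  imports "HOL-Algebra.Module" "HOL-Library.FuncSet"
begin

text \<open>
  Both \<open>k\<close>-modules and (not necessarily unital) \<open>k\<close>-algebras are represented by the record
  \<open>module\<close> of HOL-Algebra. For a module the fields \<open>mult\<close> and \<open>one\<close> are ignored, for a non-unital
  algebra the field \<open>one\<close> is ignored.
\<close>

section \<open>Modules, algebras, bimodules\<close>

definition linear_map ::
  "('k, 'z) ring_scheme \<Rightarrow> ('k, 'm) module \<Rightarrow> ('k, 'n) module \<Rightarrow> ('m \<Rightarrow> 'n) \<Rightarrow> bool" where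
  "linear_map k M N h \<longleftrightarrow>
     h \<in> carrier M \<rightarrow> carrier N \<and>
     (\<forall>x\<in>carrier M. \<forall>y\<in>carrier M. h (x \<oplus>\<^bsub>M\<^esub> y) = h x \<oplus>\<^bsub>N\<^esub> h y) \<and>
     (\<forall>c\<in>carrier k. \<forall>x\<in>carrier M. h (c \<odot>\<^bsub>M\<^esub> x) = c \<odot>\<^bsub>N\<^esub> h x)"

definition bilinear_map ::
  "('k, 'z) ring_scheme \<Rightarrow> ('k, 'm) module \<Rightarrow> ('k, 'n) module \<Rightarrow> ('k, 'p) module
    \<Rightarrow> ('m \<Rightarrow> 'n \<Rightarrow> 'p) \<Rightarrow> bool" where
  "bilinear_map k M N P f \<longleftrightarrow>
     (\<forall>x\<in>carrier M. linear_map k N P (\<lambda>y. f x y)) \<and>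
     (\<forall>y\<in>carrier N. linear_map k M P (\<lambda>x. f x y))"

text \<open>
  Projectivity is the lifting property. A HOL definition cannot quantify over the types of the two
  test modules; the ones used here are large enough that the lifting property holds for modules
  over arbitrary types, see \<open>projective_lift\<close> below.
\<close>

definition projective :: "('k, 'z) ring_scheme \<Rightarrow> ('k, 'u) module \<Rightarrow> bool" where
  "projective k P \<longleftrightarrow> module k P \<and>
     (\<forall>(M :: ('k, 'u \<Rightarrow> 'k) module) (N :: ('k, 'u) module) g h.
        module k M \<and> module k N \<and> linear_map k M N g \<and> g ` carrier M = carrier N \<and>
        linear_map k P N h \<longrightarrow>
        (\<exists>h'. linear_map k P M h' \<and> (\<forall>x\<in>carrier P. g (h' x) = h x)))"

definition finite_sums :: "('k, 'm) module \<Rightarrow> 'm set \<Rightarrow> 'm set" where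
  "finite_sums M S = {finsum M s {..<n} | s (n::nat). s \<in> {..<n} \<rightarrow> S}"

definition nonunital_algebra :: "('k, 'z) ring_scheme \<Rightarrow> ('k, 'a) module \<Rightarrow> bool" where
  "nonunital_algebra k A \<longleftrightarrow> module k A \<and>
     bilinear_map k A A A (\<lambda>a b. a \<otimes>\<^bsub>A\<^esub> b) \<and>
     (\<forall>a\<in>carrier A. \<forall>b\<in>carrier A. \<forall>c\<in>carrier A.
        (a \<otimes>\<^bsub>A\<^esub> b) \<otimes>\<^bsub>A\<^esub> c = a \<otimes>\<^bsub>A\<^esub> (b \<otimes>\<^bsub>A\<^esub> c))"

definition algebra_map ::
  "('k, 'z) ring_scheme \<Rightarrow> ('k, 'a) module \<Rightarrow> ('k, 'b) module \<Rightarrow> ('a \<Rightarrow> 'b) \<Rightarrow> bool" where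
  "algebra_map k A B f \<longleftrightarrow> linear_map k A B f \<and>
     (\<forall>x\<in>carrier A. \<forall>y\<in>carrier A. f (x \<otimes>\<^bsub>A\<^esub> y) = f x \<otimes>\<^bsub>B\<^esub> f y)"

definition idempotent_algebra :: "('k, 'a) module \<Rightarrow> bool" where
  "idempotent_algebra A \<longleftrightarrow>
     carrier A = finite_sums A {a \<otimes>\<^bsub>A\<^esub> b | a b. a \<in> carrier A \<and> b \<in> carrier A}"

definition nondegenerate_algebra :: "('k, 'a) module \<Rightarrow> bool" where
  "nondegenerate_algebra A \<longleftrightarrow>
     (\<forall>a\<in>carrier A. ((\<forall>b\<in>carrier A. a \<otimes>\<^bsub>A\<^esub> b = \<zero>\<^bsub>A\<^esub>) \<longrightarrow> a = \<zero>\<^bsub>A\<^esub>) \<and>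
                    ((\<forall>b\<in>carrier A. b \<otimes>\<^bsub>A\<^esub> a = \<zero>\<^bsub>A\<^esub>) \<longrightarrow> a = \<zero>\<^bsub>A\<^esub>))"

text \<open>Left actions are written \<open>l a m\<close> (for \<open>a \<cdot> m\<close>) and right actions \<open>r m a\<close> (for \<open>m \<cdot> a\<close>).\<close>

definition left_module ::
  "('k, 'z) ring_scheme \<Rightarrow> ('k, 'a) module \<Rightarrow> ('k, 'm) module \<Rightarrow> ('a \<Rightarrow> 'm \<Rightarrow> 'm) \<Rightarrow> bool" where
  "left_module k A M l \<longleftrightarrow> module k M \<and> bilinear_map k A M M l \<and>
     (\<forall>a\<in>carrier A. \<forall>b\<in>carrier A. \<forall>m\<in>carrier M. l (a \<otimes>\<^bsub>A\<^esub> b) m = l a (l b m))"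

definition right_module ::
  "('k, 'z) ring_scheme \<Rightarrow> ('k, 'a) module \<Rightarrow> ('k, 'm) module \<Rightarrow> ('m \<Rightarrow> 'a \<Rightarrow> 'm) \<Rightarrow> bool" where
  "right_module k A M r \<longleftrightarrow> module k M \<and> bilinear_map k M A M r \<and>
     (\<forall>a\<in>carrier A. \<forall>b\<in>carrier A. \<forall>m\<in>carrier M. r m (a \<otimes>\<^bsub>A\<^esub> b) = r (r m a) b)"

definition bimodule ::
  "('k, 'z) ring_scheme \<Rightarrow> ('k, 'a) module \<Rightarrow> ('k, 'm) module
    \<Rightarrow> ('a \<Rightarrow> 'm \<Rightarrow> 'm) \<Rightarrow> ('m \<Rightarrow> 'a \<Rightarrow> 'm) \<Rightarrow> bool" where
  "bimodule k A M l r \<longleftrightarrow> left_module k A M l \<and> right_module k A M r \<and>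
     (\<forall>a\<in>carrier A. \<forall>b\<in>carrier A. \<forall>m\<in>carrier M. r (l a m) b = l a (r m b))"

definition left_idempotent ::
  "('k, 'a) module \<Rightarrow> ('k, 'm) module \<Rightarrow> ('a \<Rightarrow> 'm \<Rightarrow> 'm) \<Rightarrow> bool" where
  "left_idempotent A M l \<longleftrightarrow>
     carrier M = finite_sums M {l a m | a m. a \<in> carrier A \<and> m \<in> carrier M}"

definition right_idempotent ::
  "('k, 'a) module \<Rightarrow> ('k, 'm) module \<Rightarrow> ('m \<Rightarrow> 'a \<Rightarrow> 'm) \<Rightarrow> bool" where
  "right_idempotent A M r \<longleftrightarrow>
     carrier M = finite_sums M {r m a | m a. m \<in> carrier M \<and> a \<in> carrier A}"

definition left_nondegenerate ::
  "('k, 'a) module \<Rightarrow> ('k, 'm) module \<Rightarrow> ('a \<Rightarrow> 'm \<Rightarrow> 'm) \<Rightarrow> bool" where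
  "left_nondegenerate A M l \<longleftrightarrow>
     (\<forall>m\<in>carrier M. (\<forall>a\<in>carrier A. l a m = \<zero>\<^bsub>M\<^esub>) \<longrightarrow> m = \<zero>\<^bsub>M\<^esub>)"

definition right_nondegenerate ::
  "('k, 'a) module \<Rightarrow> ('k, 'm) module \<Rightarrow> ('m \<Rightarrow> 'a \<Rightarrow> 'm) \<Rightarrow> bool" where
  "right_nondegenerate A M r \<longleftrightarrow>
     (\<forall>m\<in>carrier M. (\<forall>a\<in>carrier A. r m a = \<zero>\<^bsub>M\<^esub>) \<longrightarrow> m = \<zero>\<^bsub>M\<^esub>)"

text \<open>Non-degenerate idempotent \<open>k\<close>-projective bimodules.\<close>

definition nip_bimodule ::
  "('k, 'z) ring_scheme \<Rightarrow> ('k, 'a) module \<Rightarrow> ('k, 'm) module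
    \<Rightarrow> ('a \<Rightarrow> 'm \<Rightarrow> 'm) \<Rightarrow> ('m \<Rightarrow> 'a \<Rightarrow> 'm) \<Rightarrow> bool" where
  "nip_bimodule k A M l r \<longleftrightarrow> bimodule k A M l r \<and>
     left_nondegenerate A M l \<and> right_nondegenerate A M r \<and>
     left_idempotent A M l \<and> right_idempotent A M r \<and> projective k M"

definition extension ::
  "('k, 'z) ring_scheme \<Rightarrow> ('k, 'b) module \<Rightarrow> ('k, 'r) module
    \<Rightarrow> ('b \<Rightarrow> 'r \<Rightarrow> 'r) \<Rightarrow> ('r \<Rightarrow> 'b \<Rightarrow> 'r) \<Rightarrow> bool" where
  "extension k B R l r \<longleftrightarrow> nonunital_algebra k R \<and> bimodule k B R l r \<and>
     (\<forall>b\<in>carrier B. \<forall>x\<in>carrier R. \<forall>y\<in>carrier R.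
        l b (x \<otimes>\<^bsub>R\<^esub> y) = l b x \<otimes>\<^bsub>R\<^esub> y \<and>
        r (x \<otimes>\<^bsub>R\<^esub> y) b = x \<otimes>\<^bsub>R\<^esub> r y b \<and>
        r x b \<otimes>\<^bsub>R\<^esub> y = x \<otimes>\<^bsub>R\<^esub> l b y)"

section \<open>The multiplier algebra\<close>

text \<open>
  Functions on a carrier are taken to be \<open>undefined\<close> outside of it, so that equality of multipliers,
  of actions and of morphisms is equality on the carriers.
\<close>

definition multiplier_algebra :: "('k, 'z) ring_scheme \<Rightarrow> ('k, 'a) module
    \<Rightarrow> ('k, ('a \<Rightarrow> 'a) \<times> ('a \<Rightarrow> 'a)) module" where
  "multiplier_algebra k A =
   \<lparr> carrier = {(L, R).
        L \<in> extensional (carrier A) \<and> R \<in> extensional (carrier A) \<and>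
        linear_map k A A L \<and> linear_map k A A R \<and>
        (\<forall>a\<in>carrier A. \<forall>b\<in>carrier A.
           L (a \<otimes>\<^bsub>A\<^esub> b) = L a \<otimes>\<^bsub>A\<^esub> b \<and>
           R (a \<otimes>\<^bsub>A\<^esub> b) = a \<otimes>\<^bsub>A\<^esub> R b \<and>
           a \<otimes>\<^bsub>A\<^esub> L b = R a \<otimes>\<^bsub>A\<^esub> b)},
     mult = (\<lambda>x y. (compose (carrier A) (fst x) (fst y), compose (carrier A) (snd y) (snd x))),
     one = (\<lambda>a\<in>carrier A. a, \<lambda>a\<in>carrier A. a),
     zero = (\<lambda>a\<in>carrier A. \<zero>\<^bsub>A\<^esub>, \<lambda>a\<in>carrier A. \<zero>\<^bsub>A\<^esub>),
     add = (\<lambda>x y. (\<lambda>a\<in>carrier A. fst x a \<oplus>\<^bsub>A\<^esub> fst y a, \<lambda>a\<in>carrier A. snd x a \<oplus>\<^bsub>A\<^esub> snd y a)),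
     smult = (\<lambda>c x. (\<lambda>a\<in>carrier A. c \<odot>\<^bsub>A\<^esub> fst x a, \<lambda>a\<in>carrier A. c \<odot>\<^bsub>A\<^esub> snd x a)) \<rparr>"

definition \<iota> :: "('k, 'a) module \<Rightarrow> 'a \<Rightarrow> ('a \<Rightarrow> 'a) \<times> ('a \<Rightarrow> 'a)" where
  "\<iota> A a = (\<lambda>b\<in>carrier A. a \<otimes>\<^bsub>A\<^esub> b, \<lambda>b\<in>carrier A. b \<otimes>\<^bsub>A\<^esub> a)"

definition unital_algebra_map ::
  "('k, 'z) ring_scheme \<Rightarrow> ('k, 'a) module \<Rightarrow> ('k, 'b) module \<Rightarrow> ('a \<Rightarrow> 'b) \<Rightarrow> bool" where
  "unital_algebra_map k A B f \<longleftrightarrow> algebra_map k A B f \<and> f \<one>\<^bsub>A\<^esub> = \<one>\<^bsub>B\<^esub>"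

section \<open>Categories and functors\<close>

record ('o, 'a) cat =
  Obj :: "'o set"
  Arr :: "'a set"
  Dom :: "'a \<Rightarrow> 'o"
  Cod :: "'a \<Rightarrow> 'o"
  Ident :: "'o \<Rightarrow> 'a"
  Comp :: "'a \<Rightarrow> 'a \<Rightarrow> 'a"

definition is_category :: "('o, 'a) cat \<Rightarrow> bool" where
  "is_category C \<longleftrightarrow>
     (\<forall>f\<in>Arr C. Dom C f \<in> Obj C \<and> Cod C f \<in> Obj C \<and>
        Comp C f (Ident C (Dom C f)) = f \<and> Comp C (Ident C (Cod C f)) f = f) \<and>
     (\<forall>X\<in>Obj C. Ident C X \<in> Arr C \<and> Dom C (Ident C X) = X \<and> Cod C (Ident C X) = X) \<and>
     (\<forall>f\<in>Arr C. \<forall>g\<in>Arr C. Dom C g = Cod C f \<longrightarrow>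
        Comp C g f \<in> Arr C \<and> Dom C (Comp C g f) = Dom C f \<and> Cod C (Comp C g f) = Cod C g) \<and>
     (\<forall>f\<in>Arr C. \<forall>g\<in>Arr C. \<forall>h\<in>Arr C. Dom C g = Cod C f \<and> Dom C h = Cod C g \<longrightarrow>
        Comp C h (Comp C g f) = Comp C (Comp C h g) f)"

record ('o, 'a, 'p, 'b) funct =
  on_obj :: "'o \<Rightarrow> 'p"
  on_arr :: "'a \<Rightarrow> 'b"

definition is_functor :: "('o, 'a) cat \<Rightarrow> ('p, 'b) cat \<Rightarrow> ('o, 'a, 'p, 'b) funct \<Rightarrow> bool" where
  "is_functor C D F \<longleftrightarrow>
     on_obj F \<in> Obj C \<rightarrow>\<^sub>E Obj D \<and> on_arr F \<in> Arr C \<rightarrow>\<^sub>E Arr D \<and>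
     (\<forall>f\<in>Arr C. Dom D (on_arr F f) = on_obj F (Dom C f) \<and>
                Cod D (on_arr F f) = on_obj F (Cod C f)) \<and>
     (\<forall>X\<in>Obj C. on_arr F (Ident C X) = Ident D (on_obj F X)) \<and>
     (\<forall>f\<in>Arr C. \<forall>g\<in>Arr C. Dom C g = Cod C f \<longrightarrow>
        on_arr F (Comp C g f) = Comp D (on_arr F g) (on_arr F f))"

text \<open>\<open>then_functor C F G\<close> is \<open>F\<close>, a functor with source \<open>C\<close>, followed by \<open>G\<close>.\<close>

definition then_functor ::
  "('o, 'a) cat \<Rightarrow> ('o, 'a, 'p, 'b) funct \<Rightarrow> ('p, 'b, 'q, 'c) funct \<Rightarrow> ('o, 'a, 'q, 'c) funct" where
  "then_functor C F G =
   \<lparr> on_obj = (\<lambda>X\<in>Obj C. on_obj G (on_obj F X)),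
     on_arr = (\<lambda>f\<in>Arr C. on_arr G (on_arr F f)) \<rparr>"

text \<open>
  The concrete category with objects \<open>Ob\<close>, the object \<open>X\<close> having the underlying set \<open>U X\<close>, and with
  morphisms \<open>X \<rightarrow> Y\<close> the functions \<open>h : U X \<rightarrow> U Y\<close> with \<open>mor X Y h\<close>. An arrow records its
  domain and codomain.
\<close>

definition concrete_cat ::
  "'o set \<Rightarrow> ('o \<Rightarrow> 'u set) \<Rightarrow> ('o \<Rightarrow> 'o \<Rightarrow> ('u \<Rightarrow> 'u) \<Rightarrow> bool) \<Rightarrow> ('o, 'o \<times> ('u \<Rightarrow> 'u) \<times> 'o) cat" where
  "concrete_cat Ob U mor =
   \<lparr> Obj = Ob,
     Arr = {(X, h, Y). X \<in> Ob \<and> Y \<in> Ob \<and> h \<in> U X \<rightarrow>\<^sub>E U Y \<and> mor X Y h},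
     Dom = (\<lambda>(X, h, Y). X),
     Cod = (\<lambda>(X, h, Y). Y),
     Ident = (\<lambda>X. (X, \<lambda>x\<in>U X. x, X)),
     Comp = (\<lambda>(Y, g, Z) (X, f, Y'). (X, compose (U X) g f, Z)) \<rparr>"

text \<open>The functor that acts on objects by \<open>\<Phi>\<close> and keeps the function underlying a morphism.\<close>

definition forgetful ::
  "('o, 'o \<times> ('u \<Rightarrow> 'u) \<times> 'o) cat \<Rightarrow> ('o \<Rightarrow> 'p)
    \<Rightarrow> ('o, 'o \<times> ('u \<Rightarrow> 'u) \<times> 'o, 'p, 'p \<times> ('u \<Rightarrow> 'u) \<times> 'p) funct" where
  "forgetful C \<Phi> =
   \<lparr> on_obj = restrict \<Phi> (Obj C),
     on_arr = (\<lambda>(X, h, Y)\<in>Arr C. (\<Phi> X, h, \<Phi> Y)) \<rparr>"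

section \<open>The categories of modules and of extensions\<close>

text \<open>
  All objects are carried by subsets of one type \<open>'u\<close>, which plays the role of the universe of small
  sets; it is assumed infinite in the theorem, so that direct sums and tensor products of objects
  fit into it again. Objects are normalised: operations are \<open>undefined\<close> outside the carriers, and so are the
  unused fields. Hence equality of objects is equality of structures in the set-theoretic sense.
\<close>

definition extensional2 :: "'a set \<Rightarrow> 'b set \<Rightarrow> ('a \<Rightarrow> 'b \<Rightarrow> 'c) set" where
  "extensional2 S T = {f. \<forall>x y. x \<notin> S \<or> y \<notin> T \<longrightarrow> f x y = undefined}"

definition restrict2 :: "('a \<Rightarrow> 'b \<Rightarrow> 'c) \<Rightarrow> 'a set \<Rightarrow> 'b set \<Rightarrow> 'a \<Rightarrow> 'b \<Rightarrow> 'c" where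
  "restrict2 f S T = (\<lambda>x y. if x \<in> S \<and> y \<in> T then f x y else undefined)"

definition normal_algebra :: "('k, 'z) ring_scheme \<Rightarrow> ('k, 'u) module \<Rightarrow> bool" where
  "normal_algebra k R \<longleftrightarrow>
     add R \<in> extensional2 (carrier R) (carrier R) \<and>
     smult R \<in> extensional2 (carrier k) (carrier R) \<and>
     mult R \<in> extensional2 (carrier R) (carrier R) \<and>
     one R = undefined"

definition normalise :: "('k, 'z) ring_scheme \<Rightarrow> ('k, 'u) module \<Rightarrow> ('k, 'u) module" where
  "normalise k R =
   \<lparr> carrier = carrier R,
     mult = restrict2 (mult R) (carrier R) (carrier R),
     one = undefined,
     zero = zero R,
     add = restrict2 (add R) (carrier R) (carrier R),
     smult = restrict2 (smult R) (carrier k) (carrier R) \<rparr>"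

text \<open>A normalised module is a normalised algebra record whose multiplication is erased.\<close>

definition no_mult :: "'u \<Rightarrow> 'u \<Rightarrow> 'u" where
  "no_mult = (\<lambda>_ _. undefined)"

definition forget_mult :: "('k, 'u) module \<Rightarrow> ('k, 'u) module" where
  "forget_mult R = R\<lparr>mult := no_mult\<rparr>"

definition normal_module :: "('k, 'z) ring_scheme \<Rightarrow> ('k, 'u) module \<Rightarrow> bool" where
  "normal_module k M \<longleftrightarrow> normal_algebra k M \<and> mult M = no_mult"

type_synonym ('k, 'u, 'a) lmod = "('k, 'u) module \<times> ('a \<Rightarrow> 'u \<Rightarrow> 'u)"
type_synonym ('k, 'u, 'a) rmod = "('k, 'u) module \<times> ('u \<Rightarrow> 'a \<Rightarrow> 'u)"
type_synonym ('k, 'u, 'a) ext = "('k, 'u) module \<times> ('a \<Rightarrow> 'u \<Rightarrow> 'u) \<times> ('u \<Rightarrow> 'a \<Rightarrow> 'u)"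
type_synonym ('o, 'u) arrow = "'o \<times> ('u \<Rightarrow> 'u) \<times> 'o"

definition ModCat :: "('k, 'z) ring_scheme
    \<Rightarrow> (('k, 'u) module, (('k, 'u) module, 'u) arrow) cat" where
  "ModCat k = concrete_cat {M. module k M \<and> normal_module k M} carrier (\<lambda>M N. linear_map k M N)"

definition AlgCat :: "('k, 'z) ring_scheme
    \<Rightarrow> (('k, 'u) module, (('k, 'u) module, 'u) arrow) cat" where
  "AlgCat k = concrete_cat {R. nonunital_algebra k R \<and> normal_algebra k R} carrier
     (\<lambda>R S. algebra_map k R S)"

definition RModCat :: "('k, 'z) ring_scheme \<Rightarrow> ('k, 'a) module
    \<Rightarrow> (('k, 'u, 'a) rmod, (('k, 'u, 'a) rmod, 'u) arrow) cat" where
  "RModCat k A = concrete_cat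
     {(M, r). normal_module k M \<and> r \<in> extensional2 (carrier M) (carrier A) \<and>
        right_module k A M r \<and> right_nondegenerate A M r \<and> right_idempotent A M r \<and>
        projective k M}
     (\<lambda>(M, r). carrier M)
     (\<lambda>(M, r) (N, r') h. linear_map k M N h \<and>
        (\<forall>m\<in>carrier M. \<forall>a\<in>carrier A. h (r m a) = r' (h m) a))"

definition LModCat :: "('k, 'z) ring_scheme \<Rightarrow> ('k, 'a) module
    \<Rightarrow> (('k, 'u, 'a) lmod, (('k, 'u, 'a) lmod, 'u) arrow) cat" where
  "LModCat k A = concrete_cat
     {(M, l). normal_module k M \<and> l \<in> extensional2 (carrier A) (carrier M) \<and>
        left_module k A M l \<and> left_nondegenerate A M l \<and> left_idempotent A M l \<and>
        projective k M}
     (\<lambda>(M, l). carrier M)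
     (\<lambda>(M, l) (N, l') h. linear_map k M N h \<and>
        (\<forall>m\<in>carrier M. \<forall>a\<in>carrier A. h (l a m) = l' a (h m)))"

text \<open>
  The non-degenerate idempotent \<open>k\<close>-projective \<open>B\<close>-extension structures on an algebra \<open>R\<close>.
\<close>

definition extension_structures :: "('k, 'z) ring_scheme \<Rightarrow> ('k, 'b) module \<Rightarrow> ('k, 'u) module
    \<Rightarrow> (('b \<Rightarrow> 'u \<Rightarrow> 'u) \<times> ('u \<Rightarrow> 'b \<Rightarrow> 'u)) set" where
  "extension_structures k B R =
     {(l, r). l \<in> extensional2 (carrier B) (carrier R) \<and> r \<in> extensional2 (carrier R) (carrier B) \<and>
        extension k B R l r \<and> nip_bimodule k B R l r}"

definition ExtCat :: "('k, 'z) ring_scheme \<Rightarrow> ('k, 'b) module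
    \<Rightarrow> (('k, 'u, 'b) ext, (('k, 'u, 'b) ext, 'u) arrow) cat" where
  "ExtCat k B = concrete_cat
     {(R, l, r). normal_algebra k R \<and> (l, r) \<in> extension_structures k B R}
     (\<lambda>(R, l, r). carrier R)
     (\<lambda>(R, l, r) (S, l', r') h. algebra_map k R S h \<and>
        (\<forall>x\<in>carrier R. \<forall>b\<in>carrier B. h (l b x) = l' b (h x) \<and> h (r x b) = r' (h x) b))"

definition Ext_to_RMod where
  "Ext_to_RMod k B = forgetful (ExtCat k B) (\<lambda>(R, l, r). (forget_mult R, r))"

definition Ext_to_LMod where
  "Ext_to_LMod k B = forgetful (ExtCat k B) (\<lambda>(R, l, r). (forget_mult R, l))"

definition Ext_to_Alg where
  "Ext_to_Alg k B = forgetful (ExtCat k B) (\<lambda>(R, l, r). R)"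

definition Ext_to_Mod where
  "Ext_to_Mod k B = forgetful (ExtCat k B) (\<lambda>(R, l, r). forget_mult R)"

definition RMod_to_Mod where
  "RMod_to_Mod k A = forgetful (RModCat k A) (\<lambda>(M, r). M)"

definition LMod_to_Mod where
  "LMod_to_Mod k A = forgetful (LModCat k A) (\<lambda>(M, l). M)"

text \<open>\<open>A\<close> as an extension of itself.\<close>

definition regular_ext :: "('k, 'z) ring_scheme \<Rightarrow> ('k, 'u) module \<Rightarrow> ('k, 'u, 'u) ext" where
  "regular_ext k A = (normalise k A, mult (normalise k A), mult (normalise k A))"

section \<open>The four sets of data\<close>

definition induced_actions :: "('k, 'b) module \<Rightarrow> ('k, 'u) module
    \<Rightarrow> ('b \<Rightarrow> ('u \<Rightarrow> 'u) \<times> ('u \<Rightarrow> 'u)) \<Rightarrow> ('b \<Rightarrow> 'u \<Rightarrow> 'u) \<times> ('u \<Rightarrow> 'b \<Rightarrow> 'u)" where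
  "induced_actions B A f =
     (restrict2 (\<lambda>b a. fst (f b) a) (carrier B) (carrier A),
      restrict2 (\<lambda>a b. snd (f b) a) (carrier A) (carrier B))"

definition multiplier_maps :: "('k, 'z) ring_scheme \<Rightarrow> ('k, 'b) module \<Rightarrow> ('k, 'u) module
    \<Rightarrow> ('b \<Rightarrow> ('u \<Rightarrow> 'u) \<times> ('u \<Rightarrow> 'u)) set" where
  "multiplier_maps k B A =
     {f \<in> extensional (carrier B).
        algebra_map k B (multiplier_algebra k A) f \<and>
        (case induced_actions B A f of (l, r) \<Rightarrow> nip_bimodule k B A l r)}"

text \<open>
  The functors from \<open>A\<close>-extensions to \<open>B\<close>-extensions are required to keep the underlying algebra:
  they only trade the \<open>A\<close>-actions for \<open>B\<close>-actions. This is the clause with \<open>Ext_to_Alg\<close>. It does not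
  follow from compatibility with the forgetful functors to modules: for \<open>A = B\<close>, replacing
  the multiplication of an extension by the zero multiplication is a functor that preserves all
  underlying modules (\<open>zero_mult_functor_forget\<close>), but for \<open>A \<noteq> 0\<close> it does not come from an
  \<open>A\<close>-extension structure on the algebra \<open>A\<close>. For a field \<open>k = A = B\<close> there is exactly one extension
  structure, whereas without the clause there would be at least two functors, this one and the
  identity.
\<close>

definition ext_functors :: "('k, 'z) ring_scheme \<Rightarrow> ('k, 'b) module \<Rightarrow> ('k, 'u) module
    \<Rightarrow> (('k, 'u, 'u) ext, (('k, 'u, 'u) ext, 'u) arrow,
        ('k, 'u, 'b) ext, (('k, 'u, 'b) ext, 'u) arrow) funct set" where
  "ext_functors k B A =
     {F. is_functor (ExtCat k A) (ExtCat k B) F \<and>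
         then_functor (ExtCat k A) F (Ext_to_Mod k B) = Ext_to_Mod k A \<and>
         then_functor (ExtCat k A) F (Ext_to_Alg k B) = Ext_to_Alg k A}"

definition functor_triples :: "('k, 'z) ring_scheme \<Rightarrow> ('k, 'b) module \<Rightarrow> ('k, 'u) module
    \<Rightarrow> ((('k, 'u, 'u) ext, (('k, 'u, 'u) ext, 'u) arrow,
         ('k, 'u, 'b) ext, (('k, 'u, 'b) ext, 'u) arrow) funct \<times>
        (('k, 'u, 'u) rmod, (('k, 'u, 'u) rmod, 'u) arrow,
         ('k, 'u, 'b) rmod, (('k, 'u, 'b) rmod, 'u) arrow) funct \<times>
        (('k, 'u, 'u) lmod, (('k, 'u, 'u) lmod, 'u) arrow,
         ('k, 'u, 'b) lmod, (('k, 'u, 'b) lmod, 'u) arrow) funct) set" where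
  "functor_triples k B A =
     {(F, Fr, Fl).
         is_functor (ExtCat k A) (ExtCat k B) F \<and>
         is_functor (RModCat k A) (RModCat k B) Fr \<and>
         is_functor (LModCat k A) (LModCat k B) Fl \<and>
         then_functor (ExtCat k A) F (Ext_to_RMod k B) = then_functor (ExtCat k A) (Ext_to_RMod k A) Fr \<and>
         then_functor (ExtCat k A) F (Ext_to_LMod k B) = then_functor (ExtCat k A) (Ext_to_LMod k A) Fl \<and>
         then_functor (RModCat k A) Fr (RMod_to_Mod k B) = RMod_to_Mod k A \<and>
         then_functor (LModCat k A) Fl (LMod_to_Mod k B) = LMod_to_Mod k A \<and>
         then_functor (ExtCat k A) F (Ext_to_Alg k B) = Ext_to_Alg k A}"

section \<open>Basic facts\<close>

lemma concrete_cat_is_category: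
  assumes "\<And>X. X \<in> Ob \<Longrightarrow> mor X X (\<lambda>x\<in>U X. x)"
    and "\<And>X Y Z f g. \<lbrakk>X \<in> Ob; Y \<in> Ob; Z \<in> Ob; f \<in> U X \<rightarrow>\<^sub>E U Y; g \<in> U Y \<rightarrow>\<^sub>E U Z; mor X Y f; mor Y Z g\<rbrakk>
      \<Longrightarrow> mor X Z (compose (U X) g f)"
  shows "is_category (concrete_cat Ob U mor)"
  unfolding is_category_def concrete_cat_def
  using assms
  by (auto simp: compose_def fun_eq_iff PiE_iff extensional_def Pi_iff)

lemma forgetful_is_functor:
  assumes "\<And>X. X \<in> Ob \<Longrightarrow> \<Phi> X \<in> Ob' \<and> U' (\<Phi> X) = U X"
    and "\<And>X Y f. \<lbrakk>X \<in> Ob; Y \<in> Ob; f \<in> U X \<rightarrow>\<^sub>E U Y; mor X Y f\<rbrakk> \<Longrightarrow> mor' (\<Phi> X) (\<Phi> Y) f"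
    and cat: "is_category (concrete_cat Ob U mor)"
  shows "is_functor (concrete_cat Ob U mor) (concrete_cat Ob' U' mor')
           (forgetful (concrete_cat Ob U mor) \<Phi>)"
proof -
  let ?C = "concrete_cat Ob U mor"
  have *: "Ident ?C X \<in> Arr ?C" if "X \<in> Ob" for X
    using cat that unfolding is_category_def by (auto simp: concrete_cat_def)
  have **: "Comp ?C g f \<in> Arr ?C" if "f \<in> Arr ?C" "g \<in> Arr ?C" "Dom ?C g = Cod ?C f" for f g
    using cat that unfolding is_category_def by blast
  show ?thesis
    unfolding is_functor_def
  proof (intro conjI ballI impI)
    fix X assume "X \<in> Obj ?C"
    then show "on_arr (forgetful ?C \<Phi>) (Ident ?C X) = Ident (concrete_cat Ob' U' mor') (on_obj (forgetful ?C \<Phi>) X)"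
      using *[of X] assms(1)[of X] by (auto simp: forgetful_def concrete_cat_def)
  next
    fix f g assume "f \<in> Arr ?C" "g \<in> Arr ?C" "Dom ?C g = Cod ?C f"
    then show "on_arr (forgetful ?C \<Phi>) (Comp ?C g f) =
        Comp (concrete_cat Ob' U' mor') (on_arr (forgetful ?C \<Phi>) g) (on_arr (forgetful ?C \<Phi>) f)"
      using **[of f g] assms(1)[of "Dom ?C f"] by (auto simp: forgetful_def concrete_cat_def)
  qed (use assms in \<open>auto simp: forgetful_def concrete_cat_def\<close>)
qed

lemma linear_map_id: "module k M \<Longrightarrow> linear_map k M M (\<lambda>x\<in>carrier M. x)"
  by (auto simp: linear_map_def module.smult_closed abelian_group.axioms
      dest: module.axioms(2) intro: abelian_groupE(1))

lemma linear_map_compose: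
  "\<lbrakk>module k M; linear_map k M N f; linear_map k N P g\<rbrakk>
    \<Longrightarrow> linear_map k M P (compose (carrier M) g f)"
  by (auto simp: linear_map_def compose_def Pi_iff module.smult_closed
      dest: module.axioms(2) intro: abelian_groupE(1))

lemma nonunital_algebra_closed:
  "\<lbrakk>nonunital_algebra k A; x \<in> carrier A; y \<in> carrier A\<rbrakk> \<Longrightarrow> x \<otimes>\<^bsub>A\<^esub> y \<in> carrier A"
  by (auto simp: nonunital_algebra_def bilinear_map_def linear_map_def)

lemma algebra_map_id: "nonunital_algebra k M \<Longrightarrow> algebra_map k M M (\<lambda>x\<in>carrier M. x)"
  by (simp add: algebra_map_def linear_map_id nonunital_algebra_closed)
    (simp add: linear_map_id nonunital_algebra_def)

lemma algebra_map_compose: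
  assumes "nonunital_algebra k M" "algebra_map k M N f" "algebra_map k N P g"
  shows "algebra_map k M P (compose (carrier M) g f)"
proof -
  have "f x \<in> carrier N" if "x \<in> carrier M" for x
    using assms that by (auto simp: algebra_map_def linear_map_def)
  moreover have "linear_map k M P (compose (carrier M) g f)"
    using assms by (auto simp: algebra_map_def nonunital_algebra_def intro: linear_map_compose)
  ultimately show ?thesis
    using assms by (auto simp: algebra_map_def nonunital_algebra_closed compose_eq)
qed

lemma right_module_closed:
  "\<lbrakk>right_module k A M r; m \<in> carrier M; a \<in> carrier A\<rbrakk> \<Longrightarrow> r m a \<in> carrier M"
  by (auto simp: right_module_def bilinear_map_def linear_map_def)

lemma left_module_closed:
  "\<lbrakk>left_module k A M l; m \<in> carrier M; a \<in> carrier A\<rbrakk> \<Longrightarrow> l a m \<in> carrier M"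
  by (auto simp: left_module_def bilinear_map_def linear_map_def)

lemma ModCat_is_category: "is_category (ModCat k)"
  unfolding ModCat_def
  by (rule concrete_cat_is_category) (auto intro: linear_map_id linear_map_compose)

lemma AlgCat_is_category: "is_category (AlgCat k)"
  unfolding AlgCat_def
  by (rule concrete_cat_is_category) (auto intro: algebra_map_id algebra_map_compose)

lemma right_module_module: "right_module k A M r \<Longrightarrow> module k M"
  by (simp add: right_module_def)

lemma left_module_module: "left_module k A M l \<Longrightarrow> module k M"
  by (simp add: left_module_def)

lemma RModCat_is_category: "is_category (RModCat k A)"
  unfolding RModCat_def
  by (rule concrete_cat_is_category)
    (auto simp: right_module_closed compose_eq PiE_iff
      intro: linear_map_id linear_map_compose right_module_module)

lemma LModCat_is_category: "is_category (LModCat k A)"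
  unfolding LModCat_def
  by (rule concrete_cat_is_category)
    (auto simp: left_module_closed compose_eq PiE_iff
      intro: linear_map_id linear_map_compose left_module_module)

lemma extension_structuresD:
  assumes "(l, r) \<in> extension_structures k B R"
  shows "nonunital_algebra k R" "module k R" "left_module k B R l" "right_module k B R r"
  using assms
  by (auto simp: extension_structures_def extension_def bimodule_def nonunital_algebra_def)

lemma extension_structures_closed:
  assumes "(l, r) \<in> extension_structures k B R" "x \<in> carrier R" "b \<in> carrier B"
  shows "l b x \<in> carrier R" "r x b \<in> carrier R"
  using extension_structuresD(3,4)[OF assms(1)] assms(2,3)
  by (blast intro: left_module_closed right_module_closed)+

lemma ExtCat_is_category: "is_category (ExtCat k B)"
  unfolding ExtCat_def
  by (rule concrete_cat_is_category)
    (auto simp: compose_eq PiE_iff extension_structures_closed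
      intro: algebra_map_id algebra_map_compose extension_structuresD(1))

lemma module_cong:
  assumes "carrier N = carrier M" "zero N = zero M"
    and "\<And>x y. \<lbrakk>x \<in> carrier M; y \<in> carrier M\<rbrakk> \<Longrightarrow> add N x y = add M x y"
    and "\<And>c x. \<lbrakk>c \<in> carrier k; x \<in> carrier M\<rbrakk> \<Longrightarrow> smult N c x = smult M c x"
    and "module k M"
  shows "module k N"
proof -
  interpret module k M by fact
  have "\<exists>y\<in>carrier M. add M y x = zero M" if "x \<in> carrier M" for x
    using that M.l_neg M.a_inv_closed by blast
  then have "abelian_group N"
    by (intro abelian_groupI) (auto simp: assms(1-3) M.a_assoc M.a_comm M.a_lcomm)
  then show ?thesis
    by (intro moduleI)
      (auto simp: assms(1-4) smult_l_distr smult_r_distr smult_assoc1 R.is_cring)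
qed

lemma linear_map_cong:
  assumes "carrier M' = carrier M"
    and "\<And>x y. \<lbrakk>x \<in> carrier M; y \<in> carrier M\<rbrakk> \<Longrightarrow> add M' x y = add M x y"
    and "\<And>c x. \<lbrakk>c \<in> carrier k; x \<in> carrier M\<rbrakk> \<Longrightarrow> smult M' c x = smult M c x"
    and "carrier N' = carrier N"
    and "\<And>x y. \<lbrakk>x \<in> carrier N; y \<in> carrier N\<rbrakk> \<Longrightarrow> add N' x y = add N x y"
    and "\<And>c x. \<lbrakk>c \<in> carrier k; x \<in> carrier N\<rbrakk> \<Longrightarrow> smult N' c x = smult N c x"
    and "\<And>x. x \<in> carrier M \<Longrightarrow> h' x = h x"
    and "module k M" "linear_map k M N h"
  shows "linear_map k M' N' h'"
proof -
  interpret module k M by fact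
  have "h x \<in> carrier N" if "x \<in> carrier M" for x
    using assms(9) that by (auto simp: linear_map_def)
  then show ?thesis
    using assms(9) by (auto simp: linear_map_def assms(1-7))
qed

lemma forget_mult_simps [simp]:
  "carrier (forget_mult R) = carrier R" "zero (forget_mult R) = zero R"
  "add (forget_mult R) = add R" "smult (forget_mult R) = smult R"
  "mult (forget_mult R) = no_mult" "one (forget_mult R) = one R"
  "finsum (forget_mult R) = finsum R"
  by (simp_all add: forget_mult_def finsum_def fun_eq_iff)

lemma module_forget_mult [simp]: "module k (forget_mult R) = module k R"
  by (rule iffI; rule module_cong; simp)

lemma linear_map_forget_mult [simp]:
  "linear_map k (forget_mult R) N h = linear_map k R N h"
  by (simp add: linear_map_def)

lemma linear_map_forget_mult' [simp]:
  "linear_map k M (forget_mult R) h = linear_map k M R h"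
  by (simp add: linear_map_def)

lemma structure_forget_mult [simp]:
  "left_module k B (forget_mult R) l = left_module k B R l"
  "right_module k B (forget_mult R) r = right_module k B R r"
  "left_nondegenerate B (forget_mult R) l = left_nondegenerate B R l"
  "right_nondegenerate B (forget_mult R) r = right_nondegenerate B R r"
  "left_idempotent B (forget_mult R) l = left_idempotent B R l"
  "right_idempotent B (forget_mult R) r = right_idempotent B R r"
  "projective k (forget_mult R) = projective k R"
  by (simp_all add: left_module_def right_module_def left_nondegenerate_def
      right_nondegenerate_def left_idempotent_def right_idempotent_def projective_def
      bilinear_map_def finite_sums_def)

lemma normal_module_forget_mult: "normal_algebra k R \<Longrightarrow> normal_module k (forget_mult R)"
  by (auto simp: normal_module_def normal_algebra_def no_mult_def extensional2_def)

lemma Ext_to_RMod_is_functor: "is_functor (ExtCat k B) (RModCat k B) (Ext_to_RMod k B)"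
  unfolding Ext_to_RMod_def
  unfolding ExtCat_def RModCat_def
  by (rule forgetful_is_functor[OF _ _ ExtCat_is_category[unfolded ExtCat_def]])
    (auto simp: normal_module_forget_mult algebra_map_def extension_structures_def
      nip_bimodule_def bimodule_def)

lemma Ext_to_LMod_is_functor: "is_functor (ExtCat k B) (LModCat k B) (Ext_to_LMod k B)"
  unfolding Ext_to_LMod_def
  unfolding ExtCat_def LModCat_def
  by (rule forgetful_is_functor[OF _ _ ExtCat_is_category[unfolded ExtCat_def]])
    (auto simp: normal_module_forget_mult algebra_map_def extension_structures_def
      nip_bimodule_def bimodule_def)

lemma Ext_to_Mod_is_functor: "is_functor (ExtCat k B) (ModCat k) (Ext_to_Mod k B)"
  unfolding Ext_to_Mod_def
  unfolding ExtCat_def ModCat_def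
  by (rule forgetful_is_functor[OF _ _ ExtCat_is_category[unfolded ExtCat_def]])
    (auto simp: normal_module_forget_mult algebra_map_def dest: extension_structuresD(2))

lemma Ext_to_Alg_is_functor: "is_functor (ExtCat k B) (AlgCat k) (Ext_to_Alg k B)"
  unfolding Ext_to_Alg_def
  unfolding ExtCat_def AlgCat_def
  by (rule forgetful_is_functor[OF _ _ ExtCat_is_category[unfolded ExtCat_def]])
    (auto dest: extension_structuresD(1))

lemma RMod_to_Mod_is_functor: "is_functor (RModCat k A) (ModCat k) (RMod_to_Mod k A)"
  unfolding RMod_to_Mod_def
  unfolding RModCat_def ModCat_def
  by (rule forgetful_is_functor[OF _ _ RModCat_is_category[unfolded RModCat_def]])
    (auto dest: right_module_module)

lemma LMod_to_Mod_is_functor: "is_functor (LModCat k A) (ModCat k) (LMod_to_Mod k A)"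
  unfolding LMod_to_Mod_def
  unfolding LModCat_def ModCat_def
  by (rule forgetful_is_functor[OF _ _ LModCat_is_category[unfolded LModCat_def]])
    (auto dest: left_module_module)

lemma normalise_simps [simp]:
  "carrier (normalise k R) = carrier R" "zero (normalise k R) = zero R"
  "\<lbrakk>x \<in> carrier R; y \<in> carrier R\<rbrakk> \<Longrightarrow> add (normalise k R) x y = add R x y"
  "\<lbrakk>c \<in> carrier k; y \<in> carrier R\<rbrakk> \<Longrightarrow> smult (normalise k R) c y = smult R c y"
  "\<lbrakk>x \<in> carrier R; y \<in> carrier R\<rbrakk> \<Longrightarrow> mult (normalise k R) x y = mult R x y"
  by (simp_all add: normalise_def restrict2_def)

lemma normal_algebra_normalise: "normal_algebra k (normalise k R)"
  by (simp add: normal_algebra_def normalise_def restrict2_def extensional2_def)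

lemma module_normalise: "module k R \<Longrightarrow> module k (normalise k R)"
  by (rule module_cong[where M = R]) auto

lemma finsum_normalise:
  assumes "module k R" "finite I" "s \<in> I \<rightarrow> carrier R"
  shows "finsum (normalise k R) s I = finsum R s I"
proof -
  interpret R: module k R by fact
  interpret N: module k "normalise k R" using assms(1) by (rule module_normalise)
  show ?thesis
    using assms(2,3) by (induction I) (auto simp: R.M.finsum_closed Pi_iff)
qed

lemma finite_sums_normalise:
  assumes "module k R" "S \<subseteq> carrier R"
  shows "finite_sums (normalise k R) S = finite_sums R S"
proof -
  have "finsum (normalise k R) s {..<n} = finsum R s {..<n}" if "s \<in> {..<n} \<rightarrow> S" for s and n :: nat
    using that assms by (intro finsum_normalise) auto
  then show ?thesis
    unfolding finite_sums_def by (auto; metis)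
qed

lemma linear_map_normalise:
  "module k R \<Longrightarrow> linear_map k (normalise k R) N h = linear_map k R N h"
  by (auto simp: linear_map_def)

lemma linear_map_normalise':
  "linear_map k M (normalise k R) h = linear_map k M R h"
  by (simp add: linear_map_def Pi_iff cong: conj_cong)

lemma projective_normalise:
  assumes "projective k R"
  shows "projective k (normalise k R)"
proof -
  have "module k R" using assms unfolding projective_def by blast
  then show ?thesis
    using assms unfolding projective_def normalise_simps linear_map_normalise[OF \<open>module k R\<close>]
    by (meson module_normalise)
qed

lemma regular_ext_in_ExtCat:
  assumes A: "nonunital_algebra k A" "nondegenerate_algebra A" "idempotent_algebra A" "projective k A"
  shows "regular_ext k A \<in> Obj (ExtCat k A)"
proof -
  let ?N = "normalise k A" and ?m = "mult (normalise k A)"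
  interpret module k A using A by (simp add: nonunital_algebra_def)
  note mod = module_axioms
  have cl: "\<And>x y. \<lbrakk>x \<in> carrier A; y \<in> carrier A\<rbrakk> \<Longrightarrow> x \<otimes>\<^bsub>A\<^esub> y \<in> carrier A"
    using nonunital_algebra_closed[OF A(1)] .
  have as: "\<And>x y z. \<lbrakk>x \<in> carrier A; y \<in> carrier A; z \<in> carrier A\<rbrakk>
      \<Longrightarrow> (x \<otimes>\<^bsub>A\<^esub> y) \<otimes>\<^bsub>A\<^esub> z = x \<otimes>\<^bsub>A\<^esub> (y \<otimes>\<^bsub>A\<^esub> z)"
    using A(1) by (simp add: nonunital_algebra_def)
  have lin: "linear_map k A A (\<lambda>y. ?m x y)" "linear_map k A A (\<lambda>y. ?m y x)" if "x \<in> carrier A" for x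
  proof -
    have "linear_map k A A (\<lambda>y. x \<otimes>\<^bsub>A\<^esub> y)" "linear_map k A A (\<lambda>y. y \<otimes>\<^bsub>A\<^esub> x)"
      using A(1) that by (simp_all add: nonunital_algebra_def bilinear_map_def)
    then show "linear_map k A A (\<lambda>y. ?m x y)" "linear_map k A A (\<lambda>y. ?m y x)"
      using that by (simp_all add: linear_map_def Pi_iff)
  qed
  have bil: "bilinear_map k A ?N ?N ?m" "bilinear_map k ?N A ?N ?m" "bilinear_map k ?N ?N ?N ?m"
    using lin
    by (simp_all add: bilinear_map_def linear_map_normalise[OF mod] linear_map_normalise')
  have "nonunital_algebra k ?N" "bimodule k A ?N ?m ?m"
    by (auto simp: nonunital_algebra_def bimodule_def left_module_def right_module_def
        module_normalise[OF mod] bil cl as)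
  moreover have "left_nondegenerate A ?N ?m" "right_nondegenerate A ?N ?m"
    using A(2) by (auto simp: left_nondegenerate_def right_nondegenerate_def nondegenerate_algebra_def)
  moreover have "left_idempotent A ?N ?m" "right_idempotent A ?N ?m"
  proof -
    have *: "{?m a b | a b. a \<in> carrier A \<and> b \<in> carrier A} = {a \<otimes>\<^bsub>A\<^esub> b | a b. a \<in> carrier A \<and> b \<in> carrier A}"
      by (auto; metis normalise_simps(5))
    have "finite_sums ?N {a \<otimes>\<^bsub>A\<^esub> b | a b. a \<in> carrier A \<and> b \<in> carrier A} = carrier A"
      using A(3) cl by (subst finite_sums_normalise[OF mod]) (auto simp: idempotent_algebra_def)
    then show "left_idempotent A ?N ?m" "right_idempotent A ?N ?m"
      by (simp_all add: left_idempotent_def right_idempotent_def *)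
  qed
  moreover have "?m \<in> extensional2 (carrier A) (carrier A)"
    by (simp add: normalise_def restrict2_def extensional2_def)
  ultimately show ?thesis
    using A(4)
    by (auto simp: ExtCat_def concrete_cat_def regular_ext_def normal_algebra_normalise
        extension_structures_def extension_def nip_bimodule_def projective_normalise cl as)
qed

text \<open>
  Projectivity as defined above implies the lifting property against modules over arbitrary types.
\<close>

definition free_module :: "('k, 'z) ring_scheme \<Rightarrow> 'i set \<Rightarrow> ('k, 'i \<Rightarrow> 'k) module" where
  "free_module k I =
   \<lparr> carrier = {f. (\<forall>i\<in>I. f i \<in> carrier k) \<and> (\<forall>i. i \<notin> I \<longrightarrow> f i = \<zero>\<^bsub>k\<^esub>) \<and>
                    finite {i. f i \<noteq> \<zero>\<^bsub>k\<^esub>}},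
     mult = undefined, one = undefined,
     zero = (\<lambda>i. \<zero>\<^bsub>k\<^esub>),
     add = (\<lambda>f g i. f i \<oplus>\<^bsub>k\<^esub> g i),
     smult = (\<lambda>c f i. c \<otimes>\<^bsub>k\<^esub> f i) \<rparr>"

definition lin_comb ::
  "('k, 'z) ring_scheme \<Rightarrow> ('k, 'm) module \<Rightarrow> ('i \<Rightarrow> 'm) \<Rightarrow> ('i \<Rightarrow> 'k) \<Rightarrow> 'm" where
  "lin_comb k M t f = finsum M (\<lambda>i. f i \<odot>\<^bsub>M\<^esub> t i) {i. f i \<noteq> \<zero>\<^bsub>k\<^esub>}"

lemma free_module_module:
  assumes "cring k"
  shows "module k (free_module k I)"
proof -
  interpret k: cring k by fact
  let ?F = "free_module k I"
  have V: "f i \<in> carrier k" if "f \<in> carrier ?F" for f i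
    using that by (cases "i \<in> I") (auto simp: free_module_def)
  have add: "add ?F f g \<in> carrier ?F" if "f \<in> carrier ?F" "g \<in> carrier ?F" for f g
  proof -
    have "{i. f i \<oplus>\<^bsub>k\<^esub> g i \<noteq> \<zero>\<^bsub>k\<^esub>} \<subseteq> {i. f i \<noteq> \<zero>\<^bsub>k\<^esub>} \<union> {i. g i \<noteq> \<zero>\<^bsub>k\<^esub>}"
      by auto
    then show ?thesis
      using that V[OF that(1)] V[OF that(2)] by (auto simp: free_module_def intro: finite_subset)
  qed
  have smult: "smult ?F c f \<in> carrier ?F" if "c \<in> carrier k" "f \<in> carrier ?F" for c f
  proof -
    have "{i. c \<otimes>\<^bsub>k\<^esub> f i \<noteq> \<zero>\<^bsub>k\<^esub>} \<subseteq> {i. f i \<noteq> \<zero>\<^bsub>k\<^esub>}"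
      using that(1) by auto
    then show ?thesis
      using that V[OF that(2)] by (auto simp: free_module_def intro: finite_subset)
  qed
  have neg: "\<exists>g\<in>carrier ?F. add ?F g f = zero ?F" if "f \<in> carrier ?F" for f
  proof
    show "smult ?F (\<ominus>\<^bsub>k\<^esub> \<one>\<^bsub>k\<^esub>) f \<in> carrier ?F" using that by (intro smult) auto
    show "add ?F (smult ?F (\<ominus>\<^bsub>k\<^esub> \<one>\<^bsub>k\<^esub>) f) f = zero ?F"
      using V[OF that] by (auto simp: free_module_def k.l_minus k.l_neg)
  qed
  have zero: "zero ?F \<in> carrier ?F" by (simp add: free_module_def)
  have "abelian_group ?F"
    by (rule abelian_groupI[OF add zero _ _ _ neg])
      (auto simp: free_module_def fun_eq_iff dest!: V intro!: k.a_assoc k.a_comm k.l_zero V)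
  then show ?thesis
    by (rule moduleI[OF assms _ smult])
      (auto dest: V simp: free_module_def fun_eq_iff intro!: k.l_distr k.r_distr k.m_assoc k.l_one V)
qed

lemma free_module_supp:
  "\<lbrakk>f \<in> carrier (free_module k I); f i \<noteq> \<zero>\<^bsub>k\<^esub>\<rbrakk> \<Longrightarrow> i \<in> I \<and> f i \<in> carrier k"
  unfolding free_module_def by fastforce

lemma lin_comb_superset:
  assumes "module k M" "f \<in> carrier (free_module k I)" "t \<in> I \<rightarrow> carrier M"
    and "finite J" "{i. f i \<noteq> \<zero>\<^bsub>k\<^esub>} \<subseteq> J" "J \<subseteq> I"
  shows "lin_comb k M t f = finsum M (\<lambda>i. f i \<odot>\<^bsub>M\<^esub> t i) J"
proof -
  interpret module k M by fact
  show ?thesis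
    unfolding lin_comb_def
    by (rule M.add.finprod_mono_neutral_cong_left)
      (use assms in \<open>auto simp: free_module_def Pi_iff subset_eq\<close>)
qed

lemma linear_map_lin_comb:
  assumes "module k M" "t \<in> I \<rightarrow> carrier M"
  shows "linear_map k (free_module k I) M (lin_comb k M t)"
proof -
  interpret module k M by fact
  let ?F = "free_module k I"
  interpret F: module k ?F by (rule free_module_module) (rule R.is_cring)
  have supp: "finite {i. f i \<noteq> \<zero>\<^bsub>k\<^esub>}" "{i. f i \<noteq> \<zero>\<^bsub>k\<^esub>} \<subseteq> I" "\<And>i. i \<in> I \<Longrightarrow> f i \<in> carrier k"
    if "f \<in> carrier ?F" for f
    using that by (auto simp: free_module_def)
  have t: "t i \<in> carrier M" if "i \<in> I" for i using assms(2) that by auto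
  have cl: "lin_comb k M t f \<in> carrier M" if "f \<in> carrier ?F" for f
    unfolding lin_comb_def using supp[OF that] t by (intro M.finsum_closed) auto
  show ?thesis
    unfolding linear_map_def
  proof (intro conjI ballI funcsetI cl)
    fix f g assume fg: "f \<in> carrier ?F" "g \<in> carrier ?F"
    define J where "J = {i. f i \<noteq> \<zero>\<^bsub>k\<^esub>} \<union> {i. g i \<noteq> \<zero>\<^bsub>k\<^esub>}"
    have J: "finite J" "J \<subseteq> I" using supp[OF fg(1)] supp[OF fg(2)] by (auto simp: J_def)
    have s: "add ?F f g = (\<lambda>i. f i \<oplus>\<^bsub>k\<^esub> g i)" by (simp add: free_module_def)
    have "add ?F f g \<in> carrier ?F" using fg by (rule F.M.a_closed)
    then have "lin_comb k M t (add ?F f g) = finsum M (\<lambda>i. add ?F f g i \<odot>\<^bsub>M\<^esub> t i) J"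
      by (rule lin_comb_superset[OF assms(1) _ assms(2) J(1) _ J(2)]) (auto simp: J_def s)
    also have "\<dots> = finsum M (\<lambda>i. f i \<odot>\<^bsub>M\<^esub> t i \<oplus>\<^bsub>M\<^esub> g i \<odot>\<^bsub>M\<^esub> t i) J"
      using J supp(3)[OF fg(1)] supp(3)[OF fg(2)] t
      by (intro M.finsum_cong') (auto simp: s smult_l_distr subset_eq)
    also have "\<dots> = finsum M (\<lambda>i. f i \<odot>\<^bsub>M\<^esub> t i) J \<oplus>\<^bsub>M\<^esub> finsum M (\<lambda>i. g i \<odot>\<^bsub>M\<^esub> t i) J"
      using J supp(3)[OF fg(1)] supp(3)[OF fg(2)] t
      by (intro M.finsum_addf) (auto simp: subset_eq)
    also have "\<dots> = lin_comb k M t f \<oplus>\<^bsub>M\<^esub> lin_comb k M t g"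
      using fg J by (subst (1 2) lin_comb_superset[OF assms(1) _ assms(2), where J = J]) (auto simp: J_def)
    finally show "lin_comb k M t (add ?F f g) = lin_comb k M t f \<oplus>\<^bsub>M\<^esub> lin_comb k M t g" .
  next
    fix c f assume cf: "c \<in> carrier k" "f \<in> carrier ?F"
    define J where "J = {i. f i \<noteq> \<zero>\<^bsub>k\<^esub>}"
    have J: "finite J" "J \<subseteq> I" using supp[OF cf(2)] by (auto simp: J_def)
    have s: "smult ?F c f = (\<lambda>i. c \<otimes>\<^bsub>k\<^esub> f i)" by (simp add: free_module_def)
    have "smult ?F c f \<in> carrier ?F" using cf by (rule F.smult_closed)
    then have "lin_comb k M t (smult ?F c f) = finsum M (\<lambda>i. smult ?F c f i \<odot>\<^bsub>M\<^esub> t i) J"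
      by (rule lin_comb_superset[OF assms(1) _ assms(2) J(1) _ J(2)]) (use cf in \<open>auto simp: J_def s\<close>)
    also have "\<dots> = finsum M (\<lambda>i. c \<odot>\<^bsub>M\<^esub> (f i \<odot>\<^bsub>M\<^esub> t i)) J"
      using J supp(3)[OF cf(2)] t cf
      by (intro M.finsum_cong') (auto simp: s smult_assoc1 subset_eq)
    also have "\<dots> = c \<odot>\<^bsub>M\<^esub> lin_comb k M t f"
      using J supp(3)[OF cf(2)] t cf unfolding lin_comb_def J_def[symmetric]
      by (subst finsum_smult_ldistr) (auto simp: subset_eq)
    finally show "lin_comb k M t (smult ?F c f) = c \<odot>\<^bsub>M\<^esub> lin_comb k M t f" .
  qed
qed

lemma linear_map_zero:
  assumes "module k M" "module k N" "linear_map k M N h"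
  shows "h \<zero>\<^bsub>M\<^esub> = \<zero>\<^bsub>N\<^esub>"
proof -
  interpret M: module k M by fact
  interpret N: module k N by fact
  have "h (\<zero>\<^bsub>k\<^esub> \<odot>\<^bsub>M\<^esub> \<zero>\<^bsub>M\<^esub>) = \<zero>\<^bsub>k\<^esub> \<odot>\<^bsub>N\<^esub> h \<zero>\<^bsub>M\<^esub>"
    using assms(3) M.R.zero_closed M.M.zero_closed unfolding linear_map_def by blast
  moreover have "h \<zero>\<^bsub>M\<^esub> \<in> carrier N"
    using assms(3) by (auto simp: linear_map_def)
  ultimately show ?thesis by simp
qed

lemma linear_map_finsum:
  assumes "module k M" "module k N" "linear_map k M N h" "finite J" "s \<in> J \<rightarrow> carrier M"
  shows "h (finsum M s J) = finsum N (\<lambda>i. h (s i)) J"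
proof -
  interpret M: module k M by fact
  interpret N: module k N by fact
  have h: "h \<in> carrier M \<rightarrow> carrier N" using assms(3) by (simp add: linear_map_def)
  show ?thesis
    using assms(4,5)
  proof (induction J)
    case empty
    then show ?case using linear_map_zero[OF assms(1-3)] by simp
  next
    case (insert x J)
    then have "finsum M s J \<in> carrier M" by (intro M.M.finsum_closed) auto
    then have "h (s x \<oplus>\<^bsub>M\<^esub> finsum M s J) = h (s x) \<oplus>\<^bsub>N\<^esub> h (finsum M s J)"
      using assms(3) insert by (simp add: linear_map_def)
    with insert h show ?case by (simp add: Pi_iff)
  qed
qed

lemma linear_map_of_lin_comb:
  assumes "module k M" "module k N" "linear_map k M N h"
    and "f \<in> carrier (free_module k I)" "t \<in> I \<rightarrow> carrier M"
  shows "h (lin_comb k M t f) = lin_comb k N (\<lambda>i. h (t i)) f"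
proof -
  interpret M: module k M by fact
  interpret N: module k N by fact
  have h: "h \<in> carrier M \<rightarrow> carrier N" using assms(3) by (simp add: linear_map_def)
  have "h (lin_comb k M t f) = finsum N (\<lambda>i. h (f i \<odot>\<^bsub>M\<^esub> t i)) {i. f i \<noteq> \<zero>\<^bsub>k\<^esub>}"
    unfolding lin_comb_def
    by (rule linear_map_finsum[OF assms(1-3)])
      (use assms(4,5) in \<open>auto simp: free_module_def Pi_iff\<close>)
  also have "\<dots> = lin_comb k N (\<lambda>i. h (t i)) f"
    unfolding lin_comb_def
  proof (rule N.M.finsum_cong'[OF refl])
    have *: "t i \<in> carrier M \<and> h (t i) \<in> carrier N \<and> f i \<in> carrier k"
      if "f i \<noteq> \<zero>\<^bsub>k\<^esub>" for i
      using free_module_supp[OF assms(4) that] assms(5) h by auto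
    then show "(\<lambda>i. f i \<odot>\<^bsub>N\<^esub> h (t i)) \<in> {i. f i \<noteq> \<zero>\<^bsub>k\<^esub>} \<rightarrow> carrier N"
      by auto
    show "h (f i \<odot>\<^bsub>M\<^esub> t i) = f i \<odot>\<^bsub>N\<^esub> h (t i)" if "i \<in> {i. f i \<noteq> \<zero>\<^bsub>k\<^esub>}" for i
      using *[of i] that assms(3) by (simp add: linear_map_def)
  qed
  finally show ?thesis .
qed

lemma projective_lift:
  fixes P :: "('k, 'u) module" and M :: "('k, 'm) module" and N :: "('k, 'n) module"
  assumes P: "projective k P" and MN: "module k M" "module k N"
    and g: "linear_map k M N g" "g ` carrier M = carrier N"
    and h: "linear_map k P N h"
  shows "\<exists>h'. linear_map k P M h' \<and> (\<forall>x\<in>carrier P. g (h' x) = h x)"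
proof -
  interpret P: module k P using P by (simp add: projective_def)
  let ?I = "carrier P"
  let ?F = "free_module k ?I" and ?p = "lin_comb k P (\<lambda>x. x)"
  have F: "module k ?F" by (rule free_module_module) (rule P.R.is_cring)
  have p: "linear_map k ?F P ?p" by (rule linear_map_lin_comb) (auto intro: P.module_axioms)
  have surj: "?p ` carrier ?F = carrier P"
  proof
    show "?p ` carrier ?F \<subseteq> carrier P" using p by (auto simp: linear_map_def)
    show "carrier P \<subseteq> ?p ` carrier ?F"
    proof
      fix x assume x: "x \<in> carrier P"
      define d where "d = (\<lambda>y. if y = x then \<one>\<^bsub>k\<^esub> else \<zero>\<^bsub>k\<^esub>)"
      have sub: "{y. d y \<noteq> \<zero>\<^bsub>k\<^esub>} \<subseteq> {x}" by (auto simp: d_def)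
      then have d: "d \<in> carrier ?F"
        using x by (auto simp: free_module_def d_def intro: finite_subset)
      have "?p d = finsum P (\<lambda>i. d i \<odot>\<^bsub>P\<^esub> i) {x}"
        using x sub by (intro lin_comb_superset[OF P.module_axioms d]) auto
      then have "?p d = x" using x by (simp add: d_def)
      with d show "x \<in> ?p ` carrier ?F" by (metis image_eqI)
    qed
  qed
  have id: "linear_map k P P (\<lambda>x. x)" by (auto simp: linear_map_def)
  obtain s where s: "linear_map k P ?F s" "\<And>x. x \<in> carrier P \<Longrightarrow> ?p (s x) = x"
    using P F P.module_axioms p surj id unfolding projective_def by meson
  have sF: "s x \<in> carrier ?F" if "x \<in> carrier P" for x
    using s(1) that by (auto simp: linear_map_def)
  have hN: "h x \<in> carrier N" if "x \<in> carrier P" for x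
    using h that by (auto simp: linear_map_def)
  define t where "t = (\<lambda>x. SOME m. m \<in> carrier M \<and> g m = h x)"
  have t: "t x \<in> carrier M \<and> g (t x) = h x" if "x \<in> carrier P" for x
  proof -
    have "\<exists>m. m \<in> carrier M \<and> g m = h x" using hN[OF that] g(2) by (metis imageE)
    then show ?thesis unfolding t_def by (rule someI_ex)
  qed
  then have tM: "t \<in> ?I \<rightarrow> carrier M" by blast
  define h' where "h' = (\<lambda>x\<in>carrier P. lin_comb k M t (s x))"
  have "linear_map k P M h'"
    using linear_map_compose[OF P.module_axioms s(1) linear_map_lin_comb[OF MN(1) tM]]
    by (simp add: h'_def compose_def)
  moreover have "g (h' x) = h x" if x: "x \<in> carrier P" for x
  proof -
    interpret N: module k N by fact
    have "g (h' x) = lin_comb k N (\<lambda>i. g (t i)) (s x)"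
      using linear_map_of_lin_comb[OF MN g(1) sF[OF x] tM] x by (simp add: h'_def)
    also have "\<dots> = lin_comb k N (\<lambda>i. h i) (s x)"
      unfolding lin_comb_def
      by (rule N.M.finsum_cong'[OF refl]) (auto dest!: free_module_supp[OF sF[OF x]] simp: t hN)
    also have "\<dots> = h (?p (s x))"
      using linear_map_of_lin_comb[OF P.module_axioms MN(2) h sF[OF x], of "\<lambda>x. x"] by simp
    also have "\<dots> = h x" using s(2)[OF x] by simp
    finally show ?thesis .
  qed
  ultimately show ?thesis by blast
qed

section \<open>The zero multiplication functor\<close>

text \<open>
  This shows that the clause with \<open>Ext_to_Alg\<close> in \<open>ext_functors\<close> and \<open>functor_triples\<close> is needed:
  the following functor, together with the identity functors of \<open>RModCat k A\<close> and \<open>LModCat k A\<close>,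
  satisfies all other conditions.
\<close>

definition zero_mult :: "('k, 'u) module \<Rightarrow> ('k, 'u) module" where
  "zero_mult R = R\<lparr>mult := restrict2 (\<lambda>_ _. \<zero>\<^bsub>R\<^esub>) (carrier R) (carrier R)\<rparr>"

definition zero_mult_functor where
  "zero_mult_functor k A = forgetful (ExtCat k A) (\<lambda>(R, l, r). (zero_mult R, l, r))"

lemma zero_mult_simps [simp]:
  "carrier (zero_mult R) = carrier R" "zero (zero_mult R) = zero R"
  "add (zero_mult R) = add R" "smult (zero_mult R) = smult R" "one (zero_mult R) = one R"
  "\<lbrakk>x \<in> carrier R; y \<in> carrier R\<rbrakk> \<Longrightarrow> mult (zero_mult R) x y = \<zero>\<^bsub>R\<^esub>"
  "finsum (zero_mult R) = finsum R"
  "forget_mult (zero_mult R) = forget_mult R"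
  by (simp_all add: zero_mult_def finsum_def fun_eq_iff restrict2_def forget_mult_def)

lemma linear_map_zero_mult [simp]: "linear_map k (zero_mult R) N h = linear_map k R N h"
  by (simp add: linear_map_def)

lemma linear_map_zero_mult' [simp]: "linear_map k M (zero_mult R) h = linear_map k M R h"
  by (simp add: linear_map_def)

lemma structure_zero_mult [simp]:
  "left_module k B (zero_mult R) l = left_module k B R l"
  "right_module k B (zero_mult R) r = right_module k B R r"
  "nip_bimodule k B (zero_mult R) l r = nip_bimodule k B R l r"
proof -
  show l: "left_module k B (zero_mult R) l = left_module k B R l"
    using structure_forget_mult(1)[of k B "zero_mult R" l] by simp
  show r: "right_module k B (zero_mult R) r = right_module k B R r"
    using structure_forget_mult(2)[of k B "zero_mult R" r] by simp
  have "projective k (zero_mult R) = projective k R"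
    using structure_forget_mult(7)[of k "zero_mult R"] by simp
  then show "nip_bimodule k B (zero_mult R) l r = nip_bimodule k B R l r"
    by (simp add: nip_bimodule_def bimodule_def l r left_nondegenerate_def
        right_nondegenerate_def left_idempotent_def right_idempotent_def finite_sums_def)
qed

lemma zero_mult_extension:
  assumes "(l, r) \<in> extension_structures k B R"
  shows "(l, r) \<in> extension_structures k B (zero_mult R)"
proof -
  note D = extension_structuresD[OF assms] extension_structures_closed[OF assms]
  interpret module k R by (rule D(2))
  have "module k (zero_mult R)"
    using D(2) by (rule module_cong[rotated -1]) simp_all
  then have "nonunital_algebra k (zero_mult R)"
    by (simp add: nonunital_algebra_def bilinear_map_def linear_map_def)
  moreover have "l b \<zero>\<^bsub>R\<^esub> = \<zero>\<^bsub>R\<^esub>" "r \<zero>\<^bsub>R\<^esub> b = \<zero>\<^bsub>R\<^esub>" if "b \<in> carrier B" for b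
    using that D(3,4)
    by (auto simp: left_module_def right_module_def bilinear_map_def
        intro!: linear_map_zero[OF D(2) D(2), of "l b"] linear_map_zero[OF D(2) D(2), of "\<lambda>x. r x b"])
  ultimately show ?thesis
    using assms D(5,6) by (simp add: extension_structures_def extension_def bimodule_def)
qed

lemma zero_mult_obj:
  "(R, l, r) \<in> Obj (ExtCat k A) \<Longrightarrow> (zero_mult R, l, r) \<in> Obj (ExtCat k A)"
  by (auto simp: ExtCat_def concrete_cat_def zero_mult_extension)
    (simp add: normal_algebra_def zero_mult_def restrict2_def extensional2_def)

lemma zero_mult_algebra_map:
  assumes "module k R" "module k S" "algebra_map k R S h"
  shows "algebra_map k (zero_mult R) (zero_mult S) h"
proof -
  have "h x \<in> carrier S" if "x \<in> carrier R" for x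
    using assms(3) that by (auto simp: algebra_map_def linear_map_def)
  moreover have "h \<zero>\<^bsub>R\<^esub> = \<zero>\<^bsub>S\<^esub>"
    using assms(3) by (intro linear_map_zero[OF assms(1,2)]) (simp add: algebra_map_def)
  ultimately show ?thesis using assms(3) by (simp add: algebra_map_def)
qed

lemma zero_mult_arr:
  assumes "((R, l, r), h, S, l', r') \<in> Arr (ExtCat k A)"
  shows "((zero_mult R, l, r), h, zero_mult S, l', r') \<in> Arr (ExtCat k A)"
proof -
  have "(R, l, r) \<in> Obj (ExtCat k A)" "(S, l', r') \<in> Obj (ExtCat k A)"
    using assms by (auto simp: ExtCat_def concrete_cat_def)
  then show ?thesis
    using assms zero_mult_obj[of R l r k A] zero_mult_obj[of S l' r' k A]
    by (auto simp: ExtCat_def concrete_cat_def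
        intro: zero_mult_algebra_map dest: extension_structuresD(2))
qed

lemma zero_mult_functor_is_functor: "is_functor (ExtCat k A) (ExtCat k A) (zero_mult_functor k A)"
proof -
  show ?thesis
    unfolding zero_mult_functor_def
    apply (subst (1 2 3) ExtCat_def)
    apply (rule forgetful_is_functor[OF _ _ ExtCat_is_category[unfolded ExtCat_def]])
    using zero_mult_obj[of _ _ _ k A] extension_structuresD(2)
     apply (force simp: ExtCat_def concrete_cat_def)
    apply (auto intro: zero_mult_algebra_map dest: extension_structuresD(2))
    done
qed

lemma zero_mult_functor_forget:
  "then_functor (ExtCat k A) (zero_mult_functor k A) (Ext_to_RMod k A) = Ext_to_RMod k A"
  "then_functor (ExtCat k A) (zero_mult_functor k A) (Ext_to_LMod k A) = Ext_to_LMod k A"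
  "then_functor (ExtCat k A) (zero_mult_functor k A) (Ext_to_Mod k A) = Ext_to_Mod k A"
  by (auto simp: then_functor_def zero_mult_functor_def Ext_to_RMod_def Ext_to_LMod_def
      Ext_to_Mod_def forgetful_def fun_eq_iff restrict_def zero_mult_obj zero_mult_arr)

end

theory Submission
  imports Defs
begin

text \<open>
  An algebra map \<open>f : B \<rightarrow> \<M>(A)\<close> and a pair of commuting \<open>B\<close>-actions on \<open>A\<close> that are compatible with
  the multiplication are two readings of the same operators on \<open>A\<close>; see
  \<open>bij_betw_multiplier_maps_extension_structures\<close>. The substance lies in the functors and in the
  extension of \<open>f\<close> to \<open>\<M>(B)\<close>, and both come from one construction.

  Let \<open>C\<close> act on an algebra \<open>D\<close> from both sides, compatibly with the multiplication of \<open>D\<close>. Then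
  \<open>C\<close> acts on every non-degenerate idempotent left \<open>D\<close>-module \<open>M\<close> by \<open>c \<cdot> (d \<cdot> m) = (c \<cdot> d) \<cdot> m\<close>. Since
  \<open>M = D M\<close>, there is at most one such action. It is well defined because
  \<open>d' \<cdot> ((c \<cdot> d) \<cdot> m) = (d' \<cdot> c) \<cdot> (d \<cdot> m)\<close>: whatever \<open>c \<cdot> m\<close> is, its products with all \<open>d'\<close> are known,
  and non-degeneracy says that they determine it. The action is therefore defined as the solution
  of the equations \<open>d' \<cdot> (c \<cdot> m) = (d' \<cdot> c) \<cdot> m\<close> (\<open>induced_left\<close>), which avoids the isomorphism
  \<open>D \<otimes>\<^sub>D M \<cong> M\<close> and makes all its properties a matter of multiplying by \<open>d'\<close>. On an extension of \<open>D\<close>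
  the two actions obtained in this way form an extension of \<open>C\<close> (\<open>extension_transfer\<close>).

  For \<open>D = A\<close> and \<open>C = B\<close> this turns a \<open>B\<close>-extension structure on \<open>A\<close> into functors between the
  categories of extensions and of modules. Conversely, a functor \<open>F\<close> on extensions is determined by
  its value on \<open>A\<close>. Given an extension \<open>R\<close> of
  \<open>A\<close>, the direct sum \<open>A \<oplus> R\<close> with \<open>(a, x) (b, y) = (a b, a \<cdot> y + x \<cdot> b + x y)\<close> is again an extension of
  \<open>A\<close>, and both summands include into it. In the \<open>B\<close>-extension \<open>F (A \<oplus> R)\<close> the identity
  \<open>b \<cdot> ((a, 0) (0, x)) = (b \<cdot> (a, 0)) (0, x)\<close> becomes \<open>b \<cdot> (a \<cdot> x) = (b \<cdot> a) \<cdot> x\<close>, with \<open>b \<cdot> a\<close> computed in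
  \<open>F A\<close>; so the action on \<open>F R\<close> is the induced one (\<open>ext_functor_actions\<close>). A functor on right
  modules is controlled by the morphisms \<open>A \<rightarrow> M\<close>, \<open>a \<mapsto> m \<cdot> a\<close>, in the same way.

  For \<open>D = B\<close>, \<open>C = \<M>(B)\<close> and \<open>M = A\<close> the construction yields \<open>\<M>(B)\<close>-actions on \<open>A\<close>, that is, the
  extension \<open>f' : \<M>(B) \<rightarrow> \<M>(A)\<close> of \<open>f\<close>. It is unique because \<open>f' x\<close> is known on \<open>A = B A = A B\<close>:
  \<open>f' x \<rhd> (b \<cdot> a) = f' (x \<iota>(b)) \<rhd> a = f (x \<rhd> b) \<rhd> a\<close>, and similarly on the right.
\<close>


section \<open>Finite sums, linear maps and actions\<close>

lemma linear_mapD: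
  assumes "linear_map k M N h"
  shows "x \<in> carrier M \<Longrightarrow> h x \<in> carrier N"
    and "\<lbrakk>x \<in> carrier M; y \<in> carrier M\<rbrakk> \<Longrightarrow> h (x \<oplus>\<^bsub>M\<^esub> y) = h x \<oplus>\<^bsub>N\<^esub> h y"
    and "\<lbrakk>c \<in> carrier k; x \<in> carrier M\<rbrakk> \<Longrightarrow> h (c \<odot>\<^bsub>M\<^esub> x) = c \<odot>\<^bsub>N\<^esub> h x"
  using assms by (auto simp: linear_map_def)

lemma linear_map_sum:
  assumes "module k N" "linear_map k M N g" "linear_map k M N h"
  shows "linear_map k M N (\<lambda>x. g x \<oplus>\<^bsub>N\<^esub> h x)"
proof -
  interpret module k N by fact
  show ?thesis
    using assms(2,3) unfolding linear_map_def by (auto simp: M.a_ac smult_r_distr Pi_iff)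
qed

lemma finite_sums_induct [consumes 3, case_names zero incl add]:
  assumes "module k M" "S \<subseteq> carrier M" "x \<in> finite_sums M S"
    and "P \<zero>\<^bsub>M\<^esub>" "\<And>s. s \<in> S \<Longrightarrow> P s"
    and "\<And>x y. \<lbrakk>x \<in> carrier M; y \<in> carrier M; P x; P y\<rbrakk> \<Longrightarrow> P (x \<oplus>\<^bsub>M\<^esub> y)"
  shows "P x"
proof -
  interpret module k M by fact
  have "P (finsum M s {..<n}) \<and> finsum M s {..<n} \<in> carrier M"
    if "s \<in> {..<n} \<rightarrow> S" for s and n :: nat
    using that
  proof (induction n)
    case (Suc n)
    then have "s \<in> {..<n} \<rightarrow> S" "s n \<in> S" by (auto simp: Pi_iff)
    moreover from this have "finsum M s {..<Suc n} = s n \<oplus>\<^bsub>M\<^esub> finsum M s {..<n}"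
      using assms(2) unfolding lessThan_Suc by (intro M.finsum_insert) auto
    moreover have "s n \<in> carrier M" using \<open>s n \<in> S\<close> assms(2) by blast
    ultimately show ?case
      using Suc.IH assms(6)[OF _ _ assms(5)] by simp
  qed (simp add: assms(4))
  then show ?thesis using assms(3) by (auto simp: finite_sums_def)
qed

lemma finite_sums_zero: "module k M \<Longrightarrow> \<zero>\<^bsub>M\<^esub> \<in> finite_sums M S"
  unfolding finite_sums_def
  by (rule CollectI, rule exI[of _ "\<lambda>_. undefined"], rule exI[of _ 0])
    (simp add: abelian_monoid.finsum_empty abelian_group.axioms module.axioms)

lemma finite_sums_add_generator:
  assumes "module k M" "S \<subseteq> carrier M" "s \<in> S" "x \<in> finite_sums M S"
  shows "s \<oplus>\<^bsub>M\<^esub> x \<in> finite_sums M S"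
proof -
  interpret module k M by fact
  obtain t and n :: nat where t: "x = finsum M t {..<n}" "t \<in> {..<n} \<rightarrow> S"
    using assms(4) by (auto simp: finite_sums_def)
  let ?t = "t(n := s)"
  have "finsum M ?t {..<n} = x"
    unfolding t(1) using t(2) assms(2) by (intro M.finsum_cong') auto
  moreover have "finsum M ?t {..<Suc n} = ?t n \<oplus>\<^bsub>M\<^esub> finsum M ?t {..<n}"
    using t(2) assms(2,3) unfolding lessThan_Suc by (intro M.finsum_insert) auto
  moreover have "?t \<in> {..<Suc n} \<rightarrow> S"
    using t(2) assms(3) by (auto simp: Pi_iff)
  ultimately show ?thesis
    unfolding finite_sums_def by (intro CollectI exI[of _ ?t] exI[of _ "Suc n"]) simp
qed

lemma finite_sums_closed:
  assumes "module k M" "S \<subseteq> carrier M" "x \<in> finite_sums M S"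
  shows "x \<in> carrier M"
proof -
  interpret module k M by fact
  show ?thesis
    using assms by (induction rule: finite_sums_induct) (use assms(2) in auto)
qed

lemma finite_sums_incl:
  assumes "module k M" "S \<subseteq> carrier M" "s \<in> S"
  shows "s \<in> finite_sums M S"
proof -
  interpret module k M by fact
  show ?thesis
    using finite_sums_add_generator[OF assms finite_sums_zero[OF assms(1)]] assms(2,3)
    by (simp add: subset_eq)
qed

lemma finite_sums_add:
  assumes "module k M" "S \<subseteq> carrier M" "x \<in> finite_sums M S" "y \<in> finite_sums M S"
  shows "x \<oplus>\<^bsub>M\<^esub> y \<in> finite_sums M S"
proof -
  interpret module k M by fact
  note closed = finite_sums_closed[OF assms(1,2)]
  have "\<forall>y\<in>finite_sums M S. x \<oplus>\<^bsub>M\<^esub> y \<in> finite_sums M S"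
    using assms(1-3)
  proof (induction rule: finite_sums_induct)
    case zero
    then show ?case using closed by simp
  next
    case (incl s)
    then show ?case using finite_sums_add_generator[OF assms(1,2)] by blast
  next
    case (add u v)
    then show ?case using closed by (simp add: M.a_assoc)
  qed
  then show ?thesis using assms(4) by blast
qed

locale left_act =
  fixes k :: "('k, 'z) ring_scheme" and A :: "('k, 'a) module" and M :: "('k, 'm) module"
    and l :: "'a \<Rightarrow> 'm \<Rightarrow> 'm"
  assumes left_module: "left_module k A M l"
begin

sublocale module k M
  using left_module by (rule left_module_module)

lemma lin_right: "a \<in> carrier A \<Longrightarrow> linear_map k M M (l a)"
  and lin_left: "m \<in> carrier M \<Longrightarrow> linear_map k A M (\<lambda>a. l a m)"
  using left_module by (auto simp: left_module_def bilinear_map_def)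

lemmas act_closed [simp, intro] = linear_mapD(1)[OF lin_right]
lemmas act_add_right = linear_mapD(2)[OF lin_right]
lemmas act_smult_right = linear_mapD(3)[OF lin_right]
lemmas act_zero_right = linear_map_zero[OF module_axioms module_axioms lin_right]
lemmas act_add_left = linear_mapD(2)[OF lin_left]
lemmas act_smult_left = linear_mapD(3)[OF lin_left]
lemmas act_zero_left = linear_map_zero[OF _ module_axioms lin_left]

lemma act_assoc:
  "\<lbrakk>a \<in> carrier A; b \<in> carrier A; m \<in> carrier M\<rbrakk> \<Longrightarrow> l (a \<otimes>\<^bsub>A\<^esub> b) m = l a (l b m)"
  using left_module by (simp add: left_module_def)

lemma act_image_subset: "{l a m | a m. a \<in> carrier A \<and> m \<in> carrier M} \<subseteq> carrier M"
  by auto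

text \<open>Checking a property that is closed under sums on the elements \<open>a \<cdot> m\<close> is how idempotence is
  used throughout.\<close>

lemma idempotent_induct [consumes 2, case_names zero act add]:
  assumes "left_idempotent A M l" "x \<in> carrier M"
    and "P \<zero>\<^bsub>M\<^esub>" "\<And>a m. \<lbrakk>a \<in> carrier A; m \<in> carrier M\<rbrakk> \<Longrightarrow> P (l a m)"
    and "\<And>x y. \<lbrakk>x \<in> carrier M; y \<in> carrier M; P x; P y\<rbrakk> \<Longrightarrow> P (x \<oplus>\<^bsub>M\<^esub> y)"
  shows "P x"
proof -
  have "x \<in> finite_sums M {l a m | a m. a \<in> carrier A \<and> m \<in> carrier M}"
    using assms(1,2) by (simp add: left_idempotent_def)
  with module_axioms act_image_subset show ?thesis
    by (induction rule: finite_sums_induct) (blast intro: assms(3-5))+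
qed

lemma idempotentI:
  assumes "\<And>x. x \<in> carrier M \<Longrightarrow> x \<in> finite_sums M {l a m | a m. a \<in> carrier A \<and> m \<in> carrier M}"
  shows "left_idempotent A M l"
  unfolding left_idempotent_def
proof
  show "carrier M \<subseteq> finite_sums M {l a m | a m. a \<in> carrier A \<and> m \<in> carrier M}"
    using assms by blast
qed (rule subsetI, rule finite_sums_closed[OF module_axioms act_image_subset])

lemma nondegenerate_eqI:
  assumes "left_nondegenerate A M l" "x \<in> carrier M" "y \<in> carrier M"
    and "\<And>a. a \<in> carrier A \<Longrightarrow> l a x = l a y"
  shows "x = y"
proof -
  let ?d = "x \<oplus>\<^bsub>M\<^esub> \<ominus>\<^bsub>M\<^esub> y"
  have "l a ?d = \<zero>\<^bsub>M\<^esub>" if "a \<in> carrier A" for a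
  proof -
    have "l a ?d = l a y \<oplus>\<^bsub>M\<^esub> l a (\<ominus>\<^bsub>M\<^esub> y)"
      using that assms by (simp add: act_add_right)
    also have "\<dots> = l a (y \<oplus>\<^bsub>M\<^esub> \<ominus>\<^bsub>M\<^esub> y)"
      using that assms by (subst act_add_right) auto
    also have "\<dots> = \<zero>\<^bsub>M\<^esub>" using that assms by (simp add: M.r_neg act_zero_right)
    finally show ?thesis .
  qed
  then have "?d = \<zero>\<^bsub>M\<^esub>"
    using assms(1-3) by (simp add: left_nondegenerate_def)
  then have "\<ominus>\<^bsub>M\<^esub> (\<ominus>\<^bsub>M\<^esub> y) = x" using assms(2,3) by (intro M.minus_equality) auto
  then show ?thesis using assms(3) by simp
qed

end

section \<open>The opposite algebra\<close>

text \<open>Right modules over an algebra are left modules over the opposite algebra. The action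
  of one algebra induced by another is constructed on left modules and transported along this.\<close>

definition opp :: "('k, 'a) module \<Rightarrow> ('k, 'a) module" where
  "opp A = A\<lparr>mult := \<lambda>x y. y \<otimes>\<^bsub>A\<^esub> x\<rparr>"

lemma opp_simps [simp]:
  "carrier (opp A) = carrier A" "zero (opp A) = zero A" "add (opp A) = add A"
  "smult (opp A) = smult A" "x \<otimes>\<^bsub>opp A\<^esub> y = y \<otimes>\<^bsub>A\<^esub> x" "finsum (opp A) = finsum A"
  by (simp_all add: opp_def finsum_def fun_eq_iff)

lemma module_opp [simp]: "module k (opp A) = module k A"
  by (rule iffI; rule module_cong; simp)

lemma linear_map_opp [simp]:
  "linear_map k (opp A) N h = linear_map k A N h" "linear_map k M (opp A) g = linear_map k M A g"
  by (simp_all add: linear_map_def)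

lemma left_opp [simp]:
  "left_module k (opp A) M (\<lambda>a m. r m a) = right_module k A M r"
  "left_nondegenerate (opp A) M (\<lambda>a m. r m a) = right_nondegenerate A M r"
  "left_idempotent (opp A) M (\<lambda>a m. r m a) = right_idempotent A M r"
proof -
  have "{r m a | a m. a \<in> carrier A \<and> m \<in> carrier M} = {r m a | m a. m \<in> carrier M \<and> a \<in> carrier A}"
    by blast
  then show "left_idempotent (opp A) M (\<lambda>a m. r m a) = right_idempotent A M r"
    by (simp add: left_idempotent_def right_idempotent_def)
qed (auto simp: left_module_def right_module_def left_nondegenerate_def right_nondegenerate_def
      bilinear_map_def)

lemma right_opp [simp]:
  "right_module k (opp A) M (\<lambda>m a. l a m) = left_module k A M l"
  "right_idempotent (opp A) M (\<lambda>m a. l a m) = left_idempotent A M l"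
proof -
  have "{l a m | m a. m \<in> carrier M \<and> a \<in> carrier A} = {l a m | a m. a \<in> carrier A \<and> m \<in> carrier M}"
    by blast
  then show "right_idempotent (opp A) M (\<lambda>m a. l a m) = left_idempotent A M l"
    by (simp add: left_idempotent_def right_idempotent_def)
qed (auto simp: left_module_def right_module_def bilinear_map_def)

lemma module_structure_opp [simp]:
  "left_module k C (opp D) l = left_module k C D l"
  "right_module k C (opp D) r = right_module k C D r"
  "left_idempotent C (opp D) l = left_idempotent C D l"
  "right_idempotent C (opp D) r = right_idempotent C D r"
  by (simp_all add: left_module_def right_module_def bilinear_map_def left_idempotent_def
      right_idempotent_def finite_sums_def)

locale right_act =
  fixes k :: "('k, 'z) ring_scheme" and A :: "('k, 'a) module" and M :: "('k, 'm) module"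
    and r :: "'m \<Rightarrow> 'a \<Rightarrow> 'm"
  assumes right_module: "right_module k A M r"
begin

sublocale left_act k "opp A" M "\<lambda>a m. r m a"
  rewrites "carrier (opp A) = carrier A" and "zero (opp A) = zero A" and "add (opp A) = add A"
    and "smult (opp A) = smult A"
    and "module k (opp A) = module k A"
    and "\<And>a b. a \<otimes>\<^bsub>opp A\<^esub> b = b \<otimes>\<^bsub>A\<^esub> a"
    and "left_nondegenerate (opp A) M (\<lambda>a m. r m a) = right_nondegenerate A M r"
    and "left_idempotent (opp A) M (\<lambda>a m. r m a) = right_idempotent A M r"
  by unfold_locales (simp_all add: right_module)

end

section \<open>Changing the acting algebra\<close>

text \<open>Like an extension, except that the left and the right action on \<open>D\<close> need not commute. This
  matters: the multiplier algebra of \<open>D\<close> acts on \<open>D\<close> in this way, but when \<open>D\<close> is degenerate the two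
  actions commute only up to annihilators.\<close>

definition multiplier_action where
  "multiplier_action k C D l r \<longleftrightarrow> nonunital_algebra k D \<and>
     left_module k C D l \<and> right_module k C D r \<and>
     (\<forall>c\<in>carrier C. \<forall>x\<in>carrier D. \<forall>y\<in>carrier D.
        l c (x \<otimes>\<^bsub>D\<^esub> y) = l c x \<otimes>\<^bsub>D\<^esub> y \<and>
        r (x \<otimes>\<^bsub>D\<^esub> y) c = x \<otimes>\<^bsub>D\<^esub> r y c \<and>
        r x c \<otimes>\<^bsub>D\<^esub> y = x \<otimes>\<^bsub>D\<^esub> l c y)"

lemma nonunital_algebra_opp: "nonunital_algebra k D \<Longrightarrow> nonunital_algebra k (opp D)"
  by (auto simp: nonunital_algebra_def bilinear_map_def)

lemma multiplier_action_opp: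
  "multiplier_action k C D l r \<Longrightarrow> multiplier_action k (opp C) (opp D) (\<lambda>c d. r d c) (\<lambda>d c. l c d)"
  by (simp add: multiplier_action_def nonunital_algebra_opp)

lemma extension_multiplier_action: "extension k C D l r \<Longrightarrow> multiplier_action k C D l r"
  by (simp add: extension_def multiplier_action_def bimodule_def)

text \<open>The action of \<open>C\<close> on a \<open>D\<close>-module should be \<open>c \<cdot> (d \<cdot> m) = (c \<cdot> d) \<cdot> m\<close>. The value on a sum of
  elements \<open>d \<cdot> m\<close> is pinned down, without choosing such a sum, by \<open>d \<cdot> (c \<cdot> m) = (d \<cdot> c) \<cdot> m\<close>
  for all \<open>d\<close>.\<close>

definition induced_left :: "('k, 'c) module \<Rightarrow> ('k, 'd) module \<Rightarrow> ('k, 'm) module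
    \<Rightarrow> ('d \<Rightarrow> 'm \<Rightarrow> 'm) \<Rightarrow> ('d \<Rightarrow> 'c \<Rightarrow> 'd) \<Rightarrow> 'c \<Rightarrow> 'm \<Rightarrow> 'm" where
  "induced_left C D M lm rc = restrict2
     (\<lambda>c m. THE y. y \<in> carrier M \<and> (\<forall>d\<in>carrier D. lm d y = lm (rc d c) m))
     (carrier C) (carrier M)"

definition induced_right :: "('k, 'c) module \<Rightarrow> ('k, 'd) module \<Rightarrow> ('k, 'm) module
    \<Rightarrow> ('m \<Rightarrow> 'd \<Rightarrow> 'm) \<Rightarrow> ('c \<Rightarrow> 'd \<Rightarrow> 'd) \<Rightarrow> 'm \<Rightarrow> 'c \<Rightarrow> 'm" where
  "induced_right C D M rm lc =
     (\<lambda>m c. induced_left (opp C) (opp D) M (\<lambda>d m. rm m d) (\<lambda>d c. lc c d) c m)"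

lemma induced_left_extensional: "induced_left C D M lm rc \<in> extensional2 (carrier C) (carrier M)"
  by (simp add: induced_left_def restrict2_def extensional2_def)

lemma induced_right_extensional: "induced_right C D M rm lc \<in> extensional2 (carrier M) (carrier C)"
  by (auto simp: induced_right_def induced_left_def restrict2_def extensional2_def)

text \<open>Actions are undefined outside the carriers, so the laws of an action of \<open>C\<close> make sense only
  if the carrier of \<open>C\<close> is closed. In this form the condition applies to \<open>C = \<M>(D)\<close> directly.\<close>

definition operations_closed :: "('k, 'z) ring_scheme \<Rightarrow> ('k, 'c) module \<Rightarrow> bool" where
  "operations_closed k C \<longleftrightarrow>
     (\<forall>x\<in>carrier C. \<forall>y\<in>carrier C. x \<oplus>\<^bsub>C\<^esub> y \<in> carrier C \<and> x \<otimes>\<^bsub>C\<^esub> y \<in> carrier C) \<and>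
     (\<forall>t\<in>carrier k. \<forall>x\<in>carrier C. t \<odot>\<^bsub>C\<^esub> x \<in> carrier C)"

lemma nonunital_algebra_operations_closed:
  assumes "nonunital_algebra k C"
  shows "operations_closed k C"
proof -
  interpret module k C using assms by (simp add: nonunital_algebra_def)
  show ?thesis
    by (simp add: operations_closed_def nonunital_algebra_closed[OF assms])
qed

lemma operations_closed_opp: "operations_closed k C \<Longrightarrow> operations_closed k (opp C)"
  by (simp add: operations_closed_def)

locale left_transfer = M: left_act k D M lm
  for k :: "('k, 'z) ring_scheme" and C :: "('k, 'c) module" and D :: "('k, 'd) module"
    and lc rc and M :: "('k, 'm) module" and lm +
  assumes C_closed: "operations_closed k C"
    and mult_act: "multiplier_action k C D lc rc"
    and nondeg: "left_nondegenerate D M lm" and idem: "left_idempotent D M lm"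
begin

lemma D_left: "left_module k C D lc" and D_right: "right_module k C D rc"
  and D_algebra: "nonunital_algebra k D"
  using mult_act by (auto simp: multiplier_action_def)

sublocale L: left_act k C D lc by unfold_locales (rule D_left)
sublocale R: right_act k C D rc by unfold_locales (rule D_right)

abbreviation ind where "ind \<equiv> induced_left C D M lm rc"

lemma mult_act_simps:
  assumes "c \<in> carrier C" "x \<in> carrier D" "y \<in> carrier D"
  shows "lc c (x \<otimes>\<^bsub>D\<^esub> y) = lc c x \<otimes>\<^bsub>D\<^esub> y" "rc (x \<otimes>\<^bsub>D\<^esub> y) c = x \<otimes>\<^bsub>D\<^esub> rc y c"
    "rc x c \<otimes>\<^bsub>D\<^esub> y = x \<otimes>\<^bsub>D\<^esub> lc c y"
  using mult_act assms by (auto simp: multiplier_action_def)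

text \<open>Both the existence of the induced action and its value on \<open>d \<cdot> m\<close> come down to this
  identity.\<close>

lemma balanced:
  assumes "c \<in> carrier C" "x \<in> carrier D" "y \<in> carrier D" "m \<in> carrier M"
  shows "lm x (lm (lc c y) m) = lm (rc x c) (lm y m)"
proof -
  have "lm x (lm (lc c y) m) = lm (x \<otimes>\<^bsub>D\<^esub> lc c y) m"
    using assms by (simp add: M.act_assoc)
  also have "\<dots> = lm (rc x c \<otimes>\<^bsub>D\<^esub> y) m" using assms by (simp add: mult_act_simps(3))
  also have "\<dots> = lm (rc x c) (lm y m)" using assms by (simp add: M.act_assoc)
  finally show ?thesis .
qed

lemma ind_exists:
  assumes c: "c \<in> carrier C" and "m \<in> carrier M"
  shows "\<exists>y\<in>carrier M. \<forall>d\<in>carrier D. lm d y = lm (rc d c) m"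
  using idem assms(2)
proof (induction rule: M.idempotent_induct)
  case zero
  then show ?case using c by (intro bexI[of _ "\<zero>\<^bsub>M\<^esub>"]) (auto simp: M.act_zero_right)
next
  case (act a m)
  then show ?case using c by (intro bexI[of _ "lm (lc c a) m"]) (auto simp: balanced)
next
  case (add x y)
  then obtain x' y' where "x' \<in> carrier M" "y' \<in> carrier M"
    "\<And>d. d \<in> carrier D \<Longrightarrow> lm d x' = lm (rc d c) x" "\<And>d. d \<in> carrier D \<Longrightarrow> lm d y' = lm (rc d c) y"
    by blast
  with add(1,2) c show ?case
    by (intro bexI[of _ "x' \<oplus>\<^bsub>M\<^esub> y'"]) (auto simp: M.act_add_right)
qed

lemma ind_eqI:
  assumes "c \<in> carrier C" "m \<in> carrier M" "y \<in> carrier M"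
    and "\<And>d. d \<in> carrier D \<Longrightarrow> lm d y = lm (rc d c) m"
  shows "ind c m = y"
proof -
  have "(THE y. y \<in> carrier M \<and> (\<forall>d\<in>carrier D. lm d y = lm (rc d c) m)) = y"
  proof (rule the_equality)
    show "y \<in> carrier M \<and> (\<forall>d\<in>carrier D. lm d y = lm (rc d c) m)" using assms(3,4) by blast
    show "z = y" if "z \<in> carrier M \<and> (\<forall>d\<in>carrier D. lm d z = lm (rc d c) m)" for z
    proof (rule M.nondegenerate_eqI[OF nondeg])
      show "lm d z = lm d y" if "d \<in> carrier D" for d
        using \<open>z \<in> carrier M \<and> _\<close> assms(4)[OF that] that by simp
    qed (use that assms(3) in auto)
  qed
  then show ?thesis using assms(1,2) by (simp add: induced_left_def restrict2_def)
qed

lemma ind_closed [simp, intro]: "\<lbrakk>c \<in> carrier C; m \<in> carrier M\<rbrakk> \<Longrightarrow> ind c m \<in> carrier M"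
  and ind_char: "\<lbrakk>c \<in> carrier C; m \<in> carrier M; d \<in> carrier D\<rbrakk> \<Longrightarrow> lm d (ind c m) = lm (rc d c) m"
  using ind_exists[of c m] ind_eqI[of c m] by metis+

lemma ind_act:
  "\<lbrakk>c \<in> carrier C; d \<in> carrier D; m \<in> carrier M\<rbrakk> \<Longrightarrow> ind c (lm d m) = lm (lc c d) m"
  by (rule ind_eqI) (auto simp: balanced)

lemma rc_closed [simp, intro]: "\<lbrakk>d \<in> carrier D; c \<in> carrier C\<rbrakk> \<Longrightarrow> rc d c \<in> carrier D"
  by (rule R.act_closed)

lemma ind_module: "left_module k C M ind"
  unfolding left_module_def bilinear_map_def linear_map_def
proof (intro conjI ballI funcsetI ind_closed M.module_axioms)
  fix c x y assume c: "c \<in> carrier C" and xy: "x \<in> carrier M" "y \<in> carrier M"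
  show "ind c (x \<oplus>\<^bsub>M\<^esub> y) = ind c x \<oplus>\<^bsub>M\<^esub> ind c y"
    by (rule ind_eqI) (simp_all add: c xy M.act_add_right ind_char)
next
  fix c t x assume c: "c \<in> carrier C" and t: "t \<in> carrier k" and x: "x \<in> carrier M"
  show "ind c (t \<odot>\<^bsub>M\<^esub> x) = t \<odot>\<^bsub>M\<^esub> ind c x"
    by (rule ind_eqI) (simp_all add: c t x M.act_smult_right ind_char)
next
  fix x b c assume x: "x \<in> carrier M" and bc: "b \<in> carrier C" "c \<in> carrier C"
  then have "b \<oplus>\<^bsub>C\<^esub> c \<in> carrier C" using C_closed by (simp add: operations_closed_def)
  then show "ind (b \<oplus>\<^bsub>C\<^esub> c) x = ind b x \<oplus>\<^bsub>M\<^esub> ind c x"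
    by (rule ind_eqI) (simp_all add: x bc R.act_add_left M.act_add_left M.act_add_right ind_char)
next
  fix x t c assume x: "x \<in> carrier M" and t: "t \<in> carrier k" and c: "c \<in> carrier C"
  then have "t \<odot>\<^bsub>C\<^esub> c \<in> carrier C" using C_closed by (simp add: operations_closed_def)
  then show "ind (t \<odot>\<^bsub>C\<^esub> c) x = t \<odot>\<^bsub>M\<^esub> ind c x"
    by (rule ind_eqI) (simp_all add: x t c R.act_smult_left M.act_smult_left M.act_smult_right ind_char)
next
  fix b c x assume bc: "b \<in> carrier C" "c \<in> carrier C" and x: "x \<in> carrier M"
  then have "b \<otimes>\<^bsub>C\<^esub> c \<in> carrier C" using C_closed by (simp add: operations_closed_def)
  then show "ind (b \<otimes>\<^bsub>C\<^esub> c) x = ind b (ind c x)"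
    by (rule ind_eqI) (simp_all add: x bc R.act_assoc ind_char)
qed

end


context left_transfer
begin

text \<open>If all of \<open>C\<close> kills \<open>x\<close>, then so does \<open>D = D \<cdot> C\<close>, as \<open>(d \<cdot> c) \<cdot> x = d \<cdot> (c \<cdot> x)\<close>.\<close>

lemma ind_nondegenerate:
  assumes "right_idempotent C D rc"
  shows "left_nondegenerate C M ind"
  unfolding left_nondegenerate_def
proof (intro ballI impI)
  fix x assume x: "x \<in> carrier M" and 0: "\<forall>c\<in>carrier C. ind c x = \<zero>\<^bsub>M\<^esub>"
  have D: "module k D" by (rule left_module_module[OF D_left])
  have "lm d x = \<zero>\<^bsub>M\<^esub>" if "d \<in> carrier D" for d
    using assms that
  proof (induction rule: R.idempotent_induct)
    case zero
    then show ?case using x D by (simp add: M.act_zero_left)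
  next
    case (act c d)
    then have "lm (rc d c) x = lm d (ind c x)" using x by (simp add: ind_char)
    then show ?case using act 0 by (simp add: M.act_zero_right)
  next
    case (add d d')
    then show ?case using x by (simp add: M.act_add_left)
  qed
  then show "x = \<zero>\<^bsub>M\<^esub>" using nondeg x by (simp add: left_nondegenerate_def)
qed

text \<open>Writing \<open>D = C \<cdot> D\<close> inside \<open>M = D \<cdot> M\<close> gives \<open>M = C \<cdot> M\<close>, as \<open>(c \<cdot> d) \<cdot> m = c \<cdot> (d \<cdot> m)\<close>.\<close>

lemma ind_idempotent:
  assumes "left_idempotent C D lc"
  shows "left_idempotent C M ind"
proof -
  interpret I: left_act k C M ind by unfold_locales (rule ind_module)
  let ?S = "{ind c m | c m. c \<in> carrier C \<and> m \<in> carrier M}"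
  note sums = M.module_axioms I.act_image_subset
  have *: "lm d m \<in> finite_sums M ?S" if "d \<in> carrier D" "m \<in> carrier M" for d m
    using assms that(1)
  proof (induction rule: L.idempotent_induct)
    case zero
    then show ?case
      using that finite_sums_zero[OF M.module_axioms] left_module_module[OF D_left] by (simp add: M.act_zero_left)
  next
    case (act c d)
    then have "lm (lc c d) m = ind c (lm d m)" using that by (simp add: ind_act)
    then show ?case
      using act that by (auto intro!: finite_sums_incl[OF sums])
  next
    case (add d d')
    then show ?case using that by (simp add: M.act_add_left finite_sums_add[OF sums])
  qed
  show ?thesis
  proof (rule I.idempotentI)
    fix x assume "x \<in> carrier M"
    with idem show "x \<in> finite_sums M ?S"
      by (induction rule: M.idempotent_induct)
        (simp_all add: * finite_sums_zero[OF M.module_axioms] finite_sums_add[OF sums])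
  qed
qed

lemma ind_unique:
  assumes "left_module k C M l'"
    and "\<And>c d m. \<lbrakk>c \<in> carrier C; d \<in> carrier D; m \<in> carrier M\<rbrakk> \<Longrightarrow> l' c (lm d m) = lm (lc c d) m"
    and c: "c \<in> carrier C" and "m \<in> carrier M"
  shows "l' c m = ind c m"
proof -
  interpret I: left_act k C M ind by unfold_locales (rule ind_module)
  interpret L': left_act k C M l' by unfold_locales (rule assms(1))
  show ?thesis
    using idem assms(4)
    by (induction rule: M.idempotent_induct)
      (simp_all add: c assms(2) ind_act L'.act_zero_right I.act_zero_right
        L'.act_add_right I.act_add_right)
qed

end

text \<open>Being defined by equations that involve only the \<open>D\<close>-action, the induced action is respected
  by every \<open>D\<close>-linear map. This makes it functorial.\<close>

lemma induced_left_natural: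
  assumes M: "left_transfer k C D lc rc M lm" and N: "left_transfer k C D lc rc N ln"
    and h: "linear_map k M N h"
    and hl: "\<And>d m. \<lbrakk>d \<in> carrier D; m \<in> carrier M\<rbrakk> \<Longrightarrow> h (lm d m) = ln d (h m)"
    and c: "c \<in> carrier C" "m \<in> carrier M"
  shows "h (induced_left C D M lm rc c m) = induced_left C D N ln rc c (h m)"
proof -
  interpret M: left_transfer k C D lc rc M lm by (rule M)
  interpret N: left_transfer k C D lc rc N ln by (rule N)
  have "ln d (h (M.ind c m)) = ln (rc d c) (h m)" if "d \<in> carrier D" for d
    using that c by (simp add: hl[symmetric] M.ind_char)
  then show ?thesis
    using c linear_mapD(1)[OF h] by (metis N.ind_eqI M.ind_closed)
qed

locale right_transfer = M: right_act k D M rm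
  for k :: "('k, 'z) ring_scheme" and C :: "('k, 'c) module" and D :: "('k, 'd) module"
    and lc rc and M :: "('k, 'm) module" and rm +
  assumes C_closed: "operations_closed k C"
    and mult_act: "multiplier_action k C D lc rc"
    and nondeg: "right_nondegenerate D M rm" and idem: "right_idempotent D M rm"
begin

sublocale op: left_transfer k "opp C" "opp D" "\<lambda>c d. rc d c" "\<lambda>d c. lc c d" M "\<lambda>d m. rm m d"
  by unfold_locales
    (simp_all add: operations_closed_opp[OF C_closed] multiplier_action_opp[OF mult_act]
      nondeg idem M.right_module)

abbreviation ind where "ind \<equiv> induced_right C D M rm lc"

lemma ind_eqI:
  assumes "c \<in> carrier C" "m \<in> carrier M" "y \<in> carrier M"
    and "\<And>d. d \<in> carrier D \<Longrightarrow> rm y d = rm m (lc c d)"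
  shows "ind m c = y"
  unfolding induced_right_def using assms by (intro op.ind_eqI) auto

lemma
  shows ind_closed: "\<lbrakk>m \<in> carrier M; c \<in> carrier C\<rbrakk> \<Longrightarrow> ind m c \<in> carrier M"
    and ind_char: "\<lbrakk>c \<in> carrier C; m \<in> carrier M; d \<in> carrier D\<rbrakk> \<Longrightarrow> rm (ind m c) d = rm m (lc c d)"
  using op.ind_closed[of c m] op.ind_char[of c m d]
  by (simp_all add: induced_right_def)

lemma ind_module: "right_module k C M ind"
  using op.ind_module left_opp(1)[of k C M ind] by (simp add: induced_right_def)

lemma ind_nondegenerate: "left_idempotent C D lc \<Longrightarrow> right_nondegenerate C M ind"
  using op.ind_nondegenerate left_opp(2)[of C M ind] by (simp add: induced_right_def)

lemma ind_idempotent: "right_idempotent C D rc \<Longrightarrow> right_idempotent C M ind"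
  using op.ind_idempotent left_opp(3)[of C M ind] by (simp add: induced_right_def)

lemma ind_unique:
  assumes "right_module k C M r'"
    and "\<And>c d m. \<lbrakk>c \<in> carrier C; d \<in> carrier D; m \<in> carrier M\<rbrakk> \<Longrightarrow> r' (rm m d) c = rm m (rc d c)"
    and "c \<in> carrier C" "m \<in> carrier M"
  shows "r' m c = ind m c"
  using op.ind_unique[of "\<lambda>c m. r' m c" c m] assms by (simp add: induced_right_def)

end

lemma induced_right_natural:
  assumes M: "right_transfer k C D lc rc M rm" and N: "right_transfer k C D lc rc N rn"
    and h: "linear_map k M N h"
    and hr: "\<And>d m. \<lbrakk>d \<in> carrier D; m \<in> carrier M\<rbrakk> \<Longrightarrow> h (rm m d) = rn (h m) d"
    and c: "c \<in> carrier C" "m \<in> carrier M"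
  shows "h (induced_right C D M rm lc m c) = induced_right C D N rn lc (h m) c"
proof -
  interpret M: right_transfer k C D lc rc M rm by (rule M)
  interpret N: right_transfer k C D lc rc N rn by (rule N)
  show ?thesis
    using induced_left_natural[OF M.op.left_transfer_axioms N.op.left_transfer_axioms h, of c m] hr c
    by (simp add: induced_right_def)
qed

locale extension_transfer =
  fixes k :: "('k, 'z) ring_scheme" and C :: "('k, 'c) module" and D :: "('k, 'd) module"
    and lc rc and R :: "('k, 'r) module" and lr rr
  assumes C_closed: "operations_closed k C"
    and mult_act: "multiplier_action k C D lc rc"
    and ext: "extension k D R lr rr"
    and nondeg: "left_nondegenerate D R lr" "right_nondegenerate D R rr"
    and idem: "left_idempotent D R lr" "right_idempotent D R rr"
begin

sublocale L: left_transfer k C D lc rc R lr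
  by unfold_locales (use ext in \<open>simp_all add: C_closed mult_act nondeg idem extension_def bimodule_def\<close>)

sublocale R: right_transfer k C D lc rc R rr
  by unfold_locales (use ext in \<open>simp_all add: C_closed mult_act nondeg idem extension_def bimodule_def\<close>)

lemma ext_simps:
  assumes "d \<in> carrier D" "x \<in> carrier R" "y \<in> carrier R"
  shows "lr d (x \<otimes>\<^bsub>R\<^esub> y) = lr d x \<otimes>\<^bsub>R\<^esub> y" "rr (x \<otimes>\<^bsub>R\<^esub> y) d = x \<otimes>\<^bsub>R\<^esub> rr y d"
    "rr x d \<otimes>\<^bsub>R\<^esub> y = x \<otimes>\<^bsub>R\<^esub> lr d y"
  using ext assms by (auto simp: extension_def)

lemma commute:
  "\<lbrakk>d \<in> carrier D; e \<in> carrier D; x \<in> carrier R\<rbrakk> \<Longrightarrow> rr (lr d x) e = lr d (rr x e)"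
  using ext by (auto simp: extension_def bimodule_def)

lemma algebra: "nonunital_algebra k R"
  using ext by (simp add: extension_def)

lemmas mult_closed [simp] = nonunital_algebra_closed[OF algebra]

lemma mult_lin:
  assumes "x \<in> carrier R"
  shows "linear_map k R R (\<lambda>y. x \<otimes>\<^bsub>R\<^esub> y)" "linear_map k R R (\<lambda>y. y \<otimes>\<^bsub>R\<^esub> x)"
  using algebra assms by (auto simp: nonunital_algebra_def bilinear_map_def)

text \<open>The commutation of the two induced actions is reduced in two steps to that of the two
  \<open>D\<close>-actions on \<open>R\<close>: this is the first, for \<open>D\<close> on the left and \<open>C\<close> on the right.\<close>

lemma D_acts_C_commute:
  assumes "d \<in> carrier D" "x \<in> carrier R" "c \<in> carrier C"
  shows "lr d (R.ind x c) = R.ind (lr d x) c"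
  using assms
  by (intro R.ind_eqI[symmetric]) (simp_all add: R.ind_closed commute R.ind_char L.L.act_closed)

lemma ind_bimodule: "bimodule k C R L.ind R.ind"
  unfolding bimodule_def
proof (intro conjI ballI)
  show "left_module k C R L.ind" by (rule L.ind_module)
  show "right_module k C R R.ind" by (rule R.ind_module)
  fix b c x assume *: "b \<in> carrier C" "c \<in> carrier C" "x \<in> carrier R"
  show "R.ind (L.ind b x) c = L.ind b (R.ind x c)"
    using * by (intro L.ind_eqI[symmetric])
      (simp_all add: R.ind_closed D_acts_C_commute L.ind_char)
qed

lemma ind_extension: "extension k C R L.ind R.ind"
  unfolding extension_def
proof (intro conjI ballI)
  show "nonunital_algebra k R" by (rule algebra)
  show "bimodule k C R L.ind R.ind" by (rule ind_bimodule)
  fix c x y assume *: "c \<in> carrier C" "x \<in> carrier R" "y \<in> carrier R"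
  show "L.ind c (x \<otimes>\<^bsub>R\<^esub> y) = L.ind c x \<otimes>\<^bsub>R\<^esub> y"
    using * by (intro L.ind_eqI) (simp_all add: ext_simps(1) L.ind_char)
  show "R.ind (x \<otimes>\<^bsub>R\<^esub> y) c = x \<otimes>\<^bsub>R\<^esub> R.ind y c"
    using * by (intro R.ind_eqI) (simp_all add: ext_simps(2) R.ind_char R.ind_closed L.L.act_closed)
  \<comment> \<open>Multiplying by \<open>D\<close> from outside does not reach the middle of the product, so the right
    factor is written as a sum of products \<open>d \<cdot> y\<close> instead.\<close>
  show "R.ind x c \<otimes>\<^bsub>R\<^esub> y = x \<otimes>\<^bsub>R\<^esub> L.ind c y"
    using idem(1) *(3)
  proof (induction rule: L.M.idempotent_induct)
    case zero
    interpret I: left_act k C R L.ind by unfold_locales (rule L.ind_module)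
    show ?case
      using * linear_map_zero[OF L.M.module_axioms L.M.module_axioms mult_lin(1)]
      by (simp add: R.ind_closed I.act_zero_right)
  next
    case (act d y)
    have "R.ind x c \<otimes>\<^bsub>R\<^esub> lr d y = rr (R.ind x c) d \<otimes>\<^bsub>R\<^esub> y"
      using * act by (simp add: R.ind_closed ext_simps(3))
    also have "\<dots> = x \<otimes>\<^bsub>R\<^esub> lr (lc c d) y"
      using * act by (simp add: R.ind_char ext_simps(3) L.L.act_closed)
    finally show ?case using * act by (simp add: L.ind_act)
  next
    case (add y z)
    interpret I: left_act k C R L.ind by unfold_locales (rule L.ind_module)
    show ?case
      using * add linear_mapD(2)[OF mult_lin(1)] by (simp add: R.ind_closed I.act_add_right)
  qed
qed

text \<open>Each idempotence assumption serves twice: \<open>D = D \<cdot> C\<close> makes the left action non-degenerate and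
  the right action idempotent, and \<open>D = C \<cdot> D\<close> does the same with left and right exchanged.\<close>

lemma ind_extension_structure:
  assumes "left_idempotent C D lc" "right_idempotent C D rc" "projective k R"
  shows "(L.ind, R.ind) \<in> extension_structures k C R"
  using assms
  by (simp add: extension_structures_def nip_bimodule_def ind_extension ind_bimodule
      induced_left_extensional induced_right_extensional L.ind_nondegenerate
      R.ind_nondegenerate L.ind_idempotent R.ind_idempotent)

end


section \<open>Multipliers\<close>

lemma multiplier_algebra_carrier:
  "(L, R) \<in> carrier (multiplier_algebra k A) \<longleftrightarrow>
     L \<in> extensional (carrier A) \<and> R \<in> extensional (carrier A) \<and>
     linear_map k A A L \<and> linear_map k A A R \<and>
     (\<forall>a\<in>carrier A. \<forall>b\<in>carrier A.
        L (a \<otimes>\<^bsub>A\<^esub> b) = L a \<otimes>\<^bsub>A\<^esub> b \<and>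
        R (a \<otimes>\<^bsub>A\<^esub> b) = a \<otimes>\<^bsub>A\<^esub> R b \<and>
        a \<otimes>\<^bsub>A\<^esub> L b = R a \<otimes>\<^bsub>A\<^esub> b)"
  by (simp add: multiplier_algebra_def)

lemma multiplierD:
  assumes "x \<in> carrier (multiplier_algebra k A)"
  shows "fst x \<in> extensional (carrier A)" "snd x \<in> extensional (carrier A)"
    "linear_map k A A (fst x)" "linear_map k A A (snd x)"
    "\<lbrakk>a \<in> carrier A; b \<in> carrier A\<rbrakk> \<Longrightarrow> fst x (a \<otimes>\<^bsub>A\<^esub> b) = fst x a \<otimes>\<^bsub>A\<^esub> b"
    "\<lbrakk>a \<in> carrier A; b \<in> carrier A\<rbrakk> \<Longrightarrow> snd x (a \<otimes>\<^bsub>A\<^esub> b) = a \<otimes>\<^bsub>A\<^esub> snd x b"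
    "\<lbrakk>a \<in> carrier A; b \<in> carrier A\<rbrakk> \<Longrightarrow> snd x a \<otimes>\<^bsub>A\<^esub> b = a \<otimes>\<^bsub>A\<^esub> fst x b"
    "a \<in> carrier A \<Longrightarrow> fst x a \<in> carrier A" "a \<in> carrier A \<Longrightarrow> snd x a \<in> carrier A"
proof -
  obtain L R where x: "x = (L, R)" by fastforce
  note D = assms[unfolded x multiplier_algebra_carrier]
  show "fst x \<in> extensional (carrier A)" "snd x \<in> extensional (carrier A)"
    and lin: "linear_map k A A (fst x)" "linear_map k A A (snd x)"
    using D unfolding x fst_conv snd_conv by blast+
  show "a \<in> carrier A \<Longrightarrow> fst x a \<in> carrier A" "a \<in> carrier A \<Longrightarrow> snd x a \<in> carrier A"
    using lin by (blast intro: linear_mapD(1))+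
  assume "a \<in> carrier A" "b \<in> carrier A"
  with D show "fst x (a \<otimes>\<^bsub>A\<^esub> b) = fst x a \<otimes>\<^bsub>A\<^esub> b" "snd x (a \<otimes>\<^bsub>A\<^esub> b) = a \<otimes>\<^bsub>A\<^esub> snd x b"
    "snd x a \<otimes>\<^bsub>A\<^esub> b = a \<otimes>\<^bsub>A\<^esub> fst x b"
    unfolding x fst_conv snd_conv by metis+
qed

lemma multiplier_ops:
  "x \<otimes>\<^bsub>multiplier_algebra k A\<^esub> y = (compose (carrier A) (fst x) (fst y), compose (carrier A) (snd y) (snd x))"
  "x \<oplus>\<^bsub>multiplier_algebra k A\<^esub> y =
     (\<lambda>a\<in>carrier A. fst x a \<oplus>\<^bsub>A\<^esub> fst y a, \<lambda>a\<in>carrier A. snd x a \<oplus>\<^bsub>A\<^esub> snd y a)"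
  "c \<odot>\<^bsub>multiplier_algebra k A\<^esub> x =
     (\<lambda>a\<in>carrier A. c \<odot>\<^bsub>A\<^esub> fst x a, \<lambda>a\<in>carrier A. c \<odot>\<^bsub>A\<^esub> snd x a)"
  "\<one>\<^bsub>multiplier_algebra k A\<^esub> = (\<lambda>a\<in>carrier A. a, \<lambda>a\<in>carrier A. a)"
  by (simp_all add: multiplier_algebra_def)

locale alg =
  fixes k :: "('k, 'z) ring_scheme" and A :: "('k, 'a) module"
  assumes algebra: "nonunital_algebra k A"
begin

sublocale module k A
  using algebra by (simp add: nonunital_algebra_def)

lemma mult_lin:
  assumes "x \<in> carrier A"
  shows "linear_map k A A (\<lambda>y. x \<otimes>\<^bsub>A\<^esub> y)" "linear_map k A A (\<lambda>y. y \<otimes>\<^bsub>A\<^esub> x)"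
  using algebra assms by (auto simp: nonunital_algebra_def bilinear_map_def)

lemmas mult_closed [simp] = nonunital_algebra_closed[OF algebra]
lemmas mult_add_right = linear_mapD(2)[OF mult_lin(1)]
lemmas mult_add_left = linear_mapD(2)[OF mult_lin(2)]
lemmas mult_smult_right = linear_mapD(3)[OF mult_lin(1)]
lemmas mult_smult_left = linear_mapD(3)[OF mult_lin(2)]
lemmas mult_zero_right = linear_map_zero[OF module_axioms module_axioms mult_lin(1)]
lemmas mult_zero_left = linear_map_zero[OF module_axioms module_axioms mult_lin(2)]

lemma mult_assoc:
  "\<lbrakk>x \<in> carrier A; y \<in> carrier A; z \<in> carrier A\<rbrakk> \<Longrightarrow> (x \<otimes>\<^bsub>A\<^esub> y) \<otimes>\<^bsub>A\<^esub> z = x \<otimes>\<^bsub>A\<^esub> (y \<otimes>\<^bsub>A\<^esub> z)"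
  using algebra by (simp add: nonunital_algebra_def)

lemma linear_map_scaled:
  assumes "c \<in> carrier k" "linear_map k M A h"
  shows "linear_map k M A (\<lambda>x. c \<odot>\<^bsub>A\<^esub> h x)"
  using assms unfolding linear_map_def
  by (auto simp: smult_r_distr Pi_iff smult_assoc1[symmetric] R.m_comm)

lemma linear_map_restrict: "linear_map k A N (restrict h (carrier A)) = linear_map k A N h"
  by (simp add: linear_map_def Pi_iff)

lemma multiplier_one_closed: "\<one>\<^bsub>multiplier_algebra k A\<^esub> \<in> carrier (multiplier_algebra k A)"
  unfolding multiplier_ops multiplier_algebra_carrier
  by (simp add: linear_map_restrict) (simp add: linear_map_def)

lemma multiplier_operations_closed: "operations_closed k (multiplier_algebra k A)"
  unfolding operations_closed_def
proof (intro conjI ballI)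
  fix x y assume x: "x \<in> carrier (multiplier_algebra k A)" and y: "y \<in> carrier (multiplier_algebra k A)"
  show "x \<oplus>\<^bsub>multiplier_algebra k A\<^esub> y \<in> carrier (multiplier_algebra k A)"
    unfolding multiplier_ops multiplier_algebra_carrier
    using multiplierD[OF x] multiplierD[OF y]
    by (simp add: linear_map_restrict linear_map_sum[OF module_axioms] mult_add_left mult_add_right)
  show "x \<otimes>\<^bsub>multiplier_algebra k A\<^esub> y \<in> carrier (multiplier_algebra k A)"
    unfolding multiplier_ops multiplier_algebra_carrier
    using multiplierD[OF x] multiplierD[OF y]
    by (simp add: compose_eq linear_map_compose[OF module_axioms])
next
  fix c x assume c: "c \<in> carrier k" and x: "x \<in> carrier (multiplier_algebra k A)"
  show "c \<odot>\<^bsub>multiplier_algebra k A\<^esub> x \<in> carrier (multiplier_algebra k A)"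
    unfolding multiplier_ops multiplier_algebra_carrier
    using c multiplierD[OF x]
    by (simp add: linear_map_restrict linear_map_scaled mult_smult_left mult_smult_right)
qed

lemma \<iota>_closed: "b \<in> carrier A \<Longrightarrow> \<iota> A b \<in> carrier (multiplier_algebra k A)"
  unfolding \<iota>_def multiplier_algebra_carrier
  by (simp add: linear_map_restrict mult_lin mult_assoc)

text \<open>The image of \<open>\<iota>\<close> is an ideal. Together with \<open>A = B A = A B\<close> this is what makes extensions of
  algebra maps from \<open>B\<close> to \<open>\<M>(B)\<close> unique.\<close>

lemma multiplier_mult_\<iota>:
  assumes x: "x \<in> carrier (multiplier_algebra k A)" and b: "b \<in> carrier A"
  shows "x \<otimes>\<^bsub>multiplier_algebra k A\<^esub> \<iota> A b = \<iota> A (fst x b)"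
    and "\<iota> A b \<otimes>\<^bsub>multiplier_algebra k A\<^esub> x = \<iota> A (snd x b)"
  using b multiplierD[OF x]
  by (auto simp: \<iota>_def multiplier_ops compose_def fun_eq_iff)

text \<open>At a fixed \<open>c\<close>, the conditions on a multiplier are literally the compatibility of the two
  actions of \<open>c\<close> with the multiplication. This lemma and \<open>algebra_map_of_multiplier_action\<close> are the
  two readings.\<close>

lemma multiplier_action_of_algebra_map:
  assumes f: "algebra_map k C (multiplier_algebra k A) f" and C: "operations_closed k C"
    and lr: "induced_actions C A f = (l, r)"
  shows "multiplier_action k C A l r"
proof -
  have l: "l b a = fst (f b) a" and r: "r a b = snd (f b) a"
    if "b \<in> carrier C" "a \<in> carrier A" for a b
    using lr that by (auto simp: induced_actions_def restrict2_def)
  have fc: "f b \<in> carrier (multiplier_algebra k A)" if "b \<in> carrier C" for b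
    using f that by (auto simp: algebra_map_def linear_map_def)
  note m = multiplierD[OF fc]
  have Cc: "\<And>x y. \<lbrakk>x \<in> carrier C; y \<in> carrier C\<rbrakk> \<Longrightarrow> x \<oplus>\<^bsub>C\<^esub> y \<in> carrier C"
    "\<And>x y. \<lbrakk>x \<in> carrier C; y \<in> carrier C\<rbrakk> \<Longrightarrow> x \<otimes>\<^bsub>C\<^esub> y \<in> carrier C"
    "\<And>t x. \<lbrakk>t \<in> carrier k; x \<in> carrier C\<rbrakk> \<Longrightarrow> t \<odot>\<^bsub>C\<^esub> x \<in> carrier C"
    using C by (auto simp: operations_closed_def)
  have f_ops: "\<And>x y. \<lbrakk>x \<in> carrier C; y \<in> carrier C\<rbrakk> \<Longrightarrow> f (x \<oplus>\<^bsub>C\<^esub> y) = f x \<oplus>\<^bsub>multiplier_algebra k A\<^esub> f y"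
    "\<And>x y. \<lbrakk>x \<in> carrier C; y \<in> carrier C\<rbrakk> \<Longrightarrow> f (x \<otimes>\<^bsub>C\<^esub> y) = f x \<otimes>\<^bsub>multiplier_algebra k A\<^esub> f y"
    "\<And>t x. \<lbrakk>t \<in> carrier k; x \<in> carrier C\<rbrakk> \<Longrightarrow> f (t \<odot>\<^bsub>C\<^esub> x) = t \<odot>\<^bsub>multiplier_algebra k A\<^esub> f x"
    using f by (auto simp: algebra_map_def linear_map_def)
  have lin: "linear_map k A A (l b)" "linear_map k A A (\<lambda>a. r a b)" if "b \<in> carrier C" for b
    using m(3,4,8,9)[OF that] that by (simp_all add: linear_map_def l r)
  have lin': "linear_map k C A (\<lambda>b. l b a)" "linear_map k C A (\<lambda>b. r a b)" if "a \<in> carrier A" for a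
    using that m(8,9) by (auto simp: linear_map_def l r Cc f_ops multiplier_ops)
  show ?thesis
    using m
    by (auto simp: multiplier_action_def left_module_def right_module_def bilinear_map_def
        algebra module_axioms lin lin' l r Cc f_ops multiplier_ops compose_eq)
qed

text \<open>The inverse of \<open>induced_actions\<close>.\<close>

definition multiplier_of_actions where
  "multiplier_of_actions C l r =
     (\<lambda>c\<in>carrier C. (\<lambda>a\<in>carrier A. l c a, \<lambda>a\<in>carrier A. r a c))"

lemma algebra_map_of_multiplier_action:
  assumes lr: "multiplier_action k C A l r" and C: "operations_closed k C"
  shows "algebra_map k C (multiplier_algebra k A) (multiplier_of_actions C l r)"
proof -
  interpret L: left_act k C A l using lr by unfold_locales (simp add: multiplier_action_def)
  interpret R: right_act k C A r using lr by unfold_locales (simp add: multiplier_action_def)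
  have "(\<lambda>a\<in>carrier A. l c a, \<lambda>a\<in>carrier A. r a c) \<in> carrier (multiplier_algebra k A)"
    if "c \<in> carrier C" for c
    using that lr unfolding multiplier_algebra_carrier
    by (simp add: linear_map_restrict L.lin_right R.lin_right multiplier_action_def)
  then show ?thesis
    using C unfolding algebra_map_def linear_map_def multiplier_of_actions_def
    by (auto simp: operations_closed_def multiplier_ops fun_eq_iff compose_def
        L.act_add_left R.act_add_left L.act_smult_left R.act_smult_left L.act_assoc R.act_assoc
        L.act_closed R.act_closed)
qed

theorem bij_betw_multiplier_maps_extension_structures:
  assumes B: "nonunital_algebra k B"
  shows "bij_betw (induced_actions B A) (multiplier_maps k B A) (extension_structures k B A)"
proof (rule bij_betw_byWitness[where f' = "\<lambda>(l, r). multiplier_of_actions B l r"])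
  note Bc = nonunital_algebra_operations_closed[OF B]
  show "\<forall>f\<in>multiplier_maps k B A. (\<lambda>(l, r). multiplier_of_actions B l r) (induced_actions B A f) = f"
  proof
    fix f assume "f \<in> multiplier_maps k B A"
    then have f: "f \<in> extensional (carrier B)" "algebra_map k B (multiplier_algebra k A) f"
      by (auto simp: multiplier_maps_def)
    have fc: "f b \<in> carrier (multiplier_algebra k A)" if "b \<in> carrier B" for b
      using f(2) that by (auto simp: algebra_map_def linear_map_def)
    have "fst (f b) a = undefined" "snd (f b) a = undefined"
      if "b \<in> carrier B" "a \<notin> carrier A" for a b
      using multiplierD(1,2)[OF fc[OF that(1)]] that(2) by (auto intro: extensional_arb)
    then show "(\<lambda>(l, r). multiplier_of_actions B l r) (induced_actions B A f) = f"
      using f(1)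
      by (auto simp: multiplier_of_actions_def induced_actions_def restrict2_def fun_eq_iff
          extensional_def prod_eq_iff restrict_def)
  qed
  show "\<forall>s\<in>extension_structures k B A. induced_actions B A ((\<lambda>(l, r). multiplier_of_actions B l r) s) = s"
    by (auto simp: extension_structures_def multiplier_of_actions_def induced_actions_def
        restrict2_def extensional2_def fun_eq_iff)
  show "induced_actions B A ` multiplier_maps k B A \<subseteq> extension_structures k B A"
  proof
    fix s assume "s \<in> induced_actions B A ` multiplier_maps k B A"
    then obtain f l r where f: "algebra_map k B (multiplier_algebra k A) f"
      and s: "s = (l, r)" "induced_actions B A f = (l, r)" "nip_bimodule k B A l r"
      by (auto simp: multiplier_maps_def)
    have "multiplier_action k B A l r"
      using multiplier_action_of_algebra_map[OF f Bc s(2)] .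
    moreover have "l \<in> extensional2 (carrier B) (carrier A)" "r \<in> extensional2 (carrier A) (carrier B)"
      using s(2) by (auto simp: induced_actions_def restrict2_def extensional2_def)
    ultimately show "s \<in> extension_structures k B A"
      using s(1,3)
      by (auto simp: extension_structures_def extension_def multiplier_action_def nip_bimodule_def)
  qed
  show "(\<lambda>(l, r). multiplier_of_actions B l r) ` extension_structures k B A \<subseteq> multiplier_maps k B A"
  proof
    fix f assume "f \<in> (\<lambda>(l, r). multiplier_of_actions B l r) ` extension_structures k B A"
    then obtain l r where f: "f = multiplier_of_actions B l r" and lr: "(l, r) \<in> extension_structures k B A"
      by auto
    have "induced_actions B A f = (l, r)"
      using lr unfolding f
      by (auto simp: extension_structures_def multiplier_of_actions_def induced_actions_def
        restrict2_def extensional2_def fun_eq_iff)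
    moreover have "algebra_map k B (multiplier_algebra k A) f"
      using lr unfolding f
      by (auto simp: extension_structures_def intro!: algebra_map_of_multiplier_action
          extension_multiplier_action Bc)
    ultimately show "f \<in> multiplier_maps k B A"
      using lr by (simp add: multiplier_maps_def f multiplier_of_actions_def extension_structures_def)
  qed
qed

text \<open>The multiplier algebra of \<open>B\<close> acts on \<open>B\<close> through the identity map of \<open>\<M>(B)\<close>, and \<open>A\<close> is an
  extension of \<open>B\<close> by means of \<open>f\<close>. The induced action of \<open>\<M>(B)\<close> on \<open>A\<close> is the required map.\<close>

theorem extends_to_multiplier_algebra:
  assumes B: "nonunital_algebra k B" and f: "f \<in> multiplier_maps k B A"
  shows "\<exists>!f'. f' \<in> extensional (carrier (multiplier_algebra k B)) \<and>
             unital_algebra_map k (multiplier_algebra k B) (multiplier_algebra k A) f' \<and>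
             (\<forall>b\<in>carrier B. f' (\<iota> B b) = f b)"
proof -
  interpret B: alg k B by unfold_locales (rule B)
  let ?MB = "multiplier_algebra k B" and ?MA = "multiplier_algebra k A"
  obtain l r where lr: "induced_actions B A f = (l, r)" by fastforce
  then have "(l, r) \<in> extension_structures k B A"
    using bij_betw_multiplier_maps_extension_structures[OF B] f by (metis bij_betw_apply)
  then have ext: "extension k B A l r" and nip: "nip_bimodule k B A l r"
    by (auto simp: extension_structures_def)
  have l: "l b a = fst (f b) a" and r: "r a b = snd (f b) a"
    if "b \<in> carrier B" "a \<in> carrier A" for a b
    using lr that by (auto simp: induced_actions_def restrict2_def)
  have fc: "f b \<in> carrier ?MA" if "b \<in> carrier B" for b
    using f that by (auto simp: multiplier_maps_def algebra_map_def linear_map_def)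
  obtain lm rm where lrm: "induced_actions ?MB B (\<lambda>x. x) = (lm, rm)" by fastforce
  then have lm: "lm x b = fst x b" and rm: "rm b x = snd x b"
    if "b \<in> carrier B" "x \<in> carrier ?MB" for x b
    using that by (auto simp: induced_actions_def restrict2_def)
  have "algebra_map k ?MB ?MB (\<lambda>x. x)" by (simp add: algebra_map_def linear_map_def)
  then have mult_act: "multiplier_action k ?MB B lm rm"
    by (rule B.multiplier_action_of_algebra_map[OF _ B.multiplier_operations_closed lrm])
  interpret E: extension_transfer k ?MB B lm rm A l r
    using nip by unfold_locales
      (simp_all add: B.multiplier_operations_closed mult_act ext nip_bimodule_def)
  define f' where "f' = multiplier_of_actions ?MB E.L.ind E.R.ind"
  have f'_app: "fst (f' x) a = E.L.ind x a" "snd (f' x) a = E.R.ind a x"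
    if "x \<in> carrier ?MB" "a \<in> carrier A" for x a
    using that by (simp_all add: f'_def multiplier_of_actions_def)
  have f'_map: "algebra_map k ?MB ?MA f'"
    unfolding f'_def
    by (rule algebra_map_of_multiplier_action[OF extension_multiplier_action[OF E.ind_extension]
          B.multiplier_operations_closed])
  have "E.L.ind \<one>\<^bsub>?MB\<^esub> a = a" "E.R.ind a \<one>\<^bsub>?MB\<^esub> = a" if "a \<in> carrier A" for a
    using that B.multiplier_one_closed
    by (auto intro!: E.L.ind_eqI E.R.ind_eqI simp: lm rm) (simp_all add: multiplier_ops)
  then have "f' \<one>\<^bsub>?MB\<^esub> = \<one>\<^bsub>?MA\<^esub>"
    using B.multiplier_one_closed
    by (simp add: f'_def multiplier_of_actions_def multiplier_ops(4)[of k A] cong: restrict_cong)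
  with f'_map have unital: "unital_algebra_map k ?MB ?MA f'"
    by (simp add: unital_algebra_map_def)
  have f'_ext: "f' \<in> extensional (carrier ?MB)" by (simp add: f'_def multiplier_of_actions_def)
  have f'_\<iota>: "f' (\<iota> B b) = f b" if b: "b \<in> carrier B" for b
  proof -
    have "E.L.ind (\<iota> B b) a = fst (f b) a" "E.R.ind a (\<iota> B b) = snd (f b) a" if "a \<in> carrier A" for a
      using b that ext B.\<iota>_closed[OF b] l[symmetric] r[symmetric]
      by (auto intro!: E.L.ind_eqI E.R.ind_eqI E.L.M.act_closed E.R.M.act_closed
          simp: lm rm E.L.M.act_assoc[symmetric] E.R.M.act_assoc[symmetric])
        (simp_all add: \<iota>_def)
    then show ?thesis
      using multiplierD(1,2)[OF fc[OF b]] B.\<iota>_closed[OF b]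
      by (auto simp: f'_def multiplier_of_actions_def prod_eq_iff fun_eq_iff extensional_def)
  qed
  show ?thesis
  proof (rule ex1I[of _ f'])
    fix g assume "g \<in> extensional (carrier ?MB) \<and> unital_algebra_map k ?MB ?MA g \<and>
      (\<forall>b\<in>carrier B. g (\<iota> B b) = f b)"
    then have g: "g \<in> extensional (carrier ?MB)" "algebra_map k ?MB ?MA g"
      and g\<iota>: "\<And>b. b \<in> carrier B \<Longrightarrow> g (\<iota> B b) = f b"
      by (auto simp: unital_algebra_map_def)
    have gc: "g x \<in> carrier ?MA" if "x \<in> carrier ?MB" for x
      using g(2) that by (auto simp: algebra_map_def linear_map_def)
    obtain lg rg where lrg: "induced_actions ?MB A g = (lg, rg)" by fastforce
    have lg: "lg x a = fst (g x) a" and rg: "rg a x = snd (g x) a"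
      if "a \<in> carrier A" "x \<in> carrier ?MB" for x a
      using lrg that by (auto simp: induced_actions_def restrict2_def)
    have g_act: "multiplier_action k ?MB A lg rg"
      by (rule multiplier_action_of_algebra_map[OF g(2) B.multiplier_operations_closed lrg])
    have g_mult: "g (x \<otimes>\<^bsub>?MB\<^esub> y) = g x \<otimes>\<^bsub>?MA\<^esub> g y" if "x \<in> carrier ?MB" "y \<in> carrier ?MB" for x y
      using g(2) that by (simp add: algebra_map_def)
    \<comment> \<open>\<open>g x\<close> is forced on \<open>f b \<rhd> a\<close> by \<open>g x \<cdot> f b = g (x \<cdot> \<iota> b) = f (x \<rhd> b)\<close>.\<close>
    have g_f: "fst (g x) (fst (f b) a) = fst (f (fst x b)) a"
      "snd (g x) (snd (f b) a) = snd (f (snd x b)) a"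
      if x: "x \<in> carrier ?MB" and b: "b \<in> carrier B" and a: "a \<in> carrier A" for x b a
    proof -
      note xb = multiplierD(8,9)[OF x b]
      have "g x \<otimes>\<^bsub>?MA\<^esub> f b = f (fst x b)" "f b \<otimes>\<^bsub>?MA\<^esub> g x = f (snd x b)"
        using g_mult[OF x B.\<iota>_closed[OF b]] g_mult[OF B.\<iota>_closed[OF b] x] g\<iota> b xb
        by (simp_all add: B.multiplier_mult_\<iota>[OF x b])
      then have "fst (g x \<otimes>\<^bsub>?MA\<^esub> f b) a = fst (f (fst x b)) a"
        "snd (f b \<otimes>\<^bsub>?MA\<^esub> g x) a = snd (f (snd x b)) a"
        by (simp_all only:)
      then show "fst (g x) (fst (f b) a) = fst (f (fst x b)) a"
        "snd (g x) (snd (f b) a) = snd (f (snd x b)) a"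
        using a by (simp_all add: multiplier_ops compose_eq)
    qed
    have "lg x (l b a) = l (lm x b) a" "rg (r a b) x = r a (rm b x)"
      if "x \<in> carrier ?MB" "b \<in> carrier B" "a \<in> carrier A" for x b a
      using that g_f[OF that] multiplierD(8,9)[OF fc[OF that(2)] that(3)] multiplierD(8,9)[OF that(1,2)]
      by (simp_all add: lg rg lm rm l r)
    then have "lg x a = E.L.ind x a" "rg a x = E.R.ind a x"
      if "x \<in> carrier ?MB" "a \<in> carrier A" for x a
      using that g_act E.L.ind_unique[of lg x a] E.R.ind_unique[of rg x a]
      by (simp_all add: multiplier_action_def)
    then have "fst (g x) a = fst (f' x) a" "snd (g x) a = snd (f' x) a"
      if "x \<in> carrier ?MB" "a \<in> carrier A" for x a
      using that f'_app lg rg by simp_all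
    moreover have "f' x \<in> carrier ?MA" if "x \<in> carrier ?MB" for x
      using f'_map that by (auto simp: algebra_map_def linear_map_def)
    ultimately have "g x = f' x" if "x \<in> carrier ?MB" for x
      using that multiplierD(1,2)[OF gc[OF that]] multiplierD(1,2)[of "f' x" k A]
      by (intro prod_eqI; blast intro: extensionalityI[of _ "carrier A"])
    then show "g = f'" using g(1) f'_ext by (auto intro: extensionalityI)
  qed (use f'_ext unital f'_\<iota> in simp)
qed

end

section \<open>Normalised records\<close>

text \<open>The object \<open>A\<close> of the category of \<open>A\<close>-extensions is carried by \<open>normalise k A\<close>, whereas extension
  structures are put on \<open>A\<close>. The following lemmas identify the two.\<close>

lemma normalise_structure:
  assumes "module k R"
  shows "nonunital_algebra k (normalise k R) = nonunital_algebra k R"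
    "left_module k B (normalise k R) l = left_module k B R l"
    "right_module k B (normalise k R) r = right_module k B R r"
    "projective k (normalise k R) = projective k R"
proof -
  note [simp] = linear_map_normalise[OF assms] linear_map_normalise' module_normalise[OF assms] assms
  show "left_module k B (normalise k R) l = left_module k B R l"
    "right_module k B (normalise k R) r = right_module k B R r"
    by (simp_all add: left_module_def right_module_def bilinear_map_def)
  show "projective k (normalise k R) = projective k R"
    by (simp add: projective_def)
  show "nonunital_algebra k (normalise k R) = nonunital_algebra k R"
  proof -
    have "linear_map k R R (\<lambda>y. x \<otimes>\<^bsub>normalise k R\<^esub> y) = linear_map k R R (\<lambda>y. x \<otimes>\<^bsub>R\<^esub> y)"
      "linear_map k R R (\<lambda>y. y \<otimes>\<^bsub>normalise k R\<^esub> x) = linear_map k R R (\<lambda>y. y \<otimes>\<^bsub>R\<^esub> x)"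
      if "x \<in> carrier R" for x
    proof -
      interpret module k R by fact
      show "linear_map k R R (\<lambda>y. x \<otimes>\<^bsub>normalise k R\<^esub> y) = linear_map k R R (\<lambda>y. x \<otimes>\<^bsub>R\<^esub> y)"
        "linear_map k R R (\<lambda>y. y \<otimes>\<^bsub>normalise k R\<^esub> x) = linear_map k R R (\<lambda>y. y \<otimes>\<^bsub>R\<^esub> x)"
        using that by (simp_all add: linear_map_def Pi_iff)
    qed
    then have "bilinear_map k (normalise k R) (normalise k R) (normalise k R) (\<lambda>x y. x \<otimes>\<^bsub>normalise k R\<^esub> y)
        = bilinear_map k R R R (\<lambda>x y. x \<otimes>\<^bsub>R\<^esub> y)"
      by (simp add: bilinear_map_def)
    moreover have "x \<otimes>\<^bsub>R\<^esub> y \<in> carrier R"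
      if "bilinear_map k R R R (\<lambda>x y. x \<otimes>\<^bsub>R\<^esub> y)" "x \<in> carrier R" "y \<in> carrier R" for x y
      using that by (auto simp: bilinear_map_def linear_map_def)
    ultimately show ?thesis
      by (auto simp: nonunital_algebra_def)
  qed
qed

lemma extension_structures_normalise:
  assumes "nonunital_algebra k R"
  shows "extension_structures k B (normalise k R) = extension_structures k B R"
proof -
  have R: "module k R" using assms by (simp add: nonunital_algebra_def)
  have "(l, r) \<in> extension_structures k B (normalise k R) \<longleftrightarrow> (l, r) \<in> extension_structures k B R" for l r
  proof (cases "left_module k B R l \<and> right_module k B R r")
    case True
    then have closed: "l b x \<in> carrier R" "r x b \<in> carrier R" if "x \<in> carrier R" "b \<in> carrier B" for x b
      using that True by (blast intro: left_module_closed right_module_closed)+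
    then have "finite_sums (normalise k R) {l b x | b x. b \<in> carrier B \<and> x \<in> carrier R} =
        finite_sums R {l b x | b x. b \<in> carrier B \<and> x \<in> carrier R}"
      "finite_sums (normalise k R) {r x b | x b. x \<in> carrier R \<and> b \<in> carrier B} =
        finite_sums R {r x b | x b. x \<in> carrier R \<and> b \<in> carrier B}"
      by (intro finite_sums_normalise[OF R]; blast)+
    then show ?thesis
      using True closed nonunital_algebra_closed[OF assms]
      by (simp add: extension_structures_def extension_def nip_bimodule_def bimodule_def
          normalise_structure[OF R] left_nondegenerate_def right_nondegenerate_def
          left_idempotent_def right_idempotent_def)
  next
    case False
    then show ?thesis
      by (auto simp: extension_structures_def extension_def bimodule_def normalise_structure[OF R])
  qed
  then show ?thesis by auto
qed


section \<open>Split extensions\<close>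

lemma linear_map_comp:
  assumes "linear_map k M N g" "linear_map k N P h"
  shows "linear_map k M P (\<lambda>x. h (g x))"
  using assms by (auto simp: linear_map_def Pi_iff)

text \<open>A direct sum of projective modules is projective: lift on each summand and add. The sum is
  given by its inclusions \<open>i\<close>, \<open>j\<close> and projections \<open>p\<close>, \<open>q\<close>, so that its elements may be coded
  in any way.\<close>

lemma projective_direct_sum:
  fixes k :: "('k, 'z) ring_scheme" and S :: "('k, 's) module"
  assumes P: "projective k P" and Q: "projective k Q" and S: "module k S"
    and i: "linear_map k P S i" and j: "linear_map k Q S j"
    and p: "linear_map k S P p" and q: "linear_map k S Q q"
    and sum: "\<And>s. s \<in> carrier S \<Longrightarrow> s = i (p s) \<oplus>\<^bsub>S\<^esub> j (q s)"
  shows "projective k S"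
  unfolding projective_def
proof (intro conjI allI impI S; elim conjE)
  fix M :: "('k, 's \<Rightarrow> 'k) module" and N :: "('k, 's) module" and g h
  assume M: "module k M" and N: "module k N" and g: "linear_map k M N g" "g ` carrier M = carrier N"
    and h: "linear_map k S N h"
  obtain u where u: "linear_map k P M u" "\<And>x. x \<in> carrier P \<Longrightarrow> g (u x) = h (i x)"
    using projective_lift[OF P M N g linear_map_comp[OF i h]] by blast
  obtain v where v: "linear_map k Q M v" "\<And>x. x \<in> carrier Q \<Longrightarrow> g (v x) = h (j x)"
    using projective_lift[OF Q M N g linear_map_comp[OF j h]] by blast
  let ?w = "\<lambda>s. u (p s) \<oplus>\<^bsub>M\<^esub> v (q s)"
  have "linear_map k S M ?w"
    by (intro linear_map_sum[OF M] linear_map_comp[OF p u(1)] linear_map_comp[OF q v(1)])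
  moreover have "g (?w s) = h s" if s: "s \<in> carrier S" for s
  proof -
    note [simp] = linear_mapD(1)[OF p s] linear_mapD(1)[OF q s]
    have "g (?w s) = h (i (p s)) \<oplus>\<^bsub>N\<^esub> h (j (q s))"
      using linear_mapD(1)[OF u(1)] linear_mapD(1)[OF v(1)]
      by (simp add: linear_mapD(2)[OF g(1)] u(2) v(2))
    also have "\<dots> = h (i (p s) \<oplus>\<^bsub>S\<^esub> j (q s))"
      using linear_mapD(1)[OF i] linear_mapD(1)[OF j] by (simp add: linear_mapD(2)[OF h])
    finally show ?thesis using sum[OF s] by simp
  qed
  ultimately show "\<exists>w. linear_map k S M w \<and> (\<forall>x\<in>carrier S. g (w x) = h x)" by blast
qed

text \<open>The image of an idempotent module consists of sums of elements \<open>a \<cdot> n\<close>. Applied to the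
  inclusions of both summands this shows that a direct sum of idempotent modules is idempotent.\<close>

lemma left_idempotent_image:
  assumes M: "left_module k A M l" and N: "left_module k A N l'" and idem: "left_idempotent A M l"
    and h: "linear_map k M N h"
    and hl: "\<And>a m. \<lbrakk>a \<in> carrier A; m \<in> carrier M\<rbrakk> \<Longrightarrow> h (l a m) = l' a (h m)"
    and x: "x \<in> carrier M"
  shows "h x \<in> finite_sums N {l' a n | a n. a \<in> carrier A \<and> n \<in> carrier N}"
proof -
  interpret M: left_act k A M l by unfold_locales (rule M)
  interpret N: left_act k A N l' by unfold_locales (rule N)
  show ?thesis
    using idem x
  proof (induction rule: M.idempotent_induct)
    case zero
    then show ?case
      using finite_sums_zero[OF N.module_axioms] linear_map_zero[OF M.module_axioms N.module_axioms h]
      by simp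
  next
    case (act a m)
    then have "h (l a m) \<in> {l' a n | a n. a \<in> carrier A \<and> n \<in> carrier N}"
      using hl linear_mapD(1)[OF h] by blast
    then show ?case by (rule finite_sums_incl[OF N.module_axioms N.act_image_subset])
  next
    case (add x y)
    then show ?case
      using finite_sums_add[OF N.module_axioms N.act_image_subset] linear_mapD(2)[OF h] by simp
  qed
qed

lemma right_idempotent_image:
  assumes "right_module k A M r" "right_module k A N r'" "right_idempotent A M r"
    and h: "linear_map k M N h"
    and "\<And>a m. \<lbrakk>a \<in> carrier A; m \<in> carrier M\<rbrakk> \<Longrightarrow> h (r m a) = r' (h m) a"
    and "x \<in> carrier M"
  shows "h x \<in> finite_sums N {r' n a | a n. a \<in> carrier A \<and> n \<in> carrier N}"
  using left_idempotent_image[of k "opp A" M "\<lambda>a m. r m a" N "\<lambda>a m. r' m a" h x] assms by simp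

text \<open>The algebra \<open>A \<oplus> R\<close> described at the beginning. An injection \<open>e\<close> codes pairs by elements of the type
  that carries all objects; this is where that type has to be infinite.\<close>

definition split_extension where
  "split_extension k A R l r e =
   \<lparr> carrier = e ` (carrier A \<times> carrier R),
     mult = restrict2 (\<lambda>s t. case inv_into UNIV e s of (a, x) \<Rightarrow> case inv_into UNIV e t of (b, y) \<Rightarrow>
         e (a \<otimes>\<^bsub>A\<^esub> b, l a y \<oplus>\<^bsub>R\<^esub> r x b \<oplus>\<^bsub>R\<^esub> x \<otimes>\<^bsub>R\<^esub> y))
       (e ` (carrier A \<times> carrier R)) (e ` (carrier A \<times> carrier R)),
     one = undefined,
     zero = e (\<zero>\<^bsub>A\<^esub>, \<zero>\<^bsub>R\<^esub>),
     add = restrict2 (\<lambda>s t. case inv_into UNIV e s of (a, x) \<Rightarrow> case inv_into UNIV e t of (b, y) \<Rightarrow>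
         e (a \<oplus>\<^bsub>A\<^esub> b, x \<oplus>\<^bsub>R\<^esub> y))
       (e ` (carrier A \<times> carrier R)) (e ` (carrier A \<times> carrier R)),
     smult = restrict2 (\<lambda>c s. case inv_into UNIV e s of (a, x) \<Rightarrow> e (c \<odot>\<^bsub>A\<^esub> a, c \<odot>\<^bsub>R\<^esub> x))
       (carrier k) (e ` (carrier A \<times> carrier R)) \<rparr>"

locale split_ext = A: alg k A
  for k :: "('k, 'z) ring_scheme" and A :: "('k, 'u) module" and R :: "('k, 'u) module"
    and l r and e :: "'u \<times> 'u \<Rightarrow> 'u" +
  assumes A_nondeg: "nondegenerate_algebra A" and A_idem: "idempotent_algebra A"
    and A_proj: "projective k A"
    and R: "(l, r) \<in> extension_structures k A R"
    and inj: "inj e"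
begin

sublocale R: alg k R
  by unfold_locales (use R in \<open>simp add: extension_structures_def extension_def\<close>)

sublocale L: left_act k A R l
  by unfold_locales (use R in \<open>simp add: extension_structures_def extension_def bimodule_def\<close>)

sublocale RA: right_act k A R r
  by unfold_locales (use R in \<open>simp add: extension_structures_def extension_def bimodule_def\<close>)

lemma R_simps:
  assumes "a \<in> carrier A" "x \<in> carrier R" "y \<in> carrier R"
  shows "l a (x \<otimes>\<^bsub>R\<^esub> y) = l a x \<otimes>\<^bsub>R\<^esub> y" "r (x \<otimes>\<^bsub>R\<^esub> y) a = x \<otimes>\<^bsub>R\<^esub> r y a"
    "r x a \<otimes>\<^bsub>R\<^esub> y = x \<otimes>\<^bsub>R\<^esub> l a y"
  using R assms by (auto simp: extension_structures_def extension_def)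

lemma commute:
  "\<lbrakk>a \<in> carrier A; b \<in> carrier A; x \<in> carrier R\<rbrakk> \<Longrightarrow> r (l a x) b = l a (r x b)"
  using R by (auto simp: extension_structures_def extension_def bimodule_def)

abbreviation S where "S \<equiv> split_extension k A R l r e"

definition lS where
  "lS = restrict2 (\<lambda>a s. case inv_into UNIV e s of (b, x) \<Rightarrow> e (a \<otimes>\<^bsub>A\<^esub> b, l a x)) (carrier A) (carrier S)"

definition rS where
  "rS = restrict2 (\<lambda>s a. case inv_into UNIV e s of (b, x) \<Rightarrow> e (b \<otimes>\<^bsub>A\<^esub> a, r x a)) (carrier S) (carrier A)"

lemma e_eq [simp]: "e p = e q \<longleftrightarrow> p = q"
  using inj by (auto dest: injD)

lemma carrier_S: "carrier S = e ` (carrier A \<times> carrier R)"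
  by (simp add: split_extension_def)

lemma carrier_S_iff [simp]: "e (a, x) \<in> carrier S \<longleftrightarrow> a \<in> carrier A \<and> x \<in> carrier R"
  by (auto simp: carrier_S)

lemma S_cases:
  assumes "s \<in> carrier S"
  obtains a x where "s = e (a, x)" "a \<in> carrier A" "x \<in> carrier R"
  using assms by (auto simp: carrier_S)

lemma S_simps [simp]:
  "zero S = e (\<zero>\<^bsub>A\<^esub>, \<zero>\<^bsub>R\<^esub>)"
  "\<lbrakk>a \<in> carrier A; b \<in> carrier A; x \<in> carrier R; y \<in> carrier R\<rbrakk>
    \<Longrightarrow> e (a, x) \<oplus>\<^bsub>S\<^esub> e (b, y) = e (a \<oplus>\<^bsub>A\<^esub> b, x \<oplus>\<^bsub>R\<^esub> y)"
  "\<lbrakk>a \<in> carrier A; b \<in> carrier A; x \<in> carrier R; y \<in> carrier R\<rbrakk>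
    \<Longrightarrow> e (a, x) \<otimes>\<^bsub>S\<^esub> e (b, y) = e (a \<otimes>\<^bsub>A\<^esub> b, l a y \<oplus>\<^bsub>R\<^esub> r x b \<oplus>\<^bsub>R\<^esub> x \<otimes>\<^bsub>R\<^esub> y)"
  "\<lbrakk>c \<in> carrier k; a \<in> carrier A; x \<in> carrier R\<rbrakk>
    \<Longrightarrow> c \<odot>\<^bsub>S\<^esub> e (a, x) = e (c \<odot>\<^bsub>A\<^esub> a, c \<odot>\<^bsub>R\<^esub> x)"
  "\<lbrakk>a \<in> carrier A; b \<in> carrier A; x \<in> carrier R\<rbrakk> \<Longrightarrow> lS a (e (b, x)) = e (a \<otimes>\<^bsub>A\<^esub> b, l a x)"
  "\<lbrakk>a \<in> carrier A; b \<in> carrier A; x \<in> carrier R\<rbrakk> \<Longrightarrow> rS (e (b, x)) a = e (b \<otimes>\<^bsub>A\<^esub> a, r x a)"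
  using inj by (simp_all add: lS_def rS_def restrict2_def)
    (simp_all add: split_extension_def restrict2_def inv_f_f)

lemmas act_simps = L.act_add_right L.act_add_left RA.act_add_right RA.act_add_left
  L.act_smult_right L.act_smult_left RA.act_smult_right RA.act_smult_left
  L.act_zero_right RA.act_zero_right L.act_zero_left[OF A.module_axioms] RA.act_zero_left[OF A.module_axioms]

lemmas mult_simps = A.mult_add_right A.mult_add_left A.mult_smult_right A.mult_smult_left
  A.mult_zero_left A.mult_zero_right R.mult_add_right R.mult_add_left R.mult_smult_right
  R.mult_smult_left R.mult_zero_left R.mult_zero_right

lemmas assoc_simps = A.mult_assoc R.mult_assoc L.act_assoc RA.act_assoc R_simps(1,2)
  R_simps(3) commute

lemma r_closed [simp, intro]: "\<lbrakk>x \<in> carrier R; a \<in> carrier A\<rbrakk> \<Longrightarrow> r x a \<in> carrier R"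
  by (rule RA.act_closed)

lemma module_S: "module k S"
proof -
  have "abelian_group S"
  proof (rule abelian_groupI)
    fix s assume "s \<in> carrier S"
    then obtain a x where s: "s = e (a, x)" "a \<in> carrier A" "x \<in> carrier R" by (rule S_cases)
    then show "\<exists>y\<in>carrier S. y \<oplus>\<^bsub>S\<^esub> s = \<zero>\<^bsub>S\<^esub>"
      by (intro bexI[of _ "e (\<ominus>\<^bsub>A\<^esub> a, \<ominus>\<^bsub>R\<^esub> x)"]) (simp_all add: A.M.l_neg R.M.l_neg)
  qed (auto elim!: S_cases simp: A.M.a_ac R.M.a_ac)
  then show ?thesis
    by (rule moduleI[OF A.R.is_cring])
      (auto elim!: S_cases simp: A.smult_l_distr R.smult_l_distr A.smult_r_distr R.smult_r_distr
        A.smult_assoc1 R.smult_assoc1)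
qed

lemma linear_map_from_S:
  assumes "\<And>a x. \<lbrakk>a \<in> carrier A; x \<in> carrier R\<rbrakk> \<Longrightarrow> h (e (a, x)) \<in> carrier N"
    and "\<And>a x b y. \<lbrakk>a \<in> carrier A; x \<in> carrier R; b \<in> carrier A; y \<in> carrier R\<rbrakk>
      \<Longrightarrow> h (e (a \<oplus>\<^bsub>A\<^esub> b, x \<oplus>\<^bsub>R\<^esub> y)) = h (e (a, x)) \<oplus>\<^bsub>N\<^esub> h (e (b, y))"
    and "\<And>c a x. \<lbrakk>c \<in> carrier k; a \<in> carrier A; x \<in> carrier R\<rbrakk>
      \<Longrightarrow> h (e (c \<odot>\<^bsub>A\<^esub> a, c \<odot>\<^bsub>R\<^esub> x)) = c \<odot>\<^bsub>N\<^esub> h (e (a, x))"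
  shows "linear_map k S N h"
  unfolding linear_map_def using assms by (auto elim!: S_cases)

lemma algebra_S: "nonunital_algebra k S"
proof -
  have "linear_map k S S (\<lambda>t. s \<otimes>\<^bsub>S\<^esub> t)" "linear_map k S S (\<lambda>t. t \<otimes>\<^bsub>S\<^esub> s)" if "s \<in> carrier S" for s
    using that by (auto elim!: S_cases intro!: linear_map_from_S
        simp: act_simps mult_simps R.M.a_ac A.smult_r_distr R.smult_r_distr)
  moreover have "(s \<otimes>\<^bsub>S\<^esub> t) \<otimes>\<^bsub>S\<^esub> u = s \<otimes>\<^bsub>S\<^esub> (t \<otimes>\<^bsub>S\<^esub> u)"
    if "s \<in> carrier S" "t \<in> carrier S" "u \<in> carrier S" for s t u
    using that
    by (auto elim!: S_cases simp: act_simps mult_simps assoc_simps R.M.a_ac)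
  ultimately show ?thesis
    by (simp add: nonunital_algebra_def bilinear_map_def module_S)
qed

lemma left_module_S: "left_module k A S lS"
proof -
  have "linear_map k S S (lS a)" if "a \<in> carrier A" for a
    using that by (auto intro!: linear_map_from_S simp: act_simps mult_simps)
  moreover have "linear_map k A S (\<lambda>a. lS a s)" if "s \<in> carrier S" for s
    using that by (auto elim!: S_cases simp: linear_map_def act_simps mult_simps)
  moreover have "lS (a \<otimes>\<^bsub>A\<^esub> b) s = lS a (lS b s)"
    if "a \<in> carrier A" "b \<in> carrier A" "s \<in> carrier S" for a b s
    using that by (auto elim!: S_cases simp: assoc_simps)
  ultimately show ?thesis by (simp add: left_module_def bilinear_map_def module_S)
qed

lemma right_module_S: "right_module k A S rS"
proof -
  have "linear_map k S S (\<lambda>s. rS s a)" if "a \<in> carrier A" for a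
    using that by (auto intro!: linear_map_from_S simp: act_simps mult_simps)
  moreover have "linear_map k A S (rS s)" if "s \<in> carrier S" for s
    using that by (auto elim!: S_cases simp: linear_map_def act_simps mult_simps)
  moreover have "rS s (a \<otimes>\<^bsub>A\<^esub> b) = rS (rS s a) b"
    if "a \<in> carrier A" "b \<in> carrier A" "s \<in> carrier S" for a b s
    using that by (auto elim!: S_cases simp: assoc_simps)
  ultimately show ?thesis by (simp add: right_module_def bilinear_map_def module_S)
qed

lemma bimodule_S: "bimodule k A S lS rS"
  by (auto elim!: S_cases simp: bimodule_def left_module_S right_module_S assoc_simps)

lemma extension_S: "extension k A S lS rS"
  by (auto elim!: S_cases simp: extension_def algebra_S bimodule_S assoc_simps act_simps mult_simps R.M.a_ac)

lemma linear_inclusions: "linear_map k A S (\<lambda>a. e (a, \<zero>\<^bsub>R\<^esub>))" "linear_map k R S (\<lambda>x. e (\<zero>\<^bsub>A\<^esub>, x))"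
  by (auto simp: linear_map_def)

lemma projective_S: "projective k S"
proof (rule projective_direct_sum[OF A_proj _ module_S linear_inclusions])
  show "projective k R" using R by (simp add: extension_structures_def nip_bimodule_def)
  show "linear_map k S A (\<lambda>s. fst (inv_into UNIV e s))" "linear_map k S R (\<lambda>s. snd (inv_into UNIV e s))"
    using inj by (auto intro!: linear_map_from_S simp: inv_f_f)
qed (use inj in \<open>auto elim!: S_cases simp: inv_f_f\<close>)

lemma A_modules:
  "left_module k A A (\<lambda>a b. a \<otimes>\<^bsub>A\<^esub> b)" "left_idempotent A A (\<lambda>a b. a \<otimes>\<^bsub>A\<^esub> b)"
  "right_module k A A (\<lambda>a b. a \<otimes>\<^bsub>A\<^esub> b)" "right_idempotent A A (\<lambda>a b. a \<otimes>\<^bsub>A\<^esub> b)"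
  using A_idem A.algebra
  by (auto simp: left_module_def right_module_def left_idempotent_def right_idempotent_def
      idempotent_algebra_def nonunital_algebra_def)

lemma S_sum:
  "\<lbrakk>a \<in> carrier A; x \<in> carrier R\<rbrakk> \<Longrightarrow> e (a, x) = e (a, \<zero>\<^bsub>R\<^esub>) \<oplus>\<^bsub>S\<^esub> e (\<zero>\<^bsub>A\<^esub>, x)"
  by simp

lemma left_idempotent_S: "left_idempotent A S lS"
proof -
  interpret I: left_act k A S lS by unfold_locales (rule left_module_S)
  have R': "left_idempotent A R l" using R by (simp add: extension_structures_def nip_bimodule_def)
  show ?thesis
  proof (rule I.idempotentI)
    fix s assume "s \<in> carrier S"
    then obtain a x where s: "s = e (a, x)" "a \<in> carrier A" "x \<in> carrier R" by (rule S_cases)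
    show "s \<in> finite_sums S {lS a n | a n. a \<in> carrier A \<and> n \<in> carrier S}"
      unfolding s(1) S_sum[OF s(2,3)] using s(2,3)
      by (intro finite_sums_add[OF module_S I.act_image_subset]
          left_idempotent_image[OF A_modules(1) left_module_S A_modules(2) linear_inclusions(1)]
          left_idempotent_image[OF L.left_module left_module_S R' linear_inclusions(2)])
        (auto simp: act_simps mult_simps)
  qed
qed

lemma right_idempotent_S: "right_idempotent A S rS"
proof -
  interpret I: right_act k A S rS by unfold_locales (rule right_module_S)
  have R': "right_idempotent A R r" using R by (simp add: extension_structures_def nip_bimodule_def)
  show ?thesis
  proof (rule I.idempotentI)
    fix s assume "s \<in> carrier S"
    then obtain a x where s: "s = e (a, x)" "a \<in> carrier A" "x \<in> carrier R" by (rule S_cases)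
    show "s \<in> finite_sums S {rS n a | a n. a \<in> carrier A \<and> n \<in> carrier S}"
      unfolding s(1) S_sum[OF s(2,3)] using s(2,3)
      by (intro finite_sums_add[OF module_S I.act_image_subset]
          right_idempotent_image[OF A_modules(3) right_module_S A_modules(4) linear_inclusions(1)]
          right_idempotent_image[OF RA.right_module right_module_S R' linear_inclusions(2)])
        (auto simp: act_simps mult_simps)
  qed
qed

lemma nondegenerate_S: "left_nondegenerate A S lS" "right_nondegenerate A S rS"
proof -
  have R': "left_nondegenerate A R l" "right_nondegenerate A R r"
    using R by (auto simp: extension_structures_def nip_bimodule_def)
  show "left_nondegenerate A S lS"
    unfolding left_nondegenerate_def
  proof (intro ballI impI)
    fix s assume "s \<in> carrier S" and 0: "\<forall>b\<in>carrier A. lS b s = \<zero>\<^bsub>S\<^esub>"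
    then obtain a x where s: "s = e (a, x)" "a \<in> carrier A" "x \<in> carrier R" by (blast elim: S_cases)
    have n: "b \<otimes>\<^bsub>A\<^esub> a = \<zero>\<^bsub>A\<^esub>" "l b x = \<zero>\<^bsub>R\<^esub>" if "b \<in> carrier A" for b
      using bspec[OF 0 that] that s by simp_all
    have "a = \<zero>\<^bsub>A\<^esub>"
      using A_nondeg s(2) n(1) unfolding nondegenerate_algebra_def by metis
    moreover have "x = \<zero>\<^bsub>R\<^esub>"
      using R'(1) s(3) n(2) unfolding left_nondegenerate_def by metis
    ultimately show "s = \<zero>\<^bsub>S\<^esub>" using s(1) by simp
  qed
  show "right_nondegenerate A S rS"
    unfolding right_nondegenerate_def
  proof (intro ballI impI)
    fix s assume "s \<in> carrier S" and 0: "\<forall>b\<in>carrier A. rS s b = \<zero>\<^bsub>S\<^esub>"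
    then obtain a x where s: "s = e (a, x)" "a \<in> carrier A" "x \<in> carrier R" by (blast elim: S_cases)
    have n: "a \<otimes>\<^bsub>A\<^esub> b = \<zero>\<^bsub>A\<^esub>" "r x b = \<zero>\<^bsub>R\<^esub>" if "b \<in> carrier A" for b
      using bspec[OF 0 that] that s by simp_all
    have "a = \<zero>\<^bsub>A\<^esub>"
      using A_nondeg s(2) n(1) unfolding nondegenerate_algebra_def by metis
    moreover have "x = \<zero>\<^bsub>R\<^esub>"
      using R'(2) s(3) n(2) unfolding right_nondegenerate_def by metis
    ultimately show "s = \<zero>\<^bsub>S\<^esub>" using s(1) by simp
  qed
qed

lemma structure_S: "(lS, rS) \<in> extension_structures k A S"
  by (auto simp: extension_structures_def nip_bimodule_def extension_S bimodule_S projective_S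
      left_idempotent_S right_idempotent_S nondegenerate_S)
    (auto simp: lS_def rS_def restrict2_def extensional2_def)

lemma S_obj: "(S, lS, rS) \<in> Obj (ExtCat k A)"
  using structure_S
  by (auto simp: ExtCat_def concrete_cat_def normal_algebra_def)
    (auto simp: split_extension_def restrict2_def extensional2_def)

lemma A_to_S: "(regular_ext k A, \<lambda>a\<in>carrier A. e (a, \<zero>\<^bsub>R\<^esub>), (S, lS, rS)) \<in> Arr (ExtCat k A)"
proof -
  have "linear_map k (normalise k A) S (\<lambda>a\<in>carrier A. e (a, \<zero>\<^bsub>R\<^esub>))"
    by (simp add: linear_map_normalise[OF A.module_axioms] A.linear_map_restrict linear_inclusions)
  then show ?thesis
    using S_obj regular_ext_in_ExtCat[OF A.algebra A_nondeg A_idem A_proj]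
    by (auto simp: ExtCat_def concrete_cat_def regular_ext_def algebra_map_def act_simps mult_simps)
qed

lemma R_to_S:
  assumes "normal_algebra k R"
  shows "((R, l, r), \<lambda>x\<in>carrier R. e (\<zero>\<^bsub>A\<^esub>, x), (S, lS, rS)) \<in> Arr (ExtCat k A)"
  using S_obj R assms
  by (auto simp: ExtCat_def concrete_cat_def algebra_map_def act_simps mult_simps
      R.linear_map_restrict linear_inclusions)

end


section \<open>Functors between categories of extensions\<close>

lemma ExtCat_Obj_iff:
  "(R, l, r) \<in> Obj (ExtCat k B) \<longleftrightarrow> normal_algebra k R \<and> (l, r) \<in> extension_structures k B R"
  by (simp add: ExtCat_def concrete_cat_def)

lemma RModCat_Obj_iff:
  "(M, r) \<in> Obj (RModCat k A) \<longleftrightarrow> normal_module k M \<and> r \<in> extensional2 (carrier M) (carrier A) \<and>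
     right_module k A M r \<and> right_nondegenerate A M r \<and> right_idempotent A M r \<and> projective k M"
  by (simp add: RModCat_def concrete_cat_def)

lemma LModCat_Obj_iff:
  "(M, l) \<in> Obj (LModCat k A) \<longleftrightarrow> normal_module k M \<and> l \<in> extensional2 (carrier A) (carrier M) \<and>
     left_module k A M l \<and> left_nondegenerate A M l \<and> left_idempotent A M l \<and> projective k M"
  by (simp add: LModCat_def concrete_cat_def)

lemma ExtCat_ArrD:
  assumes "((R, l, r), h, (S, l', r')) \<in> Arr (ExtCat k B)" "x \<in> carrier R" "b \<in> carrier B"
  shows "h (l b x) = l' b (h x)" "h (r x b) = r' (h x) b"
  using assms by (auto simp: ExtCat_def concrete_cat_def)

lemma RModCat_ArrD:
  assumes "((M, r), h, (N, r')) \<in> Arr (RModCat k A)" "x \<in> carrier M" "a \<in> carrier A"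
  shows "h (r x a) = r' (h x) a"
  using assms by (auto simp: RModCat_def concrete_cat_def)

lemma LModCat_ArrD:
  assumes "((M, l), h, (N, l')) \<in> Arr (LModCat k A)" "x \<in> carrier M" "a \<in> carrier A"
  shows "h (l a x) = l' a (h x)"
  using assms by (auto simp: LModCat_def concrete_cat_def)

lemma is_functor_mem:
  assumes "is_functor C D F"
  shows "X \<in> Obj C \<Longrightarrow> on_obj F X \<in> Obj D" "a \<in> Arr C \<Longrightarrow> on_arr F a \<in> Arr D"
  using assms by (auto simp: is_functor_def)

lemma extensional2_eqI:
  assumes "f \<in> extensional2 S T" "g \<in> extensional2 S T" "\<And>x y. \<lbrakk>x \<in> S; y \<in> T\<rbrakk> \<Longrightarrow> f x y = g x y"
  shows "f = g"
proof (intro ext)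
  show "f x y = g x y" for x y
    using assms by (cases "x \<in> S \<and> y \<in> T") (auto simp: extensional2_def)
qed

text \<open>A functor between concrete categories that commutes with forgetful functors cannot change the
  function underlying an arrow.\<close>

lemma functor_over_forgetful:
  assumes C: "C = concrete_cat Ob U mor" and D: "D = concrete_cat Ob' U' mor'"
    and F: "is_functor C D F"
    and over: "then_functor C F (forgetful D \<Psi>) = forgetful C \<Phi>"
  shows "X \<in> Obj C \<Longrightarrow> on_obj F X \<in> Obj D \<and> \<Psi> (on_obj F X) = \<Phi> X"
    and "F = forgetful C (on_obj F)"
proof -
  have obj: "on_obj F X \<in> Obj D" if "X \<in> Obj C" for X
    by (rule is_functor_mem(1)[OF F that])
  have arr: "on_arr F a \<in> Arr D" if "a \<in> Arr C" for a
    by (rule is_functor_mem(2)[OF F that])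
  show "on_obj F X \<in> Obj D \<and> \<Psi> (on_obj F X) = \<Phi> X" if "X \<in> Obj C"
    using that obj[OF that] arg_cong[OF over, of "\<lambda>G. on_obj G X"]
    by (simp add: then_functor_def forgetful_def)
  have "on_arr F (X, h, Y) = (on_obj F X, h, on_obj F Y)" if a: "(X, h, Y) \<in> Arr C" for X h Y
  proof -
    obtain X' h' Y' where F': "on_arr F (X, h, Y) = (X', h', Y')" by (cases "on_arr F (X, h, Y)")
    have "Dom D (on_arr F (X, h, Y)) = on_obj F (Dom C (X, h, Y))"
      "Cod D (on_arr F (X, h, Y)) = on_obj F (Cod C (X, h, Y))"
      using F a by (auto simp: is_functor_def)
    then have "X' = on_obj F X" "Y' = on_obj F Y"
      unfolding F' by (simp_all add: C D concrete_cat_def)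
    moreover have "h' = h"
      using a arr[OF a] arg_cong[OF over, of "\<lambda>G. on_arr G (X, h, Y)"] F'
      by (simp add: then_functor_def forgetful_def)
    ultimately show ?thesis using F' by simp
  qed
  moreover have "on_obj F \<in> extensional (Obj C)" "on_arr F \<in> extensional (Arr C)"
    using F by (auto simp: is_functor_def PiE_def)
  ultimately show "F = forgetful C (on_obj F)"
    by (cases F) (auto simp: forgetful_def extensional_restrict fun_eq_iff extensional_def restrict_def)
qed

text \<open>By the preceding lemma the functors of interest are all of the form \<open>forgetful C \<Phi>\<close>. The
  next three lemmas reduce equality, composition and functoriality of such functors to their
  object maps.\<close>

lemma forgetful_cong:
  assumes "C = concrete_cat Ob U mor" "\<And>X. X \<in> Obj C \<Longrightarrow> \<Phi> X = \<Psi> X"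
  shows "forgetful C \<Phi> = forgetful C \<Psi>"
proof -
  have "X \<in> Obj C \<and> Y \<in> Obj C" if "(X, h, Y) \<in> Arr C" for X h Y
    using that by (auto simp: assms(1) concrete_cat_def)
  then show ?thesis
    using assms(2) by (auto simp: forgetful_def fun_eq_iff restrict_def)
qed

lemma then_forgetful:
  assumes C: "C = concrete_cat Ob U mor" and F: "is_functor C D (forgetful C \<Phi>)"
  shows "then_functor C (forgetful C \<Phi>) (forgetful D \<Psi>) = forgetful C (\<lambda>X. \<Psi> (\<Phi> X))"
proof -
  have "\<Phi> X \<in> Obj D" if "X \<in> Obj C" for X
  proof -
    have "on_obj (forgetful C \<Phi>) X \<in> Obj D" by (rule is_functor_mem(1)[OF F that])
    then show ?thesis using that by (simp add: forgetful_def)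
  qed
  moreover have "(\<Phi> X, h, \<Phi> Y) \<in> Arr D" if "(X, h, Y) \<in> Arr C" for X h Y
  proof -
    have "on_arr (forgetful C \<Phi>) (X, h, Y) \<in> Arr D" by (rule is_functor_mem(2)[OF F that])
    then show ?thesis using that by (simp add: forgetful_def)
  qed
  ultimately show ?thesis
    by (auto simp: then_functor_def forgetful_def fun_eq_iff restrict_def)
qed

lemma forgetful_functorI:
  assumes C: "C = concrete_cat Ob U mor" "is_category C" and D: "D = concrete_cat Ob' U' mor'"
    and obj: "\<And>X. X \<in> Obj C \<Longrightarrow> \<Phi> X \<in> Obj D \<and> U' (\<Phi> X) = U X"
    and arr: "\<And>X h Y. (X, h, Y) \<in> Arr C \<Longrightarrow> mor' (\<Phi> X) (\<Phi> Y) h"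
  shows "is_functor C D (forgetful C \<Phi>)"
  unfolding C(1) D
  by (rule forgetful_is_functor)
    (use obj arr C(2) in \<open>auto simp: C(1) D concrete_cat_def\<close>)

locale base_algebras = A: alg k A
  for k :: "'k ring" and A :: "('k, 'u) module" and B :: "('k, 'b) module" +
  assumes infinite: "infinite (UNIV :: 'u set)"
    and A_nondeg: "nondegenerate_algebra A" and A_idem: "idempotent_algebra A"
    and A_proj: "projective k A"
    and B: "nonunital_algebra k B"
begin

lemma regular_obj: "regular_ext k A \<in> Obj (ExtCat k A)"
  by (rule regular_ext_in_ExtCat[OF A.algebra A_nondeg A_idem A_proj])

definition ext_functor_of where
  "ext_functor_of = (\<lambda>(lA, rA). forgetful (ExtCat k A)
     (\<lambda>(R, l, r). (R, induced_left B A R l rA, induced_right B A R r lA)))"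

definition rmod_functor_of where
  "rmod_functor_of lA = forgetful (RModCat k A) (\<lambda>(M, r). (M, induced_right B A M r lA))"

definition lmod_functor_of where
  "lmod_functor_of rA = forgetful (LModCat k A) (\<lambda>(M, l). (M, induced_left B A M l rA))"

lemma ext_transfer:
  assumes "(lA, rA) \<in> extension_structures k B A" "(l, r) \<in> extension_structures k A R"
  shows "extension_transfer k B A lA rA R l r"
  using assms
  by unfold_locales
    (auto simp: extension_structures_def nip_bimodule_def extension_multiplier_action
      nonunital_algebra_operations_closed[OF B])

lemma lmod_transfer:
  assumes "(lA, rA) \<in> extension_structures k B A" "(M, l) \<in> Obj (LModCat k A)"
  shows "left_transfer k B A lA rA M l"
  using assms
  by unfold_locales
    (auto simp: extension_structures_def LModCat_Obj_iff extension_multiplier_action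
      nonunital_algebra_operations_closed[OF B])

lemma rmod_transfer:
  assumes "(lA, rA) \<in> extension_structures k B A" "(M, r) \<in> Obj (RModCat k A)"
  shows "right_transfer k B A lA rA M r"
  using assms
  by unfold_locales
    (auto simp: extension_structures_def RModCat_Obj_iff extension_multiplier_action
      nonunital_algebra_operations_closed[OF B])

lemma structure_idempotent:
  assumes "(lA, rA) \<in> extension_structures k B A"
  shows "left_idempotent B A lA" "right_idempotent B A rA"
  using assms by (auto simp: extension_structures_def nip_bimodule_def)

lemma ext_functor_of_functor:
  assumes s: "(lA, rA) \<in> extension_structures k B A"
  shows "is_functor (ExtCat k A) (ExtCat k B) (ext_functor_of (lA, rA))"
proof -
  let ?l = "\<lambda>R l. induced_left B A R l rA" and ?r = "\<lambda>R r. induced_right B A R r lA"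
  have obj: "(R, ?l R l, ?r R r) \<in> Obj (ExtCat k B)" if X: "(R, l, r) \<in> Obj (ExtCat k A)" for R l r
  proof -
    from X have lr: "(l, r) \<in> extension_structures k A R" by (simp add: ExtCat_Obj_iff)
    interpret E: extension_transfer k B A lA rA R l r by (rule ext_transfer[OF s lr])
    have "projective k R" using lr by (simp add: extension_structures_def nip_bimodule_def)
    then show ?thesis
      using E.ind_extension_structure[OF structure_idempotent[OF s]] X by (simp add: ExtCat_Obj_iff)
  qed
  have arr: "algebra_map k R S h"
    "\<And>x b. \<lbrakk>x \<in> carrier R; b \<in> carrier B\<rbrakk> \<Longrightarrow> h (?l R l b x) = ?l S l' b (h x)"
    "\<And>x b. \<lbrakk>x \<in> carrier R; b \<in> carrier B\<rbrakk> \<Longrightarrow> h (?r R r x b) = ?r S r' (h x) b"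
    if "((R, l, r), h, (S, l', r')) \<in> Arr (ExtCat k A)" for R l r S l' r' h
  proof -
    have "(l, r) \<in> extension_structures k A R" "(l', r') \<in> extension_structures k A S"
      and h: "algebra_map k R S h"
        "\<And>x a. \<lbrakk>a \<in> carrier A; x \<in> carrier R\<rbrakk> \<Longrightarrow> h (l a x) = l' a (h x)"
        "\<And>x a. \<lbrakk>a \<in> carrier A; x \<in> carrier R\<rbrakk> \<Longrightarrow> h (r x a) = r' (h x) a"
      using that by (auto simp: ExtCat_def concrete_cat_def)
    then have E: "extension_transfer k B A lA rA R l r" "extension_transfer k B A lA rA S l' r'"
      by (auto intro: ext_transfer[OF s])
    interpret E: extension_transfer k B A lA rA R l r by (rule E(1))
    interpret E': extension_transfer k B A lA rA S l' r' by (rule E(2))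
    have lin: "linear_map k R S h" using h(1) by (simp add: algebra_map_def)
    show "algebra_map k R S h" by (rule h(1))
    fix x b assume xb: "x \<in> carrier R" "b \<in> carrier B"
    show "h (?l R l b x) = ?l S l' b (h x)"
      by (rule induced_left_natural[OF E.L.left_transfer_axioms E'.L.left_transfer_axioms lin])
        (simp_all add: h(2) xb)
    show "h (?r R r x b) = ?r S r' (h x) b"
      by (rule induced_right_natural[OF E.R.right_transfer_axioms E'.R.right_transfer_axioms lin])
        (simp_all add: h(3) xb)
  qed
  show ?thesis
    unfolding ext_functor_of_def prod.case
    by (rule forgetful_functorI[OF ExtCat_def ExtCat_is_category ExtCat_def])
      (auto simp: obj arr)
qed

lemma lmod_functor_of_functor:
  assumes s: "(lA, rA) \<in> extension_structures k B A"
  shows "is_functor (LModCat k A) (LModCat k B) (lmod_functor_of rA)"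
proof -
  let ?l = "\<lambda>M l. induced_left B A M l rA"
  have obj: "(M, ?l M l) \<in> Obj (LModCat k B)" if X: "(M, l) \<in> Obj (LModCat k A)" for M l
  proof -
    interpret L: left_transfer k B A lA rA M l by (rule lmod_transfer[OF s X])
    show ?thesis
      using X L.ind_module L.ind_nondegenerate L.ind_idempotent structure_idempotent[OF s]
        induced_left_extensional by (simp add: LModCat_Obj_iff)
  qed
  have arr: "linear_map k M N h"
    "\<And>x b. \<lbrakk>x \<in> carrier M; b \<in> carrier B\<rbrakk> \<Longrightarrow> h (?l M l b x) = ?l N l' b (h x)"
    if "((M, l), h, (N, l')) \<in> Arr (LModCat k A)" for M l N l' h
  proof -
    have MN: "(M, l) \<in> Obj (LModCat k A)" "(N, l') \<in> Obj (LModCat k A)"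
      and h: "linear_map k M N h"
        "\<And>x a. \<lbrakk>a \<in> carrier A; x \<in> carrier M\<rbrakk> \<Longrightarrow> h (l a x) = l' a (h x)"
      using that by (auto simp: LModCat_def concrete_cat_def)
    show "linear_map k M N h" by (rule h(1))
    fix x b assume xb: "x \<in> carrier M" "b \<in> carrier B"
    show "h (?l M l b x) = ?l N l' b (h x)"
      by (rule induced_left_natural[OF lmod_transfer[OF s MN(1)] lmod_transfer[OF s MN(2)] h(1)])
        (simp_all add: h(2) xb)
  qed
  show ?thesis
    unfolding lmod_functor_of_def
    by (rule forgetful_functorI[OF LModCat_def LModCat_is_category LModCat_def])
      (auto simp: obj arr)
qed

lemma rmod_functor_of_functor:
  assumes s: "(lA, rA) \<in> extension_structures k B A"
  shows "is_functor (RModCat k A) (RModCat k B) (rmod_functor_of lA)"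
proof -
  let ?r = "\<lambda>M r. induced_right B A M r lA"
  have obj: "(M, ?r M r) \<in> Obj (RModCat k B)" if X: "(M, r) \<in> Obj (RModCat k A)" for M r
  proof -
    interpret R: right_transfer k B A lA rA M r by (rule rmod_transfer[OF s X])
    show ?thesis
      using X R.ind_module R.ind_nondegenerate R.ind_idempotent structure_idempotent[OF s]
        induced_right_extensional by (simp add: RModCat_Obj_iff)
  qed
  have arr: "linear_map k M N h"
    "\<And>x b. \<lbrakk>x \<in> carrier M; b \<in> carrier B\<rbrakk> \<Longrightarrow> h (?r M r x b) = ?r N r' (h x) b"
    if "((M, r), h, (N, r')) \<in> Arr (RModCat k A)" for M r N r' h
  proof -
    have MN: "(M, r) \<in> Obj (RModCat k A)" "(N, r') \<in> Obj (RModCat k A)"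
      and h: "linear_map k M N h"
        "\<And>x a. \<lbrakk>a \<in> carrier A; x \<in> carrier M\<rbrakk> \<Longrightarrow> h (r x a) = r' (h x) a"
      using that by (auto simp: RModCat_def concrete_cat_def)
    show "linear_map k M N h" by (rule h(1))
    fix x b assume xb: "x \<in> carrier M" "b \<in> carrier B"
    show "h (?r M r x b) = ?r N r' (h x) b"
      by (rule induced_right_natural[OF rmod_transfer[OF s MN(1)] rmod_transfer[OF s MN(2)] h(1)])
        (simp_all add: h(2) xb)
  qed
  show ?thesis
    unfolding rmod_functor_of_def
    by (rule forgetful_functorI[OF RModCat_def RModCat_is_category RModCat_def])
      (auto simp: obj arr)
qed

text \<open>On \<open>A\<close> itself the equations \<open>a' (b \<cdot> a) = (a' \<cdot> b) a\<close> that define the induced action are an axiom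
  of extensions, so the given structure solves them.\<close>

lemma ext_functor_of_regular:
  assumes s: "(lA, rA) \<in> extension_structures k B A"
  shows "snd (on_obj (ext_functor_of (lA, rA)) (regular_ext k A)) = (lA, rA)"
proof -
  let ?N = "normalise k A"
  have N: "(mult ?N, mult ?N) \<in> extension_structures k A ?N"
    using regular_obj by (simp add: regular_ext_def ExtCat_Obj_iff)
  interpret E: extension_transfer k B A lA rA ?N "mult ?N" "mult ?N" by (rule ext_transfer[OF s N])
  have ext: "lA \<in> extensional2 (carrier B) (carrier A)" "rA \<in> extensional2 (carrier A) (carrier B)"
    using s by (auto simp: extension_structures_def)
  have "E.L.ind b a = lA b a" "E.R.ind a b = rA a b" if "a \<in> carrier A" "b \<in> carrier B" for a b
    using that extension_structures_closed[OF s that]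
    by (auto intro!: E.L.ind_eqI E.R.ind_eqI simp: E.L.mult_act_simps)
  then have "E.L.ind = lA" "E.R.ind = rA"
    using ext induced_left_extensional[of B A ?N] induced_right_extensional[of B A ?N]
    by (auto intro!: extensional2_eqI)
  then show ?thesis
    using regular_obj by (simp add: ext_functor_of_def forgetful_def regular_ext_def)
qed

lemma ext_functor_of_mem:
  assumes s: "(lA, rA) \<in> extension_structures k B A"
  shows "ext_functor_of (lA, rA) \<in> ext_functors k B A"
proof -
  note F = ext_functor_of_functor[OF s]
  note then_F = then_forgetful[OF ExtCat_def F[unfolded ext_functor_of_def prod.case]]
  have "then_functor (ExtCat k A) (ext_functor_of (lA, rA)) (Ext_to_Mod k B) = Ext_to_Mod k A"
    unfolding Ext_to_Mod_def ext_functor_of_def prod.case then_F by (simp add: case_prod_unfold)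
  moreover have "then_functor (ExtCat k A) (ext_functor_of (lA, rA)) (Ext_to_Alg k B) = Ext_to_Alg k A"
    unfolding Ext_to_Alg_def ext_functor_of_def prod.case then_F by (simp add: case_prod_unfold)
  ultimately show ?thesis using F by (simp add: ext_functors_def)
qed

text \<open>This is where functoriality pins down the functor. For an extension \<open>R\<close> of \<open>A\<close>, both \<open>A\<close> and
  \<open>R\<close> embed into the split extension, and in the \<open>B\<close>-extension assigned to it,
  \<open>b \<cdot> (a \<cdot> x) = (b \<cdot> a) \<cdot> x\<close> is an instance of left linearity of the multiplication.\<close>

lemma ext_functor_actions:
  assumes F: "F \<in> ext_functors k B A"
    and A: "on_obj F (regular_ext k A) = (N, lA, rA)"
    and X: "(R, l, r) \<in> Obj (ExtCat k A)" and FX: "on_obj F (R, l, r) = (R', l', r')"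
    and "a \<in> carrier A" "x \<in> carrier R" "b \<in> carrier B"
  shows "l' b (l a x) = l (lA b a) x" "r' (r x a) b = r x (rA a b)"
proof -
  obtain e :: "'u \<times> 'u \<Rightarrow> 'u" where "inj e"
    using card_of_Times_same_infinite[OF infinite] card_of_ordIso[of "UNIV \<times> UNIV" "UNIV :: 'u set"]
    by (auto simp: bij_betw_def)
  then interpret S: split_ext k A R l r e
    using X A_nondeg A_idem A_proj by unfold_locales (simp_all add: ExtCat_Obj_iff)
  have isF: "is_functor (ExtCat k A) (ExtCat k B) F"
    and over: "then_functor (ExtCat k A) F (Ext_to_Alg k B) = Ext_to_Alg k A"
    using F by (auto simp: ext_functors_def)
  note alg = functor_over_forgetful[OF ExtCat_def ExtCat_def isF over[unfolded Ext_to_Alg_def]]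
  have obj: "\<exists>l' r'. on_obj F (R, l, r) = (R, l', r') \<and> (l', r') \<in> extension_structures k B R"
    if "(R, l, r) \<in> Obj (ExtCat k A)" for R l r
    using alg(1)[OF that] by (cases "on_obj F (R, l, r)") (auto simp: ExtCat_Obj_iff)
  obtain lS rS where FS: "on_obj F (S.S, S.lS, S.rS) = (S.S, lS, rS)"
    and S: "(lS, rS) \<in> extension_structures k B S.S"
    using obj[OF S.S_obj] by blast
  have R': "R' = R" "(l', r') \<in> extension_structures k B R" using obj[OF X] FX by auto
  have N: "N = normalise k A" "(lA, rA) \<in> extension_structures k B A"
    using obj[OF regular_obj[unfolded regular_ext_def]] A extension_structures_normalise[OF A.algebra]
    by (auto simp: regular_ext_def)
  have arr: "(on_obj F X, h, on_obj F Y) \<in> Arr (ExtCat k B)" if "(X, h, Y) \<in> Arr (ExtCat k A)" for X h Y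
  proof -
    have "on_arr F (X, h, Y) \<in> Arr (ExtCat k B)" by (rule is_functor_mem(2)[OF isF that])
    then show ?thesis by (subst (asm) alg(2)) (simp add: forgetful_def that)
  qed
  have R: "normal_algebra k R" using X by (simp add: ExtCat_Obj_iff)
  note arrA = arr[OF S.A_to_S, unfolded A FS] and arrR = arr[OF S.R_to_S[OF R], unfolded FX FS]
  have lA: "lS b (e (a, \<zero>\<^bsub>R\<^esub>)) = e (lA b a, \<zero>\<^bsub>R\<^esub>)" "rS (e (a, \<zero>\<^bsub>R\<^esub>)) b = e (rA a b, \<zero>\<^bsub>R\<^esub>)"
    if "a \<in> carrier A" "b \<in> carrier B" for a b
    using ExtCat_ArrD[OF arrA[unfolded N(1)], of a b] extension_structures_closed[OF N(2) that] that
    by simp_all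
  have lR: "lS b (e (\<zero>\<^bsub>A\<^esub>, x)) = e (\<zero>\<^bsub>A\<^esub>, l' b x)" "rS (e (\<zero>\<^bsub>A\<^esub>, x)) b = e (\<zero>\<^bsub>A\<^esub>, r' x b)"
    if "x \<in> carrier R" "b \<in> carrier B" for x b
    using ExtCat_ArrD[OF arrR[unfolded R'(1)] that] extension_structures_closed[OF R'(2) that] that
    by simp_all
  have lin: "lS b (s \<otimes>\<^bsub>S.S\<^esub> t) = lS b s \<otimes>\<^bsub>S.S\<^esub> t" "rS (s \<otimes>\<^bsub>S.S\<^esub> t) b = s \<otimes>\<^bsub>S.S\<^esub> rS t b"
    if "s \<in> carrier S.S" "t \<in> carrier S.S" "b \<in> carrier B" for s t b
    using S that by (auto simp: extension_structures_def extension_def)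
  note ab = extension_structures_closed[OF N(2) assms(5,7)]
  show "l' b (l a x) = l (lA b a) x"
    using lin(1)[of "e (a, \<zero>\<^bsub>R\<^esub>)" "e (\<zero>\<^bsub>A\<^esub>, x)" b] assms(5-7) ab
    by (simp add: lA lR S.act_simps S.mult_simps)
  show "r' (r x a) b = r x (rA a b)"
    using lin(2)[of "e (\<zero>\<^bsub>A\<^esub>, x)" "e (a, \<zero>\<^bsub>R\<^esub>)" b] assms(5-7) ab
    by (simp add: lA lR S.act_simps S.mult_simps)
qed

lemma ext_functor_structure:
  assumes F: "F \<in> ext_functors k B A"
  shows "snd (on_obj F (regular_ext k A)) \<in> extension_structures k B A"
    and "ext_functor_of (snd (on_obj F (regular_ext k A))) = F"
proof -
  have isF: "is_functor (ExtCat k A) (ExtCat k B) F"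
    and over: "then_functor (ExtCat k A) F (Ext_to_Alg k B) = Ext_to_Alg k A"
    using F by (auto simp: ext_functors_def)
  note alg = functor_over_forgetful[OF ExtCat_def ExtCat_def isF over[unfolded Ext_to_Alg_def]]
  obtain N lA rA where A: "on_obj F (regular_ext k A) = (N, lA, rA)" by (cases "on_obj F (regular_ext k A)")
  then have s: "(lA, rA) \<in> extension_structures k B A"
    using alg(1)[OF regular_obj] extension_structures_normalise[OF A.algebra]
    by (auto simp: regular_ext_def ExtCat_Obj_iff)
  then show "snd (on_obj F (regular_ext k A)) \<in> extension_structures k B A" using A by simp
  have "(R, induced_left B A R l rA, induced_right B A R r lA) = on_obj F (R, l, r)"
    if X: "(R, l, r) \<in> Obj (ExtCat k A)" for R l r
  proof -
    obtain l' r' where FX: "on_obj F (R, l, r) = (R, l', r')" "(l', r') \<in> extension_structures k B R"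
      using alg(1)[OF X] by (cases "on_obj F (R, l, r)") (auto simp: ExtCat_Obj_iff)
    have "(l, r) \<in> extension_structures k A R" using X by (simp add: ExtCat_Obj_iff)
    then interpret E: extension_transfer k B A lA rA R l r by (rule ext_transfer[OF s])
    note act = ext_functor_actions[OF F A X FX(1)]
    have "l' b x = E.L.ind b x" "r' x b = E.R.ind x b" if "x \<in> carrier R" "b \<in> carrier B" for x b
      using E.L.ind_unique[OF extension_structuresD(3)[OF FX(2)]]
        E.R.ind_unique[OF extension_structuresD(4)[OF FX(2)]] act that by auto
    then have "l' = E.L.ind" "r' = E.R.ind"
      using FX(2) induced_left_extensional[of B A R] induced_right_extensional[of B A R]
      by (auto simp: extension_structures_def intro!: extensional2_eqI)
    then show ?thesis using FX(1) by simp
  qed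
  then have "ext_functor_of (lA, rA) = forgetful (ExtCat k A) (on_obj F)"
    unfolding ext_functor_of_def prod.case by (intro forgetful_cong[OF ExtCat_def]) auto
  then show "ext_functor_of (snd (on_obj F (regular_ext k A))) = F"
    using A alg(2) by simp
qed

theorem bij_betw_ext_functors_extension_structures:
  "bij_betw (\<lambda>F. snd (on_obj F (regular_ext k A))) (ext_functors k B A) (extension_structures k B A)"
proof (rule bij_betw_byWitness[where f' = ext_functor_of])
  show "\<forall>F\<in>ext_functors k B A. ext_functor_of (snd (on_obj F (regular_ext k A))) = F"
    using ext_functor_structure(2) by blast
  show "\<forall>s\<in>extension_structures k B A. snd (on_obj (ext_functor_of s) (regular_ext k A)) = s"
    using ext_functor_of_regular by auto
  show "(\<lambda>F. snd (on_obj F (regular_ext k A))) ` ext_functors k B A \<subseteq> extension_structures k B A"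
    using ext_functor_structure(1) by blast
  show "ext_functor_of ` extension_structures k B A \<subseteq> ext_functors k B A"
    using ext_functor_of_mem by auto
qed

lemma functor_triple_of_mem:
  assumes s: "(lA, rA) \<in> extension_structures k B A"
  shows "(ext_functor_of (lA, rA), rmod_functor_of lA, lmod_functor_of rA) \<in> functor_triples k B A"
proof -
  note F = ext_functor_of_functor[OF s] and Fr = rmod_functor_of_functor[OF s]
    and Fl = lmod_functor_of_functor[OF s]
  note then_F = then_forgetful[OF ExtCat_def F[unfolded ext_functor_of_def prod.case]]
  have "then_functor (ExtCat k A) (ext_functor_of (lA, rA)) (Ext_to_RMod k B)
      = then_functor (ExtCat k A) (Ext_to_RMod k A) (rmod_functor_of lA)"
    unfolding Ext_to_RMod_def ext_functor_of_def rmod_functor_of_def prod.case then_F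
      then_forgetful[OF ExtCat_def Ext_to_RMod_is_functor[unfolded Ext_to_RMod_def]]
    by (simp add: case_prod_unfold induced_right_def induced_left_def)
  moreover have "then_functor (ExtCat k A) (ext_functor_of (lA, rA)) (Ext_to_LMod k B)
      = then_functor (ExtCat k A) (Ext_to_LMod k A) (lmod_functor_of rA)"
    unfolding Ext_to_LMod_def ext_functor_of_def lmod_functor_of_def prod.case then_F
      then_forgetful[OF ExtCat_def Ext_to_LMod_is_functor[unfolded Ext_to_LMod_def]]
    by (simp add: case_prod_unfold induced_left_def)
  moreover have "then_functor (RModCat k A) (rmod_functor_of lA) (RMod_to_Mod k B) = RMod_to_Mod k A"
    unfolding RMod_to_Mod_def rmod_functor_of_def
      then_forgetful[OF RModCat_def Fr[unfolded rmod_functor_of_def]]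
    by (simp add: case_prod_unfold)
  moreover have "then_functor (LModCat k A) (lmod_functor_of rA) (LMod_to_Mod k B) = LMod_to_Mod k A"
    unfolding LMod_to_Mod_def lmod_functor_of_def
      then_forgetful[OF LModCat_def Fl[unfolded lmod_functor_of_def]]
    by (simp add: case_prod_unfold)
  ultimately show ?thesis
    using ext_functor_of_mem[OF s] F Fr Fl by (simp add: functor_triples_def ext_functors_def)
qed

lemma functor_triple_ext_functor:
  assumes "(F, Fr, Fl) \<in> functor_triples k B A"
  shows "F \<in> ext_functors k B A"
proof -
  have isF: "is_functor (ExtCat k A) (ExtCat k B) F"
    and over: "then_functor (ExtCat k A) F (Ext_to_Alg k B) = Ext_to_Alg k A"
    using assms by (auto simp: functor_triples_def)
  note alg = functor_over_forgetful[OF ExtCat_def ExtCat_def isF over[unfolded Ext_to_Alg_def]]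
  have "then_functor (ExtCat k A) F (Ext_to_Mod k B) =
      then_functor (ExtCat k A) (forgetful (ExtCat k A) (on_obj F)) (Ext_to_Mod k B)"
    using alg(2) by simp
  also have "\<dots> = forgetful (ExtCat k A) (\<lambda>X. case on_obj F X of (R, l, r) \<Rightarrow> forget_mult R)"
    unfolding Ext_to_Mod_def by (rule then_forgetful[OF ExtCat_def]) (use isF alg(2) in simp)
  also have "\<dots> = Ext_to_Mod k A"
    unfolding Ext_to_Mod_def
    by (rule forgetful_cong[OF ExtCat_def]) (use alg(1) in \<open>auto simp: case_prod_unfold\<close>)
  finally show ?thesis using isF over by (simp add: ext_functors_def)
qed

text \<open>For \<open>m\<close> in a right \<open>A\<close>-module \<open>M\<close> the map \<open>a \<mapsto> m \<cdot> a\<close> is a morphism from the regular module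
  to \<open>M\<close>, so that its image under the functor is \<open>B\<close>-linear: \<open>(m \<cdot> a) \<cdot> b = m \<cdot> (a \<cdot> b)\<close>.\<close>

lemma rmod_functor_unique:
  assumes T: "(F, Fr, Fl) \<in> functor_triples k B A" and A: "on_obj F (regular_ext k A) = (N, lA, rA)"
  shows "Fr = rmod_functor_of lA"
proof -
  have F: "F \<in> ext_functors k B A" by (rule functor_triple_ext_functor[OF T])
  have s: "(lA, rA) \<in> extension_structures k B A" using ext_functor_structure(1)[OF F] A by simp
  have isF: "is_functor (ExtCat k A) (ExtCat k B) F"
    and isFr: "is_functor (RModCat k A) (RModCat k B) Fr"
    and over: "then_functor (RModCat k A) Fr (RMod_to_Mod k B) = RMod_to_Mod k A"
    and comm: "then_functor (ExtCat k A) F (Ext_to_RMod k B) = then_functor (ExtCat k A) (Ext_to_RMod k A) Fr"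
    using T by (auto simp: functor_triples_def)
  note mod = functor_over_forgetful[OF RModCat_def RModCat_def isFr over[unfolded RMod_to_Mod_def]]
  let ?N = "forget_mult (normalise k A)" and ?m = "mult (normalise k A)"
  have "on_obj F (regular_ext k A) \<in> Obj (ExtCat k B)"
    by (rule is_functor_mem(1)[OF isF regular_obj])
  then have FA: "on_obj Fr (?N, ?m) = (forget_mult N, rA)"
    using arg_cong[OF comm, of "\<lambda>G. on_obj G (regular_ext k A)"] regular_obj A
    by (simp add: then_functor_def Ext_to_RMod_def forgetful_def regular_ext_def)
  have regular: "(?N, ?m) \<in> Obj (RModCat k A)"
    using is_functor_mem(1)[OF Ext_to_RMod_is_functor regular_obj] regular_obj
    by (simp add: Ext_to_RMod_def forgetful_def regular_ext_def)
  have "forget_mult N = ?N" using mod(1)[OF regular] FA by simp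
  then have N: "carrier N = carrier A" by (metis forget_mult_simps(1) normalise_simps(1))
  have "on_obj Fr (M, r) = (M, induced_right B A M r lA)" if X: "(M, r) \<in> Obj (RModCat k A)" for M r
  proof -
    interpret R: right_transfer k B A lA rA M r by (rule rmod_transfer[OF s X])
    obtain r' where FX: "on_obj Fr (M, r) = (M, r')" and r': "(M, r') \<in> Obj (RModCat k B)"
      using mod(1)[OF X] by (cases "on_obj Fr (M, r)") auto
    have act: "r' (r m a) b = r m (rA a b)" if "m \<in> carrier M" "a \<in> carrier A" "b \<in> carrier B" for m a b
    proof -
      let ?h = "\<lambda>a\<in>carrier A. r m a"
      have "linear_map k (normalise k A) M ?h"
        using R.M.lin_left[OF that(1)] by (simp add: linear_map_normalise[OF A.module_axioms] A.linear_map_restrict)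
      then have a: "((?N, ?m), ?h, (M, r)) \<in> Arr (RModCat k A)"
        using regular X that(1) by (auto simp: RModCat_def concrete_cat_def R.M.act_assoc R.M.act_closed)
      have "on_arr Fr ((?N, ?m), ?h, (M, r)) \<in> Arr (RModCat k B)"
        by (rule is_functor_mem(2)[OF isFr a])
      then have "(on_obj Fr (?N, ?m), ?h, on_obj Fr (M, r)) \<in> Arr (RModCat k B)"
        by (subst (asm) mod(2)) (simp add: forgetful_def a)
      then have "((forget_mult N, rA), ?h, (M, r')) \<in> Arr (RModCat k B)" by (simp only: FA FX)
      from RModCat_ArrD[OF this, of a b] show ?thesis
        using that extension_structures_closed[OF s that(2,3)] N by simp
    qed
    have "r' m b = R.ind m b" if "m \<in> carrier M" "b \<in> carrier B" for m b
      using r' act that by (intro R.ind_unique) (auto simp: RModCat_Obj_iff)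
    then have "r' = R.ind"
      using r' induced_right_extensional[of B A M]
      by (intro extensional2_eqI[of _ "carrier M" "carrier B"]) (auto simp: RModCat_Obj_iff)
    then show ?thesis using FX by simp
  qed
  then show ?thesis
    unfolding rmod_functor_of_def by (subst mod(2)) (auto intro!: forgetful_cong[OF RModCat_def])
qed

text \<open>The mirror image, with \<open>a \<mapsto> a \<cdot> m\<close> in place of \<open>a \<mapsto> m \<cdot> a\<close>.\<close>

lemma lmod_functor_unique:
  assumes T: "(F, Fr, Fl) \<in> functor_triples k B A" and A: "on_obj F (regular_ext k A) = (N, lA, rA)"
  shows "Fl = lmod_functor_of rA"
proof -
  have F: "F \<in> ext_functors k B A" by (rule functor_triple_ext_functor[OF T])
  have s: "(lA, rA) \<in> extension_structures k B A" using ext_functor_structure(1)[OF F] A by simp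
  have isF: "is_functor (ExtCat k A) (ExtCat k B) F"
    and isFl: "is_functor (LModCat k A) (LModCat k B) Fl"
    and over: "then_functor (LModCat k A) Fl (LMod_to_Mod k B) = LMod_to_Mod k A"
    and comm: "then_functor (ExtCat k A) F (Ext_to_LMod k B) = then_functor (ExtCat k A) (Ext_to_LMod k A) Fl"
    using T by (auto simp: functor_triples_def)
  note mod = functor_over_forgetful[OF LModCat_def LModCat_def isFl over[unfolded LMod_to_Mod_def]]
  let ?N = "forget_mult (normalise k A)" and ?m = "mult (normalise k A)"
  have "on_obj F (regular_ext k A) \<in> Obj (ExtCat k B)"
    by (rule is_functor_mem(1)[OF isF regular_obj])
  then have FA: "on_obj Fl (?N, ?m) = (forget_mult N, lA)"
    using arg_cong[OF comm, of "\<lambda>G. on_obj G (regular_ext k A)"] regular_obj A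
    by (simp add: then_functor_def Ext_to_LMod_def forgetful_def regular_ext_def)
  have regular: "(?N, ?m) \<in> Obj (LModCat k A)"
    using is_functor_mem(1)[OF Ext_to_LMod_is_functor regular_obj] regular_obj
    by (simp add: Ext_to_LMod_def forgetful_def regular_ext_def)
  have "forget_mult N = ?N" using mod(1)[OF regular] FA by simp
  then have N: "carrier N = carrier A" by (metis forget_mult_simps(1) normalise_simps(1))
  have "on_obj Fl (M, l) = (M, induced_left B A M l rA)" if X: "(M, l) \<in> Obj (LModCat k A)" for M l
  proof -
    interpret L: left_transfer k B A lA rA M l by (rule lmod_transfer[OF s X])
    obtain l' where FX: "on_obj Fl (M, l) = (M, l')" and l': "(M, l') \<in> Obj (LModCat k B)"
      using mod(1)[OF X] by (cases "on_obj Fl (M, l)") auto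
    have act: "l' b (l a m) = l (lA b a) m" if "m \<in> carrier M" "a \<in> carrier A" "b \<in> carrier B" for m a b
    proof -
      let ?h = "\<lambda>a\<in>carrier A. l a m"
      have "linear_map k (normalise k A) M ?h"
        using L.M.lin_left[OF that(1)] by (simp add: linear_map_normalise[OF A.module_axioms] A.linear_map_restrict)
      then have a: "((?N, ?m), ?h, (M, l)) \<in> Arr (LModCat k A)"
        using regular X that(1) by (auto simp: LModCat_def concrete_cat_def L.M.act_assoc L.M.act_closed)
      have "on_arr Fl ((?N, ?m), ?h, (M, l)) \<in> Arr (LModCat k B)"
        by (rule is_functor_mem(2)[OF isFl a])
      then have "(on_obj Fl (?N, ?m), ?h, on_obj Fl (M, l)) \<in> Arr (LModCat k B)"
        by (subst (asm) mod(2)) (simp add: forgetful_def a)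
      then have "((forget_mult N, lA), ?h, (M, l')) \<in> Arr (LModCat k B)" by (simp only: FA FX)
      from LModCat_ArrD[OF this, of a b] show ?thesis
        using that extension_structures_closed[OF s that(2,3)] N by simp
    qed
    have "l' b m = L.ind b m" if "m \<in> carrier M" "b \<in> carrier B" for m b
      using l' act that by (intro L.ind_unique) (auto simp: LModCat_Obj_iff)
    then have "l' = L.ind"
      using l' induced_left_extensional[of B A M]
      by (intro extensional2_eqI[of _ "carrier B" "carrier M"]) (auto simp: LModCat_Obj_iff)
    then show ?thesis using FX by simp
  qed
  then show ?thesis
    unfolding lmod_functor_of_def by (subst mod(2)) (auto intro!: forgetful_cong[OF LModCat_def])
qed

theorem bij_betw_functor_triples_ext_functors:
  "bij_betw (\<lambda>(F, Fr, Fl). F) (functor_triples k B A) (ext_functors k B A)"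
proof (rule bij_betw_byWitness[where f' = "\<lambda>F. case on_obj F (regular_ext k A) of (N, lA, rA) \<Rightarrow>
    (F, rmod_functor_of lA, lmod_functor_of rA)"])
  show "\<forall>T\<in>functor_triples k B A. (case on_obj ((\<lambda>(F, Fr, Fl). F) T) (regular_ext k A) of (N, lA, rA) \<Rightarrow>
      ((\<lambda>(F, Fr, Fl). F) T, rmod_functor_of lA, lmod_functor_of rA)) = T"
  proof
    fix T assume "T \<in> functor_triples k B A"
    moreover obtain F Fr Fl where T: "T = (F, Fr, Fl)" by (cases T)
    moreover obtain N lA rA where A: "on_obj F (regular_ext k A) = (N, lA, rA)"
      by (cases "on_obj F (regular_ext k A)")
    ultimately show "(case on_obj ((\<lambda>(F, Fr, Fl). F) T) (regular_ext k A) of (N, lA, rA) \<Rightarrow>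
      ((\<lambda>(F, Fr, Fl). F) T, rmod_functor_of lA, lmod_functor_of rA)) = T"
      using rmod_functor_unique lmod_functor_unique by simp
  qed
  show "(\<lambda>F. case on_obj F (regular_ext k A) of (N, lA, rA) \<Rightarrow>
      (F, rmod_functor_of lA, lmod_functor_of rA)) ` ext_functors k B A \<subseteq> functor_triples k B A"
  proof (rule image_subsetI)
    fix F assume F: "F \<in> ext_functors k B A"
    obtain N lA rA where A: "on_obj F (regular_ext k A) = (N, lA, rA)"
      by (cases "on_obj F (regular_ext k A)")
    then show "(case on_obj F (regular_ext k A) of (N, lA, rA) \<Rightarrow>
      (F, rmod_functor_of lA, lmod_functor_of rA)) \<in> functor_triples k B A"
      using functor_triple_of_mem[of lA rA] ext_functor_structure[OF F] by simp
  qed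
qed (auto split: prod.splits intro: functor_triple_ext_functor)

end

theorem theorem1p10:
  fixes k :: "'k ring" and A :: "('k, 'u) module" and B :: "('k, 'b) module"
  assumes "infinite (UNIV :: 'u set)"
    and "cring k"
    and "nonunital_algebra k A" and "nondegenerate_algebra A" and "idempotent_algebra A"
    and "projective k A"
    and "nonunital_algebra k B"
  shows
    "bij_betw (induced_actions B A) (multiplier_maps k B A) (extension_structures k B A) \<and>
     bij_betw (\<lambda>(F, Fr, Fl). F) (functor_triples k B A) (ext_functors k B A) \<and>
     bij_betw (\<lambda>F. snd (on_obj F (regular_ext k A)))
       (ext_functors k B A) (extension_structures k B A) \<and>
     (\<forall>f\<in>multiplier_maps k B A.
        \<exists>!f'. f' \<in> extensional (carrier (multiplier_algebra k B)) \<and>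
             unital_algebra_map k (multiplier_algebra k B) (multiplier_algebra k A) f' \<and>
             (\<forall>b\<in>carrier B. f' (\<iota> B b) = f b))"
proof -
  interpret base_algebras k A B
    by unfold_locales (use assms in blast)+
  show ?thesis
    using A.bij_betw_multiplier_maps_extension_structures[OF assms(7)]
      bij_betw_functor_triples_ext_functors bij_betw_ext_functors_extension_structures
      A.extends_to_multiplier_algebra[OF assms(7)]
    by blast
qed

end
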